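(* Let $n=2m$, let $D$ be the open $SL(m,\mathbb{H})$-orbit in the manifold $Z$ of complete flags in $\mathbb{C}^{n}$, $C_0\subset D$ its base cycle, and let $\mathcal{S}_{C_0}$ be the set of Iwasawa–Schubert varieties $S_w$ with $\dim S_w+\dim C_0=\dim Z$ and $S_w\cap C_0\ne\emptyset$. There is a bijection between $\Sigma_m$ and $\mathcal{S}_{C_0}$ sending $s=s_1\dots s_m\in\Sigma_m$ to $S_w$, where $w=k_1\dots k_ml_m\dots l_1\in\Sigma_{2m}$ is given by $k_i=2s_i-1$ and $l_i=k_i+1$ for all $1\le i\le m$. Conversely, each $w=k_1\dots k_ml_m\dots l_1$ that parametrizes an element of $\mathcal{S}_{C_0}$ gives the unique element of $\Sigma_m$ defined by $s_i=(k_i+1)/2$ for all $1\le i\le m$. Thus the cardinality of $\mathcal{S}_{C_0}$ is $m!$.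
   Context: Let $\mathbf{j}(v)=J\bar v$ on $\mathbb{C}^{2m}$ with $J=\begin{pmatrix}0&I_m\\-I_m&0\end{pmatrix}$, so $\mathbf{j}(e_i)=-e_{m+i}$ for $1\le i\le m$. $G=SL(2m,\mathbb{C})$, $G_0=SL(m,\mathbb{H})=\{X\in G:\mathbf{j}X=X\mathbf{j}\}$, $K_0=SU(2m)\cap G_0=Sp(m)$. $G_0$ has exactly one open orbit $D$ in $Z$. The base cycle $C_0$ is the unique $K_0$-orbit in $D$ that is a complex submanifold. Let $(u_1,\dots,u_n)=(e_1,\mathbf{j}(e_1),e_2,\mathbf{j}(e_2),\dots,e_m,\mathbf{j}(e_m))$ and let $B_I\subset G$ be the (Iwasawa–)Borel subgroup stabilizing the complete flag of this ordered basis. For $w\in\Sigma_n$ in one-line notation, $V_w$ is the complete flag with $k$-th subspace $\langle u_{w(1)},\dots,u_{w(k)}\rangle$, and the Iwasawa–Schubert variety $S_w$ is the closure of $B_I.V_w$. *)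

theory Defs
  imports "HOL-Analysis.Analysis" "HOL-Combinatorics.Permutations"
begin

text \<open>
  Throughout, \<open>m = CARD('m)\<close> and \<open>n = 2m\<close>. The coordinates of \<open>\<complex>\<^sup>n\<close> are indexed by the sum type
  \<open>'m + 'm\<close>, whose canonical enumeration lists all \<open>Inl\<close>-coordinates (positions \<open>1..m\<close>) before all
  \<open>Inr\<close>-coordinates (positions \<open>m+1..2m\<close>). Every cardinality \<open>m \<ge> 1\<close> is realised by a type of
  class \<open>enum\<close>.
\<close>

type_synonym 'm cvec = "complex ^ ('m + 'm)"
type_synonym 'm cmat = "complex ^ ('m + 'm) ^ ('m + 'm)"
type_synonym 'm flag = "nat \<Rightarrow> (complex ^ ('m + 'm)) set"
type_synonym 'm coords = "complex ^ (('m + 'm) \<times> ('m + 'm))"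


section \<open>The groups\<close>

definition jmap :: "'m::finite cvec \<Rightarrow> 'm cvec" where
  "jmap v = (\<chi> i. case i of Inl a \<Rightarrow> cnj (v $ Inr a) | Inr a \<Rightarrow> - cnj (v $ Inl a))"

definition SL :: "'m::finite cmat set" where
  "SL = {A. det A = 1}"

definition SLH :: "'m::finite cmat set" where
  "SLH = {X \<in> SL. \<forall>v. jmap (X *v v) = X *v jmap v}"

definition conj_transpose :: "'m::finite cmat \<Rightarrow> 'm cmat" where
  "conj_transpose A = (\<chi> i j. cnj (A $ j $ i))"

definition SU :: "'m::finite cmat set" where
  "SU = {A \<in> SL. conj_transpose A ** A = mat 1}"

definition K0 :: "'m::finite cmat set" where
  "K0 = SU \<inter> SLH"


section \<open>Complete flags\<close>

text \<open>
  A complete flag is the function sending \<open>k\<close> to its \<open>k\<close>-dimensional member; since functions are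
  total, its values are fixed to be the whole space for \<open>k > n\<close> (forced by the dimension).
\<close>

definition flags :: "'m::finite flag set" where
  "flags = {V. mono V \<and> (\<forall>k. vec.subspace (V k) \<and> vec.dim (V k) = min k (2 * CARD('m)))}"

definition flag_of :: "(nat \<Rightarrow> 'm::finite cvec) \<Rightarrow> 'm flag" where
  "flag_of b = (\<lambda>k. vec.span (b ` {1..min k (2 * CARD('m))}))"

definition act :: "'m::finite cmat \<Rightarrow> 'm flag \<Rightarrow> 'm flag" where
  "act g V = (\<lambda>k. (*v) g ` V k)"

definition orbit :: "'m::finite cmat set \<Rightarrow> 'm flag \<Rightarrow> 'm flag set" where
  "orbit H V = (\<lambda>g. act g V) ` H"

definition coord :: "nat \<Rightarrow> 'm::enum + 'm" where
  "coord k = (enum_class.enum :: ('m + 'm) list) ! (k - 1)"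

definition e :: "nat \<Rightarrow> 'm::enum cvec" where
  "e k = axis (coord k) 1"

lemma jmap_e:
  assumes "i \<in> {1..CARD('m)}"
  shows "jmap (e i :: 'm::enum cvec) = - e (CARD('m) + i)"
proof -
  have l: "length (enum_class.enum :: 'm list) = CARD('m)"
    by (simp add: card_UNIV_length_enum)
  have a: "coord i = (Inl (enum_class.enum ! (i - 1)) :: 'm + 'm)"
    using assms l by (auto simp: coord_def enum_sum_def nth_append)
  have b: "coord (CARD('m) + i) = (Inr (enum_class.enum ! (i - 1)) :: 'm + 'm)"
    using assms l by (auto simp: coord_def enum_sum_def nth_append)
  show ?thesis
    unfolding vec_eq_iff e_def a b jmap_def by (auto simp: axis_def split: sum.splits)
qed

text \<open>The manifold topology on the flags is the quotient topology of \<open>SL(n,\<complex>) \<rightarrow> Z\<close>, \<open>g \<mapsto> g.F\<close>.\<close>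

definition flag_topology :: "'m::enum flag topology" where
  "flag_topology = topology (\<lambda>U. U \<subseteq> flags \<and>
     openin (top_of_set SL) {g \<in> SL. act g (flag_of e) \<in> U})"

lemma istopology_flag_topology:
  "istopology (\<lambda>U. U \<subseteq> flags \<and>
     openin (top_of_set SL) {g \<in> SL. act g (flag_of e) \<in> (U :: 'm::enum flag set)})"
proof -
  have 1: "{g \<in> SL. act g (flag_of e) \<in> S \<inter> T} =
      {g \<in> SL. act g (flag_of e) \<in> S} \<inter> {g \<in> SL. act g (flag_of e) \<in> T}"
    for S T :: "'m flag set" by auto
  have 2: "{g \<in> SL. act g (flag_of e) \<in> \<Union>K} = (\<Union>U\<in>K. {g \<in> SL. act g (flag_of e) \<in> U})"
    for K :: "'m flag set set" by auto
  show ?thesis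
    unfolding istopology_def 1 2 by (auto intro!: openin_Int openin_Union)
qed


section \<open>Complex submanifolds and dimension\<close>

definition holomorphic_map_on :: "(complex ^ 'k::finite \<Rightarrow> complex ^ 'k) \<Rightarrow> (complex ^ 'k) set \<Rightarrow> bool" where
  "holomorphic_map_on f U \<longleftrightarrow>
     (\<forall>x\<in>U. \<exists>f'. (f has_derivative f') (at x) \<and> (\<forall>c v. f' (c *s v) = c *s f' v))"

definition biholomorphic :: "(complex ^ 'k::finite \<Rightarrow> complex ^ 'k) \<Rightarrow> (complex ^ 'k) set \<Rightarrow> (complex ^ 'k) set \<Rightarrow> bool" where
  "biholomorphic h U U' \<longleftrightarrow> open U \<and> open U' \<and> bij_betw h U U' \<and>
     holomorphic_map_on h U \<and> holomorphic_map_on (inv_into U h) U'"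

definition submanifold_of_space :: "nat \<Rightarrow> (complex ^ 'k::finite) set \<Rightarrow> bool" where
  "submanifold_of_space d S \<longleftrightarrow>
     (\<forall>p\<in>S. \<exists>U U' h L. p \<in> U \<and> biholomorphic h U U' \<and>
        vec.subspace L \<and> vec.dim L = d \<and> h ` (S \<inter> U) = L \<inter> U')"

text \<open>
  The complex structure of the flag manifold is given by the charts inverse to
  \<open>X \<mapsto> g(1 + X).F\<close>, where \<open>g\<close> ranges over \<open>SL(n,\<complex>)\<close>, \<open>F\<close> is the flag of the standard basis and
  \<open>X\<close> over the strictly lower triangular matrices. These matrices are a linear subspace of the
  space \<open>'m coords\<close> of all matrices, so being a complex submanifold of the former or of the
  latter is the same.
\<close>

definition strictly_lower :: "'m::enum coords set" where
  "strictly_lower = {X. \<forall>k\<in>{1..2 * CARD('m)}. \<forall>l\<in>{1..k}. X $ (coord l, coord k) = 0}"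

definition flag_param :: "'m::enum cmat \<Rightarrow> 'm coords \<Rightarrow> 'm flag" where
  "flag_param g X =
     flag_of (\<lambda>k. g *v (e k + (\<Sum>l\<in>{k<..2 * CARD('m)}. X $ (coord l, coord k) *s e l)))"

definition complex_submanifold :: "nat \<Rightarrow> 'm::enum flag set \<Rightarrow> bool" where
  "complex_submanifold d S \<longleftrightarrow> S \<subseteq> flags \<and>
     (\<forall>g\<in>SL. submanifold_of_space d {X \<in> strictly_lower. flag_param g X \<in> S})"

text \<open>
  The complex dimension of an analytic subset (such as a Schubert variety, a complex submanifold
  or the flag manifold itself): the maximum of the dimensions at its regular points.
\<close>

definition complex_dim :: "'m::enum flag set \<Rightarrow> nat" where
  "complex_dim A = Max {d. \<exists>U. openin flag_topology U \<and> A \<inter> U \<noteq> {} \<and> complex_submanifold d (A \<inter> U)}"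


section \<open>The open orbit and the base cycle\<close>

definition open_orbit :: "'m::enum flag set" where
  "open_orbit = (THE D. (\<exists>V\<in>flags. D = orbit SLH V) \<and> openin flag_topology D)"

definition base_cycle :: "'m::enum flag set" where
  "base_cycle = (THE C. (\<exists>V\<in>flags. C = orbit K0 V) \<and> C \<subseteq> open_orbit \<and>
     (\<exists>d. complex_submanifold d C))"


section \<open>Iwasawa--Schubert varieties\<close>

definition u :: "nat \<Rightarrow> 'm::enum cvec" where
  "u k = (if odd k then e ((k + 1) div 2) else jmap (e (k div 2)))"

definition iwasawa_borel :: "'m::enum cmat set" where
  "iwasawa_borel = {g \<in> SL. act g (flag_of u) = flag_of u}"

definition perm_flag :: "(nat \<Rightarrow> nat) \<Rightarrow> 'm::enum flag" where
  "perm_flag w = flag_of (\<lambda>k. u (w k))"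

definition iwasawa_schubert :: "(nat \<Rightarrow> nat) \<Rightarrow> 'm::enum flag set" where
  "iwasawa_schubert w = flag_topology closure_of (orbit iwasawa_borel (perm_flag w))"

definition complementary_schubert_set :: "'m::enum flag set set" where
  "complementary_schubert_set = {iwasawa_schubert w | w. w permutes {1..2 * CARD('m)} \<and>
     complex_dim (iwasawa_schubert w :: 'm flag set) + complex_dim (base_cycle :: 'm flag set)
       = complex_dim (flags :: 'm flag set) \<and>
     (iwasawa_schubert w :: 'm flag set) \<inter> base_cycle \<noteq> {}}"

text \<open>
  The word \<open>k\<^sub>1 \<dots> k\<^sub>m l\<^sub>m \<dots> l\<^sub>1\<close> with \<open>k\<^sub>i = 2 s\<^sub>i - 1\<close> and \<open>l\<^sub>i = k\<^sub>i + 1\<close>; the entry \<open>l\<^sub>i\<close> is in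
  position \<open>2m + 1 - i\<close>.
\<close>

definition paired_perm :: "nat \<Rightarrow> (nat \<Rightarrow> nat) \<Rightarrow> nat \<Rightarrow> nat" where
  "paired_perm m s i =
     (if i \<in> {1..m} then 2 * s i - 1
      else if i \<in> {m<..2 * m} then (2 * s (2 * m + 1 - i) - 1) + 1
      else i)"

end

(*
  Write n = 2m, let omega(x, y) = <x, j y> be the complex symplectic form attached to j, and let
  U be the flag fixed by the Iwasawa-Borel group.

  The open orbit consists of the flags V with V_k \<inter> j V_{n-k} = 0 for all k: such a flag has an
  adapted basis f_1, ..., f_m, j f_m, ..., j f_1, and quaternionic matrices have positive determinant.
  The omega-isotropic flags are those for which this basis can be taken orthonormal, hence form one
  K_0-orbit. It is the only complex K_0-orbit in D: a complex K_0-orbit C is preserved by the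
  complexification of the diagonal torus of K_0 (identity theorem along imaginary directions, and
  compactness of C), so by a limit it contains a coordinate flag, and a coordinate flag lying in D
  is isotropic.

  The cell of w is locally a coordinate subspace of dimension inv(w), and it is open in its closure
  because it is cut out by the numbers dim (V_k \<inter> U_j), which are upper semicontinuous. A flag of
  S_w lies in the cell of some v that is below w in the Bruhat order. If it also lies in C_0, then
  j U_{2i} = U_{2i} and V_k \<inter> j V_{n-k} = 0 force
    #{p <= k. v(p) <= 2i} + #{p <= n-k. v(p) <= 2i} <= 2i.
  With c = ceil(v/2) this says that the word c dominates its reversal, so inv(c) is at least half of
  the 2m(m-1) pairs with different entries. Hence inv(v) >= m(m-1) = codim C_0, with equality only
  if c is a palindrome in which every odd value precedes its even partner.
*)
theory Submission
  imports Defs "HOL-Complex_Analysis.Complex_Analysis"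
begin

section \<open>Inversions and rank conditions\<close>

text \<open>The open orbit and the base cycle are definite descriptions, so each needs a uniqueness
  proof besides an example. For the orbit, uniqueness is density of \<open>opposite_flags\<close>.
  The obstacle is that j is conjugate-linear: the determinants that detect opposition are not
  holomorphic along a complex line of matrices, but at the real points of the line they agree with
  holomorphic ones, whose zeros are isolated. A complex submanifold is tested in every chart, and
  the dimension is a maximum over open pieces, so chart changes must be biholomorphic and local
  dimensions well defined. LU factorisation and the isotropy equations are both a linear plus a
  bilinear map, so one application of the inverse function theorem,
  \<open>quadratic_local_biholomorphic\<close>, serves both. The codimension m(m-1) of the base
  cycle is the number of pairs k < l with k + l <= n, each contributing one equation omega(f_k, f_l)
  = 0. The lower bound on inversions rests on opposition, so Schubert varieties of dimension below
  m(m-1) miss the whole open orbit.\<close>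

text \<open>For a permutation this is a rank number of the Bruhat order, the dimension of the
  intersection of a member of \<open>perm_flag w\<close> with a member of \<open>flag_of u\<close>;
  see \<open>dim_perm_flag_Int\<close>. Arbitrary words are allowed because it is also applied to
  words with repeated entries.\<close>

definition prefix_count :: "(nat \<Rightarrow> nat) \<Rightarrow> nat \<Rightarrow> nat \<Rightarrow> nat" where
  "prefix_count c k j = card {i \<in> {1..k}. c i \<le> j}"

definition inversions :: "nat \<Rightarrow> (nat \<Rightarrow> nat) \<Rightarrow> (nat \<times> nat) set" where
  "inversions n c = {(p, q). 1 \<le> p \<and> p < q \<and> q \<le> n \<and> c q < c p}"

lemma inversions_subset: "inversions n c \<subseteq> {1..n} \<times> {1..n}"
  by (auto simp: inversions_def)

lemma finite_inversions [simp]: "finite (inversions n c)"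
  by (rule finite_subset[OF inversions_subset]) simp

text \<open>An inversion moves along with the two swapped positions. Where this would reverse the
  order of its two positions, the pair itself stays inverted, since the larger value has moved to
  the left and the smaller one to the right. The pair of swapped positions is a new
  inversion.\<close>

lemma card_inversions_swap:
  assumes "1 \<le> i" "i < i'" "i' \<le> n" "d i < d i'"
  shows "card (inversions n d) < card (inversions n (d \<circ> Transposition.transpose i i'))"
proof -
  let ?s = "Transposition.transpose i i'"
  define f where "f = (\<lambda>(p, q). if ?s p < ?s q then (?s p, ?s q) else (p, q))"
  have inj: "inj_on f (inversions n d)"
  proof (rule inj_onI, clarify)
    fix p q p' q' assume "(p, q) \<in> inversions n d" "(p', q') \<in> inversions n d" "f (p, q) = f (p', q')"
    moreover have "?s x = ?s y \<longleftrightarrow> x = y" "?s x = y \<longleftrightarrow> x = ?s y" for x y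
      by (metis transpose_involutory)+
    ultimately show "p = p' \<and> q = q'"
      unfolding f_def inversions_def by (cases "?s p < ?s q"; cases "?s p' < ?s q'") auto
  qed
  have sub: "f ` inversions n d \<subseteq> inversions n (d \<circ> ?s)"
    using assms by (auto simp: f_def inversions_def Transposition.transpose_def split: if_splits)
  have new: "(i, i') \<in> inversions n (d \<circ> ?s)"
    using assms by (auto simp: inversions_def)
  have notin: "(i, i') \<notin> f ` inversions n d"
    using assms by (auto simp: f_def inversions_def Transposition.transpose_def split: if_splits)
  have "card (inversions n d) = card (f ` inversions n d)"
    using inj by (simp add: card_image)
  also have "\<dots> < card (inversions n (d \<circ> ?s))"
    using sub new notin by (intro psubset_card_mono) auto
  finally show ?thesis .
qed

lemma prefix_count_sum: "prefix_count c k j = (\<Sum>p\<in>{1..k}. of_bool (c p \<le> j))"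
  unfolding prefix_count_def of_bool_def by (simp add: sum.If_cases Int_def)

lemma prefix_count_cong: "(\<And>p. p \<in> {1..k} \<Longrightarrow> c p = d p) \<Longrightarrow> prefix_count c k j = prefix_count d k j"
  unfolding prefix_count_sum by (rule sum.cong) auto

lemma prefix_count_split:
  assumes "a \<le> b"
  shows "prefix_count c k b = prefix_count c k a + card {p \<in> {1..k}. a < c p \<and> c p \<le> b}"
proof -
  have "{i \<in> {1..k}. c i \<le> b} = {i \<in> {1..k}. c i \<le> a} \<union> {p \<in> {1..k}. a < c p \<and> c p \<le> b}"
    using assms by auto
  then show ?thesis
    unfolding prefix_count_def by (subst card_Un_disjoint[symmetric]) auto
qed

text \<open>The standard argument for the tableau criterion of the Bruhat order: as long as the two words
  differ, some transposition moves \<open>d\<close> strictly up without violating the rank conditions.\<close>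

lemma card_inversions_mono:
  assumes "\<And>k j. k \<le> n \<Longrightarrow> prefix_count c k j \<le> prefix_count d k j"
    and "\<And>j. prefix_count c n j = prefix_count d n j"
  shows "card (inversions n d) \<le> card (inversions n c) \<and>
    (card (inversions n d) = card (inversions n c) \<longrightarrow> (\<forall>i\<in>{1..n}. d i = c i))"
  using assms
\<comment> \<open>Each swap raises the number of inversions of \<open>d\<close>, which never exceeds
  \<open>n * n\<close>, so this deficit decreases.\<close>
proof (induction "n * n - card (inversions n d)" arbitrary: d rule: less_induct)
  case less
  show ?case
  proof (cases "\<forall>i\<in>{1..n}. d i = c i")
    case True
    then have "inversions n d = inversions n c"
      by (auto simp: inversions_def)
    with True show ?thesis by simp
  next
    case False
    define i where "i = (LEAST i. i \<in> {1..n} \<and> d i \<noteq> c i)"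
    have i: "i \<in> {1..n}" "d i \<noteq> c i"
      using False LeastI_ex[of "\<lambda>i. i \<in> {1..n} \<and> d i \<noteq> c i"] unfolding i_def by blast+
    have before: "d p = c p" if "p \<in> {1..<i}" for p
      using not_less_Least[of p "\<lambda>i. i \<in> {1..n} \<and> d i \<noteq> c i"] that i(1) unfolding i_def[symmetric] by auto
    define a b where "a = d i" and "b = c i"
    have split_i: "{1..i} = insert i {1..<i}" using i by auto
    have pre: "prefix_count x i b = of_bool (x i \<le> b) + (\<Sum>p\<in>{1..<i}. of_bool (x p \<le> b))" for x
      unfolding prefix_count_sum split_i by simp
    have "(\<Sum>p\<in>{1..<i}. of_bool (d p \<le> b)) = (\<Sum>p\<in>{1..<i}. of_bool (c p \<le> b) :: nat)"
      using before by (intro sum.cong) auto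
    \<comment> \<open>The prefixes agree before \<open>i\<close>, and \<open>c\<close> counts its
      own value \<open>b\<close> at \<open>i\<close>; the rank condition at \<open>(i, b)\<close>
      forces \<open>d\<close> to count there as well.\<close>
    with less.prems(1)[of i b] i have "d i \<le> b"
      unfolding pre by (auto simp: b_def of_bool_def split: if_splits)
    with i have ab: "a < b" by (auto simp: a_def b_def)
    have card_n: "card {p \<in> {1..n}. a < d p \<and> d p \<le> b} = card {p \<in> {1..n}. a < c p \<and> c p \<le> b}"
      using prefix_count_split[of a b d n] prefix_count_split[of a b c n] ab less.prems(2) by simp
    \<comment> \<open>Both words have equally many values in \<open>(a, b]\<close>. At
      \<open>i\<close> the word \<open>c\<close> has one, namely \<open>b\<close>, while
      \<open>d i = a\<close> is none, so \<open>d\<close> must make up for it later.\<close>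
    have ex: "\<exists>p. i < p \<and> p \<le> n \<and> a < d p \<and> d p \<le> b"
    proof (rule ccontr)
      assume "\<not> ?thesis"
      then have "{p \<in> {1..n}. a < d p \<and> d p \<le> b} \<subseteq> {p \<in> {1..<i}. a < c p \<and> c p \<le> b}"
        using before by (smt (verit) a_def atLeastAtMost_iff atLeastLessThan_iff linorder_neqE_nat
            mem_Collect_eq order_less_irrefl subsetI)
      also have "\<dots> \<subset> {p \<in> {1..n}. a < c p \<and> c p \<le> b}"
        using i ab by (auto simp: b_def)
      finally have "card {p \<in> {1..n}. a < d p \<and> d p \<le> b} < card {p \<in> {1..n}. a < c p \<and> c p \<le> b}"
        by (intro psubset_card_mono) auto
      with card_n show False by simp
    qed
    \<comment> \<open>Taking the first such position keeps values in \<open>(a, b]\<close> away from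
      the positions between \<open>i\<close> and \<open>i'\<close>, and this protects the rank
      conditions in \<open>mid\<close>.\<close>
    define i' where "i' = (LEAST p. i < p \<and> p \<le> n \<and> a < d p \<and> d p \<le> b)"
    have i': "i < i'" "i' \<le> n" "a < d i'" "d i' \<le> b"
      using LeastI_ex[OF ex] unfolding i'_def by blast+
    have between: "\<not> (a < d p \<and> d p \<le> b)" if "i < p" "p < i'" for p
      using not_less_Least[of p "\<lambda>p. i < p \<and> p \<le> n \<and> a < d p \<and> d p \<le> b"] that i'(2)
      unfolding i'_def[symmetric] by auto
    define d' where "d' = d \<circ> Transposition.transpose i i'"
    have gt: "card (inversions n d) < card (inversions n d')"
      unfolding d'_def using i i' by (intro card_inversions_swap) (auto simp: a_def)
    have bound: "card (inversions n d') \<le> n * n"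
      using card_mono[OF _ inversions_subset[of n d']] by simp
    have same: "prefix_count d' k j = prefix_count d k j" if "k < i \<or> i' \<le> k" for k j
    proof (cases "k < i")
      case True
      then show ?thesis using i' by (intro prefix_count_cong) (auto simp: d'_def Transposition.transpose_def)
    next
      case False
      with that have "Transposition.transpose i i' permutes {1..k}"
        using i i' by (intro permutes_swap_id) auto
      then show ?thesis
        unfolding prefix_count_sum d'_def o_def
        by (rule sum.permute[symmetric, unfolded o_def, of _ _ "\<lambda>p. of_bool (d p \<le> j)"])
    qed
    \<comment> \<open>The swap lowers a count only for \<open>a \<le> j < d i'\<close>, and then by
      one. For such \<open>j\<close> the word \<open>c\<close> has strictly more values in
      \<open>(j, b]\<close> than \<open>d\<close> among the first \<open>k\<close>, so its count at
      \<open>j\<close> was strictly smaller and the loss is affordable.\<close>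
    have mid: "prefix_count c k j \<le> prefix_count d' k j" if k: "i \<le> k" "k < i'" for k j
    proof -
      have ik: "i \<in> {1..k}" using i k by auto
      have eqd: "prefix_count x k j = of_bool (x i \<le> j) + (\<Sum>p\<in>{1..k} - {i}. of_bool (x p \<le> j))" for x
        unfolding prefix_count_sum by (rule sum.remove) (use ik in auto)
      have rest: "(\<Sum>p\<in>{1..k} - {i}. of_bool (d' p \<le> j)) = (\<Sum>p\<in>{1..k} - {i}. of_bool (d p \<le> j) :: nat)"
        using k by (intro sum.cong) (auto simp: d'_def Transposition.transpose_def)
      have d'i: "d' i = d i'" by (simp add: d'_def)
      show ?thesis
      proof (cases "a \<le> j \<and> j < d i'")
        case True
        have "{p \<in> {1..k}. j < d p \<and> d p \<le> b} \<subseteq> {p \<in> {1..<i}. j < c p \<and> c p \<le> b}"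
        proof
          fix p assume p: "p \<in> {p \<in> {1..k}. j < d p \<and> d p \<le> b}"
          then have pk: "p \<le> k" "j < d p" "d p \<le> b" by simp_all
          have "\<not> i < p"
          proof
            assume "i < p"
            then have "\<not> (a < d p \<and> d p \<le> b)" using pk k by (intro between) simp_all
            with pk True show False by simp
          qed
          moreover have "p \<noteq> i" using pk True by (auto simp: a_def)
          ultimately have "p < i" by simp
          with p before show "p \<in> {p \<in> {1..<i}. j < c p \<and> c p \<le> b}" by auto
        qed
        also have "\<dots> \<subset> {p \<in> {1..k}. j < c p \<and> c p \<le> b}"
        proof
          show "{p \<in> {1..<i}. j < c p \<and> c p \<le> b} \<subseteq> {p \<in> {1..k}. j < c p \<and> c p \<le> b}" using k by auto
          have "i \<in> {p \<in> {1..k}. j < c p \<and> c p \<le> b}" using ik True i' by (simp add: b_def)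
          then show "{p \<in> {1..<i}. j < c p \<and> c p \<le> b} \<noteq> {p \<in> {1..k}. j < c p \<and> c p \<le> b}" by fastforce
        qed
        finally have "card {p \<in> {1..k}. j < d p \<and> d p \<le> b} < card {p \<in> {1..k}. j < c p \<and> c p \<le> b}"
          by (intro psubset_card_mono) auto
        moreover have "prefix_count c k b \<le> prefix_count d k b"
          using less.prems(1) k i' by simp
        ultimately have "prefix_count c k j < prefix_count d k j"
          using prefix_count_split[of j b d k] prefix_count_split[of j b c k] True i' by simp
        then show ?thesis using True unfolding eqd[of d] eqd[of d'] rest d'i a_def by simp
      next
        case False
        then have "of_bool (d' i \<le> j) = (of_bool (d i \<le> j) :: nat)"
          using i' unfolding d'i a_def by auto
        then have "prefix_count d' k j = prefix_count d k j"
          unfolding eqd[of d] eqd[of d'] rest by simp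
        with less.prems(1)[of k j] k i' show ?thesis by simp
      qed
    qed
    have "card (inversions n d') \<le> card (inversions n c)"
    proof (rule less.hyps[THEN conjunct1])
      show "n * n - card (inversions n d') < n * n - card (inversions n d)"
        using gt bound by simp
      show "prefix_count c k j \<le> prefix_count d' k j" if "k \<le> n" for k j
        using mid[of k j] same[of k j] less.prems(1)[OF that, of j] by (cases "k < i \<or> i' \<le> k") auto
      show "prefix_count c n j = prefix_count d' n j" for j
        using same[of n j] less.prems(2) i' by simp
    qed
    with gt show ?thesis by simp
  qed
qed

text \<open>Words that dominate each other have equally many inversions, and the equality case of
  \<open>card_inversions_mono\<close> identifies them.\<close>

lemma prefix_count_inject:
  assumes "\<And>k j. k \<le> n \<Longrightarrow> prefix_count c k j = prefix_count d k j"
  shows "\<forall>i\<in>{1..n}. c i = d i"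
proof -
  have *: "(card (inversions n d) = card (inversions n c) \<longrightarrow> (\<forall>i\<in>{1..n}. d i = c i))"
    "card (inversions n d) \<le> card (inversions n c)" "card (inversions n c) \<le> card (inversions n d)"
    using card_inversions_mono[of n c d] card_inversions_mono[of n d c] assms by auto
  then show ?thesis by auto
qed

section \<open>Words of classes: the values 2t-1 and 2t form the class t\<close>

lemma halves_eq_iff: "1 \<le> t \<Longrightarrow> (x + 1) div 2 = t \<longleftrightarrow> x = 2 * t - 1 \<or> x = 2 * t" for x t :: nat
  by presburger

lemma halves_less_iff: "(x + 1) div 2 \<noteq> (y + 1) div 2 \<Longrightarrow> (x + 1) div 2 < (y + 1) div 2 \<longleftrightarrow> x < y" for x y :: nat
  by presburger

lemma card_permutes_halves:
  fixes w :: "nat \<Rightarrow> nat"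
  assumes w: "w permutes {1..2 * m}" and t: "t \<in> {1..m}"
  shows "card {q \<in> {1..2 * m}. (w q + 1) div 2 = t} = 2"
proof -
  have "{q \<in> {1..2 * m}. (w q + 1) div 2 = t} = {q \<in> {1..2 * m}. w q = 2 * t - 1 \<or> w q = 2 * t}"
    using t halves_eq_iff[of t] by (metis (no_types, lifting) atLeastAtMost_iff)
  also have "\<dots> = inv w ` {2 * t - 1, 2 * t}"
  proof -
    have "q \<in> {1..2 * m} \<and> w q = y \<longleftrightarrow> q = inv w y" if "y \<in> {1..2 * m}" for q y
      by (metis permutes_in_image[OF w] permutes_inv_eq[OF w] that)
    moreover have "2 * t - 1 \<in> {1..2 * m}" "2 * t \<in> {1..2 * m}" using t by auto
    ultimately show ?thesis by blast
  qed
  also have "card \<dots> = card {2 * t - 1, 2 * t}"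
    by (rule card_image) (rule inj_on_subset[OF permutes_inj[OF permutes_inv[OF w]]], simp)
  also have "2 * t - 1 \<noteq> 2 * t" using t by auto
  then have "card {2 * t - 1, 2 * t} = 2" by simp
  finally show ?thesis .
qed

text \<open>Every position shares its class with exactly two positions, itself included. Of the
  \<open>(2 * m)^2\<close> ordered pairs this leaves \<open>4 * m^2 - 4 * m\<close> with different
  classes, and half of them are increasing pairs of positions.\<close>

lemma card_unequal_halves:
  assumes w: "w permutes {1..2 * m}"
  shows "card {(p, q). 1 \<le> p \<and> p < q \<and> q \<le> 2 * m \<and> (w p + 1) div 2 \<noteq> (w q + 1) div 2} = 2 * (m * (m - 1))"
proof -
  define c where "c = (\<lambda>p. (w p + 1) div 2)"
  let ?U = "{1..2 * m} \<times> {1..2 * m}"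
  let ?A = "{(p, q). 1 \<le> p \<and> p < q \<and> q \<le> 2 * m \<and> c p \<noteq> c q}"
  let ?E = "{z \<in> ?U. c (fst z) = c (snd z)}"
  have finA: "finite ?A" by (rule finite_subset[of _ ?U]) auto
  have cr: "c p \<in> {1..m}" if "p \<in> {1..2 * m}" for p
    using permutes_in_image[OF w, of p] that by (auto simp: c_def)
  have E_eq: "?E = Sigma {1..2 * m} (\<lambda>p. {q \<in> {1..2*m}. c q = c p})" by auto
  have "card ?E = (\<Sum>p\<in>{1..2 * m}. card {q \<in> {1..2*m}. c q = c p})"
    unfolding E_eq by (rule card_SigmaI) simp_all
  also have "\<dots> = (\<Sum>p\<in>{1..2 * m}. 2)"
    using card_permutes_halves[OF w cr] by (intro sum.cong) (auto simp: c_def)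
  finally have E: "card ?E = 4 * m" by simp
  have dec: "?U - ?E = ?A \<union> prod.swap ` ?A"
    by (auto simp: image_iff) (metis linorder_neqE_nat)+
  have "card (?U - ?E) = card ?A + card (prod.swap ` ?A)"
    unfolding dec by (rule card_Un_disjoint) (use finA in auto)
  also have "card (prod.swap ` ?A) = card ?A" by (simp add: card_image)
  finally have "2 * card ?A = card (?U - ?E)" by simp
  also have "\<dots> = card ?U - card ?E"
    by (rule card_Diff_subset) auto
  also have "\<dots> = 2 * m * (2 * m) - 4 * m"
    unfolding E by (simp add: card_cartesian_product)
  finally have "card ?A = 2 * m * m - 2 * m" by simp
  also have "\<dots> = 2 * (m * (m - 1))" by (cases m) auto
  finally show ?thesis by (simp add: c_def)
qed

definition reflect :: "nat \<Rightarrow> (nat \<Rightarrow> nat) \<Rightarrow> nat \<Rightarrow> nat" where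
  "reflect n c i = c (n + 1 - i)"

lemma card_inversions_reflect:
  assumes "1 \<le> n"
  shows "card (inversions n (reflect n c)) = card {(p, q). 1 \<le> p \<and> p < q \<and> q \<le> n \<and> c p < c q}"
proof (rule bij_betw_same_card)
  show "bij_betw (\<lambda>(p, q). (n + 1 - q, n + 1 - p)) (inversions n (reflect n c))
     {(p, q). 1 \<le> p \<and> p < q \<and> q \<le> n \<and> c p < c q}"
    by (rule bij_betw_byWitness[where f' = "\<lambda>(p, q). (n + 1 - q, n + 1 - p)"])
      (auto simp: inversions_def reflect_def)
qed

text \<open>A pair of positions with different classes is inverted either in the word or, after
  reflection, in its reversal, and never in both.\<close>

lemma card_inversions_halves:
  assumes w: "w permutes {1..2 * m}" and m: "1 \<le> m"
  defines "c \<equiv> \<lambda>p. (w p + 1) div 2"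
  shows "card (inversions (2 * m) c) + card (inversions (2 * m) (reflect (2 * m) c)) = 2 * (m * (m - 1))"
proof -
  let ?B = "{(p, q). 1 \<le> p \<and> p < q \<and> q \<le> 2 * m \<and> c p < c q}"
  have fin: "finite ?B" by (rule finite_subset[of _ "{1..2*m} \<times> {1..2*m}"]) auto
  have "card (inversions (2*m) c \<union> ?B) = card (inversions (2*m) c) + card ?B"
    by (rule card_Un_disjoint[OF finite_inversions fin]) (auto simp: inversions_def)
  moreover have "inversions (2*m) c \<union> ?B = {(p, q). 1 \<le> p \<and> p < q \<and> q \<le> 2 * m \<and> c p \<noteq> c q}"
    by (auto simp: inversions_def)
  moreover have "card {(p, q). 1 \<le> p \<and> p < q \<and> q \<le> 2 * m \<and> c p \<noteq> c q} = 2 * (m * (m - 1))"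
    unfolding c_def by (rule card_unequal_halves[OF w])
  moreover have "card (inversions (2 * m) (reflect (2 * m) c)) = card ?B"
    using m by (intro card_inversions_reflect) simp
  ultimately show ?thesis by simp
qed

lemma prefix_count_reflect:
  assumes "k \<le> n"
  shows "prefix_count (reflect n c) k j + prefix_count c (n - k) j = prefix_count c n j"
proof -
  have "bij_betw (\<lambda>i. n + 1 - i) {i \<in> {1..k}. reflect n c i \<le> j} {i \<in> {n - k<..n}. c i \<le> j}"
    by (rule bij_betw_byWitness[where f' = "\<lambda>i. n + 1 - i"]) (use assms in \<open>auto simp: reflect_def\<close>)
  then have A: "card {i \<in> {1..k}. reflect n c i \<le> j} = card {i \<in> {n - k<..n}. c i \<le> j}"
    by (rule bij_betw_same_card)
  have B: "{i \<in> {1..n}. c i \<le> j} = {i \<in> {n - k<..n}. c i \<le> j} \<union> {i \<in> {1..n-k}. c i \<le> j}"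
    by auto
  have C: "card ({i \<in> {n - k<..n}. c i \<le> j} \<union> {i \<in> {1..n-k}. c i \<le> j}) =
      card {i \<in> {n - k<..n}. c i \<le> j} + card {i \<in> {1..n-k}. c i \<le> j}"
    by (rule card_Un_disjoint) auto
  show ?thesis unfolding prefix_count_def A B C ..
qed

lemma prefix_count_total:
  assumes w: "w permutes {1..n}" and "j \<le> n"
  shows "prefix_count w n j = j"
proof -
  have "w ` {i \<in> {1..n}. w i \<le> j} = {1..j}"
  proof
    show "w ` {i \<in> {1..n}. w i \<le> j} \<subseteq> {1..j}" using permutes_in_image[OF w] by fastforce
    show "{1..j} \<subseteq> w ` {i \<in> {1..n}. w i \<le> j}"
    proof
      fix x assume x: "x \<in> {1..j}"
      then have "x \<in> {1..n}" using assms by auto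
      then have "x \<in> w ` {1..n}" by (simp only: permutes_image[OF w])
      with x show "x \<in> w ` {i \<in> {1..n}. w i \<le> j}" by auto
    qed
  qed
  moreover have "inj_on w {i \<in> {1..n}. w i \<le> j}" using permutes_inj_on[OF w] by (auto intro: inj_on_subset)
  ultimately show ?thesis unfolding prefix_count_def by (metis card_atLeastAtMost card_image diff_Suc_1)
qed

text \<open>The left half carries odd values and the right half even ones, so two equal values lie
  in the same half and \<open>s\<close> separates them.\<close>

lemma paired_perm_permutes:
  assumes s: "s permutes {1..m}"
  shows "paired_perm m s permutes {1..2 * m}"
proof -
  have sr: "s i \<in> {1..m}" if "i \<in> {1..m}" for i using permutes_in_image[OF s] that by blast
  have si: "i = i'" if "s i = s i'" for i i' using permutes_inj[OF s] that by (auto dest: injD)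
  have maps: "paired_perm m s ` {1..2*m} \<subseteq> {1..2*m}"
  proof
    fix x assume "x \<in> paired_perm m s ` {1..2*m}"
    then obtain i where i: "i \<in> {1..2*m}" "x = paired_perm m s i" by auto
    show "x \<in> {1..2*m}"
    proof (cases "i \<le> m")
      case True
      then show ?thesis using i sr[of i] by (auto simp: paired_perm_def)
    next
      case False
      with i have "2 * m + 1 - i \<in> {1..m}" by auto
      from sr[OF this] show ?thesis using i False by (auto simp: paired_perm_def)
    qed
  qed
  have inj: "inj_on (paired_perm m s) {1..2*m}"
  proof (rule inj_onI)
    fix i i' assume a: "i \<in> {1..2*m}" "i' \<in> {1..2*m}" "paired_perm m s i = paired_perm m s i'"
    have p: "even (2 * x - 1) \<longleftrightarrow> x = 0" for x :: nat by (cases x) auto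
    consider "i \<le> m" "i' \<le> m" | "i > m" "i' > m" | "i \<le> m" "i' > m" | "i > m" "i' \<le> m" by linarith
    then show "i = i'"
    proof cases
      case 1
      then have "2 * s i - 1 = 2 * s i' - 1" using a by (auto simp: paired_perm_def)
      then have "s i = s i'" using sr[of i] sr[of i'] a 1 by auto
      then show ?thesis by (rule si)
    next
      case 2
      then have "2 * s (2 * m + 1 - i) - 1 = 2 * s (2 * m + 1 - i') - 1" using a by (auto simp: paired_perm_def)
      then have "s (2 * m + 1 - i) = s (2 * m + 1 - i')"
        using sr[of "2 * m + 1 - i"] sr[of "2 * m + 1 - i'"] a 2 by auto
      then have "2 * m + 1 - i = 2 * m + 1 - i'" by (rule si)
      with a show ?thesis by auto
    next
      case 3
      then have "2 * s i - 1 = 2 * s (2 * m + 1 - i') - 1 + 1" using a by (auto simp: paired_perm_def)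
      then show ?thesis using sr[of i] sr[of "2 * m + 1 - i'"] a 3 by simp presburger
    next
      case 4
      then have "2 * s i' - 1 = 2 * s (2 * m + 1 - i) - 1 + 1" using a by (auto simp: paired_perm_def)
      then show ?thesis using sr[of i'] sr[of "2 * m + 1 - i"] a 4 by simp presburger
    qed
  qed
  have "bij_betw (paired_perm m s) {1..2*m} {1..2*m}"
    using inj maps by (simp add: bij_betw_def endo_inj_surj)
  then show ?thesis
    by (rule bij_imp_permutes) (auto simp: paired_perm_def)
qed

lemma paired_perm_palindrome:
  assumes s: "s permutes {1..m}" and i: "i \<in> {1..2 * m}"
  shows "(paired_perm m s i + 1) div 2 = (paired_perm m s (2 * m + 1 - i) + 1) div 2"
proof -
  have sr: "s i \<in> {1..m}" if "i \<in> {1..m}" for i using permutes_in_image[OF s] that by blast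
  show ?thesis
    using i sr[of i] sr[of "2 * m + 1 - i"] by (auto simp: paired_perm_def)
qed

text \<open>A class occurs only at two mirror positions, and the left one carries the odd value. Two
  positions in the same half would contradict injectivity of \<open>s\<close>.\<close>

lemma paired_perm_ascending:
  assumes s: "s permutes {1..m}" and "1 \<le> p" "p < q" "q \<le> 2 * m"
    and eq: "(paired_perm m s p + 1) div 2 = (paired_perm m s q + 1) div 2"
  shows "paired_perm m s p < paired_perm m s q"
proof -
  have sr: "s i \<in> {1..m}" if "i \<in> {1..m}" for i using permutes_in_image[OF s] that by blast
  have si: "i = i'" if "s i = s i'" for i i' using permutes_inj[OF s] that by (auto dest: injD)
  consider "q \<le> m" | "p \<le> m" "q > m" | "p > m" by linarith
  then show ?thesis
  proof cases
    case 1
    then have "s p = s q" using eq assms sr[of p] sr[of q] by (auto simp: paired_perm_def)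
    then show ?thesis using si[of p q] assms by auto
  next
    case 2
    then have "p \<in> {1..m}" "2 * m + 1 - q \<in> {1..m}" using assms by auto
    from this[THEN sr] show ?thesis using eq assms 2 by (auto simp: paired_perm_def)
  next
    case 3
    then have "2 * m + 1 - p \<in> {1..m}" "2 * m + 1 - q \<in> {1..m}" using assms by auto
    from this[THEN sr] have "s (2 * m + 1 - p) = s (2 * m + 1 - q)"
      using eq assms 3 by (auto simp: paired_perm_def)
    then show ?thesis using si[of "2 * m + 1 - p" "2 * m + 1 - q"] assms by auto
  qed
qed

text \<open>Partners never form an inversion, so the inversions are those of the word of classes.
  That word is a palindrome, hence has half of the total counted in
  \<open>card_inversions_halves\<close>.\<close>

lemma card_inversions_paired_perm:
  assumes s: "s permutes {1..m}" and m: "1 \<le> m"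
  shows "card (inversions (2 * m) (paired_perm m s)) = m * (m - 1)"
proof -
  define w where "w = paired_perm m s"
  define c where "c = (\<lambda>p. (w p + 1) div 2)"
  have "inversions (2*m) w = inversions (2*m) c"
  proof -
    have "w q < w p \<longleftrightarrow> c q < c p" if "1 \<le> p" "p < q" "q \<le> 2 * m" for p q
      using paired_perm_ascending[OF s that] unfolding w_def[symmetric] c_def
      using halves_less_iff[of "w q" "w p"] by (cases "(w p + 1) div 2 = (w q + 1) div 2") auto
    then show ?thesis by (auto simp: inversions_def)
  qed
  moreover have "inversions (2*m) (reflect (2*m) c) = inversions (2*m) c"
    using paired_perm_palindrome[OF s] unfolding inversions_def reflect_def c_def w_def by fastforce
  ultimately show ?thesis
    using card_inversions_halves[OF paired_perm_permutes[OF s] m] by (simp add: w_def c_def)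
qed

lemma inversions_lower_bound:
  assumes w: "w permutes {1..2 * m}" and m: "1 \<le> m"
    and cond: "\<And>k j. k \<le> 2 * m \<Longrightarrow> j \<le> m \<Longrightarrow>
      prefix_count w k (2 * j) + prefix_count w (2 * m - k) (2 * j) \<le> 2 * j"
  shows "m * (m - 1) \<le> card (inversions (2 * m) w) \<and>
    (card (inversions (2 * m) w) = m * (m - 1) \<longrightarrow> (\<exists>s. s permutes {1..m} \<and> w = paired_perm m s))"
proof -
  define c where "c = (\<lambda>p. (w p + 1) div 2)"
  define d where "d = reflect (2*m) c"
  have wr: "w p \<in> {1..2*m}" if "p \<in> {1..2*m}" for p using permutes_in_image[OF w] that by blast
  \<comment> \<open>Rounding the halves up turns the bound \<open>2 * j\<close> for \<open>w\<close>
    into the bound \<open>j\<close> for \<open>c\<close>, so the hypothesis on even bounds speaks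
    about all prefix counts of \<open>c\<close>.\<close>
  have pc: "prefix_count c k j = prefix_count w k (2 * j)" for k j
    unfolding prefix_count_def c_def by (rule arg_cong[where f = card]) auto
  have large: "prefix_count x k j = k" if "k \<le> 2*m" "\<And>p. p \<in> {1..2*m} \<Longrightarrow> x p \<le> j" for x k j
  proof -
    have "{i \<in> {1..k}. x i \<le> j} = {1..k}" using that by auto
    then show ?thesis by (simp add: prefix_count_def)
  qed
  have total: "prefix_count c (2*m) j = 2 * j" if "j \<le> m" for j
    using prefix_count_total[OF w, of "2 * j"] that by (simp add: pc)
  have refl: "prefix_count d k j + prefix_count c (2*m - k) j = prefix_count c (2*m) j" if "k \<le> 2 * m" for k j
    unfolding d_def using that by (rule prefix_count_reflect)
  have le: "prefix_count c k j \<le> prefix_count d k j" if k: "k \<le> 2 * m" for k j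
  proof (cases "j \<le> m")
    case True
    then show ?thesis
      using cond[OF k True] refl[OF k, of j] total[OF True] unfolding pc by linarith
  next
    case False
    have "c p \<le> j" if "p \<in> {1..2*m}" for p using wr[OF that] False by (auto simp: c_def)
    moreover have "d p \<le> j" if "p \<in> {1..2*m}" for p
      unfolding d_def reflect_def by (rule calculation) (use that in auto)
    ultimately show ?thesis using large[OF k, of c j] large[OF k, of d j] by simp
  qed
  have eq: "prefix_count c (2*m) j = prefix_count d (2*m) j" for j
    using refl[of "2*m" j] by (simp add: prefix_count_def)
  have mono: "card (inversions (2*m) d) \<le> card (inversions (2*m) c)"
    "card (inversions (2*m) d) = card (inversions (2*m) c) \<Longrightarrow> (\<forall>i\<in>{1..2*m}. d i = c i)"
    using card_inversions_mono[of "2*m" c d] le eq by auto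
  have sum: "card (inversions (2 * m) c) + card (inversions (2 * m) d) = 2 * (m * (m - 1))"
    unfolding c_def d_def by (rule card_inversions_halves[OF w m])
  have sub: "inversions (2*m) c \<subseteq> inversions (2*m) w"
    unfolding inversions_def c_def by auto
  then have sub': "card (inversions (2*m) c) \<le> card (inversions (2*m) w)"
    by (intro card_mono) auto
  have lb: "m * (m - 1) \<le> card (inversions (2 * m) w)" using mono(1) sum sub' by linarith
  have "\<exists>s. s permutes {1..m} \<and> w = paired_perm m s" if e: "card (inversions (2 * m) w) = m * (m - 1)"
  proof -
    have ec: "card (inversions (2 * m) c) = card (inversions (2 * m) w)"
      "card (inversions (2*m) d) = card (inversions (2*m) c)"
      using e mono(1) sum sub' by linarith+
    have pal: "c (2*m+1-i) = c i" if "i \<in> {1..2*m}" for i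
      using mono(2)[OF ec(2)] that by (simp add: d_def reflect_def)
    \<comment> \<open>In the extremal case no inversion of \<open>w\<close> disappears on passing to
      classes; hence partners occur in increasing order, which is \<open>asc\<close>.\<close>
    have inv: "inversions (2*m) w = inversions (2*m) c"
      using card_subset_eq[OF _ sub ec(1)] by simp
    have asc: "w p < w q" if "1 \<le> p" "p < q" "q \<le> 2*m" "c p = c q" for p q
    proof -
      have "(p, q) \<notin> inversions (2*m) w" unfolding inv using that by (auto simp: inversions_def)
      moreover have "w p \<noteq> w q" using permutes_inj[OF w] that by (auto dest: injD)
      ultimately show ?thesis using that by (auto simp: inversions_def)
    qed
    have pair: "w i = 2 * c i - 1 \<and> w (2*m+1-i) = 2 * c i \<and> c i \<in> {1..m}" if i: "i \<in> {1..m}" for i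
    proof -
      have "c i = c (2*m+1-i)" using pal[of i] i by simp
      moreover have "w i < w (2*m+1-i)" using asc[of i "2*m+1-i"] i calculation by auto
      moreover have "w i \<in> {1..2*m}" using wr i by auto
      ultimately show ?thesis unfolding c_def by auto
    qed
    define s where "s = (\<lambda>i. if i \<in> {1..m} then c i else i)"
    have "s permutes {1..m}"
    proof (rule bij_imp_permutes)
      have "inj_on s {1..m}"
      proof (rule inj_onI)
        fix x y assume "x \<in> {1..m}" "y \<in> {1..m}" "s x = s y"
        then have "w x = w y" using pair[of x] pair[of y] by (auto simp: s_def)
        then show "x = y" using permutes_inj[OF w] by (auto dest: injD)
      qed
      moreover have "s ` {1..m} \<subseteq> {1..m}" using pair by (auto simp: s_def)
      ultimately show "bij_betw s {1..m} {1..m}" by (simp add: bij_betw_def endo_inj_surj)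
    qed (auto simp: s_def)
    moreover have "w = paired_perm m s"
    proof
      fix i
      consider "i \<in> {1..m}" | "i \<in> {m<..2*m}" | "i \<notin> {1..2*m}" by force
      then show "w i = paired_perm m s i"
      proof cases
        case 1
        then show ?thesis using pair[of i] by (auto simp: paired_perm_def s_def)
      next
        case 2
        then have "2*m+1-i \<in> {1..m}" "2*m+1-(2*m+1-i) = i" by auto
        then show ?thesis using pair[of "2*m+1-i"] 2 by (auto simp: paired_perm_def s_def)
      next
        case 3
        then have "w i = i" using w by (simp add: permutes_not_in)
        with 3 show ?thesis by (auto simp: paired_perm_def)
      qed
    qed
    ultimately show ?thesis by blast
  qed
  with lb show ?thesis by blast
qed

section \<open>Flags and matrices\<close>

lemma bij_betw_coord: "bij_betw (coord :: nat \<Rightarrow> 'm::enum + 'm) {1..2 * CARD('m)} UNIV"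
proof -
  have l: "length (enum_class.enum :: ('m + 'm) list) = 2 * CARD('m)"
    using card_UNIV_length_enum[where 'a = "'m + 'm"] by simp
  have "bij_betw (\<lambda>k. (enum_class.enum :: ('m + 'm) list) ! k) {..<2 * CARD('m)} UNIV"
    using bij_betw_nth[OF enum_distinct refl refl, where ?'a3 = "'m + 'm"] l by (simp add: enum_UNIV)
  moreover have "bij_betw (\<lambda>k. k - 1) {1..2 * CARD('m)} {..<2 * CARD('m)}"
    by (rule bij_betw_byWitness[where f' = Suc]) auto
  ultimately have "bij_betw ((\<lambda>k. (enum_class.enum :: ('m + 'm) list) ! k) \<circ> (\<lambda>k. k - 1)) {1..2 * CARD('m)} UNIV"
    by (rule bij_betw_trans[rotated])
  moreover have "coord = (\<lambda>k. (enum_class.enum :: ('m + 'm) list) ! k) \<circ> (\<lambda>k. k - 1)"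
    by (simp add: fun_eq_iff coord_def)
  ultimately show ?thesis by simp
qed

text \<open>The 1-based position of a coordinate. It turns triangularity of matrices indexed by a
  sum type into a comparison of natural numbers.\<close>

definition idx :: "'m::enum + 'm \<Rightarrow> nat" where
  "idx = the_inv_into {1..2 * CARD('m)} coord"

lemma coord_idx [simp]: "coord (idx i) = i"
  unfolding idx_def by (metis UNIV_I bij_betw_coord f_the_inv_into_f_bij_betw)

lemma idx_coord [simp]: "k \<in> {1..2 * CARD('m)} \<Longrightarrow> idx (coord k :: 'm::enum + 'm) = k"
  unfolding idx_def by (rule the_inv_into_f_f[OF bij_betw_imp_inj_on[OF bij_betw_coord]])

lemma idx_range: "idx (i :: 'm::enum + 'm) \<in> {1..2 * CARD('m)}"
  unfolding idx_def using bij_betw_the_inv_into[OF bij_betw_coord] by (metis UNIV_I bij_betwE)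

lemma idx_bounds [simp]: "Suc 0 \<le> idx (i :: 'm::enum + 'm)" "idx i \<le> 2 * CARD('m)" "0 < idx i"
  using idx_range[of i] by auto

lemma inj_idx: "inj idx"
  by (metis coord_idx injI)

lemma idx_eq_iff [simp]: "idx i = idx j \<longleftrightarrow> i = j"
  using inj_idx by (auto dest: injD)

lemma bij_betw_idx: "bij_betw (idx :: 'm::enum + 'm \<Rightarrow> nat) UNIV {1..2 * CARD('m)}"
  unfolding idx_def by (rule bij_betw_the_inv_into[OF bij_betw_coord])

abbreviation std_flag :: "'m::enum flag" where
  "std_flag \<equiv> flag_of e"

text \<open>The matrix with the vectors of \<open>b\<close> as its columns, so that
  \<open>flag_of b\<close> is the translate of the standard flag by a single matrix.\<close>

definition frame :: "(nat \<Rightarrow> 'm::enum cvec) \<Rightarrow> 'm cmat" where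
  "frame b = (\<chi> i j. b (idx j) $ i)"

lemma matrix_vector_e: "(A *v e k) $ i = A $ i $ coord k"
  by (simp add: e_def matrix_vector_mult_def axis_def if_distrib cong: if_cong)

lemma frame_e:
  assumes "k \<in> {1..2 * CARD('m)}"
  shows "frame b *v (e k :: 'm::enum cvec) = b k"
  using assms by (simp add: vec_eq_iff matrix_vector_e frame_def)

lemma e_component:
  assumes "k \<in> {1..2 * CARD('m)}"
  shows "(e k :: 'm::enum cvec) $ i = (if idx i = k then 1 else 0)"
  using assms by (auto simp: e_def axis_def)

lemma sum_coord: "(\<Sum>i\<in>UNIV. f i) = (\<Sum>k\<in>{1..2 * CARD('m)}. f (coord k :: 'm::enum + 'm))"
  by (rule sum.reindex_bij_betw[OF bij_betw_coord, symmetric])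

lemma e_expansion: "(x :: 'm::enum cvec) = (\<Sum>k\<in>{1..2 * CARD('m)}. x $ coord k *s e k)"
  using basis_expansion[of x] unfolding sum_coord e_def by simp

lemma frame_expansion: "frame b *v (x :: 'm::enum cvec) = (\<Sum>k\<in>{1..2 * CARD('m)}. x $ coord k *s b k)"
proof -
  have "frame b *v x = (\<Sum>k\<in>{1..2 * CARD('m)}. x $ coord k *s (frame b *v e k))"
    by (subst e_expansion[of x]) (simp add: vec.sum vec.scale)
  then show ?thesis by (simp add: frame_e)
qed

lemma flag_of_cong:
  assumes "\<And>k. k \<in> {1..2 * CARD('m)} \<Longrightarrow> b k = c k"
  shows "flag_of b = (flag_of c :: 'm::enum flag)"
proof -
  have "b ` {1..min k (2 * CARD('m))} = c ` {1..min k (2 * CARD('m))}" for k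
    using assms by (intro image_cong) auto
  then show ?thesis by (simp add: flag_of_def)
qed

lemma act_flag_of: "act A (flag_of b) = flag_of (\<lambda>k. A *v b k)"
  unfolding act_def flag_of_def vec.span_image[symmetric] image_image ..

lemma flag_of_frame: "flag_of b = act (frame b) (std_flag :: 'm::enum flag)"
  unfolding act_flag_of by (rule flag_of_cong) (simp add: frame_e)

lemma act_mult: "act (A ** B) V = act A (act B V)"
  by (simp add: act_def image_image matrix_vector_mul_assoc)

lemma act_one [simp]: "act (mat 1) V = V"
  by (simp add: act_def)

lemma std_flag_iff: "x \<in> (std_flag :: 'm::enum flag) k \<longleftrightarrow> (\<forall>i. k < idx i \<longrightarrow> x $ i = 0)"
proof
  let ?S = "{x :: 'm cvec. \<forall>i. k < idx i \<longrightarrow> x $ i = 0}"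
  have sub: "vec.subspace ?S" by (auto simp: vec.subspace_def)
  have "e ` {1..min k (2 * CARD('m))} \<subseteq> ?S"
    by (auto simp: e_component)
  then have "vec.span (e ` {1..min k (2 * CARD('m))}) \<subseteq> ?S"
    by (rule vec.span_minimal[OF _ sub])
  then show "x \<in> (std_flag :: 'm::enum flag) k \<Longrightarrow> \<forall>i. k < idx i \<longrightarrow> x $ i = 0"
    by (auto simp: flag_of_def)
  assume x: "\<forall>i. k < idx i \<longrightarrow> x $ i = 0"
  have "x = (\<Sum>l\<in>{1..2 * CARD('m)}. x $ coord l *s e l)" by (rule e_expansion)
  also have "\<dots> \<in> vec.span (e ` {1..min k (2 * CARD('m))})"
  proof (rule vec.span_sum)
    fix l assume l: "l \<in> {1..2 * CARD('m)}"
    show "x $ coord l *s (e l :: 'm cvec) \<in> vec.span (e ` {1..min k (2 * CARD('m))})"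
    proof (cases "k < l")
      case True
      then show ?thesis using x l by (simp add: vec.span_zero)
    next
      case False
      then show ?thesis using l by (intro vec.span_scale vec.span_base) auto
    qed
  qed
  finally show "x \<in> (std_flag :: 'm::enum flag) k" by (simp add: flag_of_def)
qed

lemma std_flag_eq: "(std_flag :: 'm::enum flag) k = {x. \<forall>i. k < idx i \<longrightarrow> x $ i = 0}"
  using std_flag_iff by blast

lemma subspace_flag_of: "vec.subspace (flag_of b k)"
  by (simp add: flag_of_def)

lemma card_idx_le: "card {i :: 'm::enum + 'm. idx i \<le> k} = min k (2 * CARD('m))"
proof -
  have "bij_betw idx {i :: 'm + 'm. idx i \<le> k} {1..min k (2 * CARD('m))}"
  proof (rule bij_betw_subset[OF bij_betw_idx])
    show "idx ` {i :: 'm + 'm. idx i \<le> k} = {1..min k (2 * CARD('m))}" (is "?L = ?R")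
    proof
      show "?R \<subseteq> ?L"
      proof
        fix x assume "x \<in> ?R"
        then show "x \<in> ?L" by (intro image_eqI[of _ _ "coord x"]) auto
      qed
    qed auto
  qed simp
  then show ?thesis by (simp add: bij_betw_same_card)
qed

lemma dim_std_flag: "vec.dim ((std_flag :: 'm::enum flag) k) = min k (2 * CARD('m))"
  using dim_substandard_cart[of "{i :: 'm + 'm. idx i \<le> k}", where ?'a = complex]
  unfolding std_flag_eq card_idx_le by (simp add: not_le)

lemma std_flag_in_flags: "std_flag \<in> flags"
proof -
  have "mono std_flag" by (auto simp: mono_def std_flag_iff)
  then show ?thesis by (simp add: flags_def dim_std_flag subspace_flag_of)
qed

lemma inverse_matrix:
  fixes A :: "'m::finite cmat"
  assumes "det A \<noteq> 0"
  obtains B where "A ** B = mat 1" "B ** A = mat 1" "det B = 1 / det A"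
proof -
  from assms obtain B where B: "A ** B = mat 1" "B ** A = mat 1"
    by (metis invertible_def invertible_det_nz)
  then have "det A * det B = 1" by (metis det_I det_mul)
  then show ?thesis using that B assms by (simp add: field_simps)
qed

lemma inj_matrix: "det (A :: 'm::enum cmat) \<noteq> 0 \<Longrightarrow> inj ((*v) A)"
  by (metis inverse_matrix matrix_left_invertible_injective)

lemma dim_image_matrix:
  assumes "det (A :: 'm::enum cmat) \<noteq> 0"
  shows "vec.dim ((*v) A ` S) = vec.dim S"
  by (rule vec.dim_image_eq) (auto intro: inj_on_subset[OF inj_matrix[OF assms]])

lemma act_in_flags:
  fixes A :: "'a::enum cmat"
  assumes "det A \<noteq> 0" "V \<in> flags"
  shows "act A V \<in> flags"
proof -
  have "vec.dim ((*v) A ` V k) = min k (2 * CARD('a))" for k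
    using assms by (simp add: dim_image_matrix flags_def)
  moreover have "vec.subspace ((*v) A ` V k)" for k
    using assms(2) by (intro vec.subspace_image) (simp add: flags_def)
  moreover have "mono (\<lambda>k. (*v) A ` V k)"
    using assms(2) by (auto simp: flags_def mono_def)
  ultimately show ?thesis by (simp add: flags_def act_def)
qed

lemma SL_det_nz: "A \<in> SL \<Longrightarrow> det A \<noteq> 0" by (simp add: SL_def)

lemma SL_mult: "A \<in> SL \<Longrightarrow> B \<in> SL \<Longrightarrow> A ** B \<in> SL"
  by (simp add: SL_def det_mul)

lemma SL_inverse:
  assumes "A \<in> SL"
  obtains B where "B \<in> SL" "A ** B = mat 1" "B ** A = mat 1"
  using inverse_matrix[of A] assms unfolding SL_def by auto

definition smat :: "complex \<Rightarrow> 'm::enum cmat \<Rightarrow> 'm cmat" where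
  "smat c A = (\<chi> i j. c * A $ i $ j)"

lemma smat_vector: "smat c A *v x = c *s (A *v x)"
  by (simp add: smat_def vec_eq_iff matrix_vector_mult_def sum_distrib_left mult.assoc)

lemma det_smat: "det (smat c (A :: 'm::enum cmat)) = c ^ (2 * CARD('m)) * det A"
proof -
  have "smat c A = (\<chi> i. c *s (A $ i))" by (simp add: smat_def vec_eq_iff)
  then show ?thesis by (simp add: det_rows_mul mult_2)
qed

lemma scale_subspace:
  assumes "c \<noteq> 0" "vec.subspace S"
  shows "(*s) c ` S = S"
proof
  show "(*s) c ` S \<subseteq> S" using assms(2) by (auto simp: vec.subspace_scale)
  show "S \<subseteq> (*s) c ` S"
  proof
    fix x assume "x \<in> S"
    then have "(1 / c) *s x \<in> S" "x = c *s ((1 / c) *s x)"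
      using assms by (auto simp: vec.subspace_scale vector_smult_assoc)
    then show "x \<in> (*s) c ` S" by blast
  qed
qed

lemma act_smat:
  assumes "c \<noteq> 0" "\<And>k. vec.subspace (V k)"
  shows "act (smat c A) V = act A V"
proof -
  have "(*v) (smat c A) ` V k = (*s) c ` ((*v) A ` V k)" for k
    by (simp add: image_image smat_vector)
  then show ?thesis unfolding act_def by (simp add: scale_subspace assms vec.subspace_image)
qed

text \<open>The factor is a root of order \<open>2 * CARD('m)\<close> of \<open>1 / det A\<close>,
  taken through the principal logarithm. By \<open>act_smat\<close> the scaled matrix acts on flags
  in the same way.\<close>

lemma scale_to_SL:
  fixes A :: "'m::enum cmat"
  assumes "det A \<noteq> 0"
  obtains c where "c \<noteq> 0" "smat c A \<in> SL"
proof
  define c where "c = exp (- Ln (det A) / (2 * CARD('m)))"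
  have "c ^ (2 * CARD('m)) = exp (of_nat (2 * CARD('m)) * (- Ln (det A) / (2 * CARD('m))))"
    unfolding c_def by (rule exp_of_nat_mult[symmetric])
  also have "of_nat (2 * CARD('m)) * (- Ln (det A) / (2 * CARD('m))) = - Ln (det A)"
    by (simp del: of_nat_mult)
  also have "exp (- Ln (det A)) = 1 / det A"
    using assms by (simp add: exp_minus divide_inverse)
  finally show "smat c A \<in> SL" using assms by (simp add: SL_def det_smat)
  show "c \<noteq> 0" by (simp add: c_def)
qed

lemma subspace_std [simp]: "vec.subspace (std_flag k)"
  by (rule subspace_flag_of)

lemma flag_of_adapted:
  fixes f :: "nat \<Rightarrow> 'm::enum cvec"
  assumes V: "V \<in> flags"
    and f: "\<And>k. k \<in> {1..2 * CARD('m)} \<Longrightarrow> f k \<in> V k \<and> f k \<notin> V (k - 1)"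
  shows "V = flag_of f"
proof -
  define n where "n = 2 * CARD('m)"
  have subV: "vec.subspace (V k)" and dimV: "vec.dim (V k) = min k n" for k
    using V by (auto simp: flags_def n_def)
  have monoV: "k \<le> l \<Longrightarrow> V k \<subseteq> V l" for k l using V by (auto simp: flags_def mono_def)
  note f = f[folded n_def]
  have span_f: "k \<le> n \<Longrightarrow> vec.span (f ` {1..k}) = V k" for k
  proof (induction k)
    case 0
    have "V 0 = {0}"
      using dimV[of 0] vec.subspace_0[OF subV, of 0] by (auto simp: vec.dim_eq_0)
    then show ?case by simp
  next
    case (Suc k)
    then have IH: "vec.span (f ` {1..k}) = V k" by simp
    have fS: "f (Suc k) \<in> V (Suc k)" "f (Suc k) \<notin> V k" using f[of "Suc k"] Suc.prems by auto
    have ins: "f ` {1..Suc k} = insert (f (Suc k)) (f ` {1..k})" by (auto simp: atLeastAtMostSuc_conv)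
    have "vec.span (f ` {1..Suc k}) \<subseteq> V (Suc k)"
    proof (rule vec.span_minimal[OF _ subV])
      show "f ` {1..Suc k} \<subseteq> V (Suc k)"
        using f Suc.prems monoV[of _ "Suc k"] by fastforce
    qed
    moreover have "vec.dim (f ` {1..k}) = k"
      using dimV[of k] Suc.prems unfolding IH[symmetric] vec.dim_span by simp
    then have "vec.dim (V (Suc k)) \<le> vec.dim (vec.span (f ` {1..Suc k}))"
      unfolding ins vec.dim_span vec.dim_insert using fS IH dimV[of k] dimV[of "Suc k"] Suc.prems by simp
    ultimately show ?case by (intro vec.subspace_dim_equal subV) auto
  qed
  show "V = flag_of f"
  proof
    fix k
    show "V k = flag_of f k"
    proof (cases "k \<le> n")
      case True
      then show ?thesis using span_f[OF True] by (simp add: flag_of_def n_def min_def)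
    next
      case False
      \<comment> \<open>Beyond \<open>n\<close> both flags take their default value, the whole
        space.\<close>
      have "V n = V k"
        by (rule vec.subspace_dim_equal[OF subV subV]) (use False dimV monoV in auto)
      then show ?thesis using span_f[of n] False by (simp add: flag_of_def n_def min_def)
    qed
  qed
qed

text \<open>The Bruhat decomposition relative to the ordered basis \<open>b\<close>, on the level of flags.\<close>

lemma flag_adapted_basis:
  fixes b :: "nat \<Rightarrow> 'm::enum cvec"
  assumes V: "V \<in> flags" and b: "vec.span (b ` {1..2 * CARD('m)}) = UNIV"
  obtains v f where "v permutes {1..2 * CARD('m)}" "V = flag_of f"
    "\<And>k. k \<in> {1..2 * CARD('m)} \<Longrightarrow> f k - b (v k) \<in> vec.span (b ` {1..<v k})"
proof -
  define n where "n = 2 * CARD('m)"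
  define U where "U = (\<lambda>j. vec.span (b ` {1..j}))"
  have subV: "vec.subspace (V k)" and dimV: "vec.dim (V k) = min k n" for k
    using V by (auto simp: flags_def n_def)
  have monoV: "k \<le> l \<Longrightarrow> V k \<subseteq> V l" for k l using V by (auto simp: flags_def mono_def)
  have U0: "U 0 = {0}" by (simp add: U_def)
  have Un: "U n = UNIV" using b by (simp add: U_def n_def)
  have USuc: "\<exists>c. x - c *s b (Suc j) \<in> U j" if "x \<in> U (Suc j)" for x j
  proof -
    have "b ` {1..Suc j} = insert (b (Suc j)) (b ` {1..j})" by (auto simp: atLeastAtMostSuc_conv)
    then show ?thesis using that unfolding U_def by (simp add: vec.span_insert)
  qed
  have ex: "\<exists>x. x \<in> V k \<and> x \<notin> V (k - 1)" if "k \<in> {1..n}" for k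
  proof (rule ccontr)
    assume "\<not> ?thesis"
    then have "vec.dim (V k) \<le> vec.dim (V (k - 1))" by (intro vec.dim_subset) auto
    then show False using that by (auto simp: dimV)
  qed
  \<comment> \<open>The permutation records the jumps: \<open>w k\<close> will be the least
    \<open>j\<close> such that \<open>U j\<close> contains a vector that is new in the
    \<open>k\<close>-th member of the flag.\<close>
  define P where "P = (\<lambda>k j. \<exists>x. x \<in> V k \<and> x \<notin> V (k - 1) \<and> x \<in> U j)"
  define w where "w = (\<lambda>k. LEAST j. P k j)"
  have Pw: "P k (w k)" and wn: "w k \<le> n" if "k \<in> {1..n}" for k
  proof -
    have "P k n" using ex[OF that] by (auto simp: P_def Un)
    then show "P k (w k)" "w k \<le> n" unfolding w_def by (auto intro: LeastI Least_le)
  qed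
  have w_min: "\<not> P k j" if "j < w k" for k j using that not_less_Least unfolding w_def by blast
  have w1: "1 \<le> w k" if "k \<in> {1..n}" for k
  proof (rule ccontr)
    assume "\<not> ?thesis"
    then have "w k = 0" by simp
    then have "P k 0" using Pw[OF that] by simp
    then show False unfolding P_def U0 using vec.subspace_0[OF subV] by auto
  qed
  have "\<exists>x. x \<in> V k \<and> x \<notin> V (k - 1) \<and> x - b (w k) \<in> U (w k - 1)" if k: "k \<in> {1..n}" for k
  proof -
    obtain x where x: "x \<in> V k" "x \<notin> V (k - 1)" "x \<in> U (w k)"
      using Pw[OF k] by (auto simp: P_def)
    obtain c where c: "x - c *s b (w k) \<in> U (w k - 1)"
      using USuc[of x "w k - 1"] x(3) w1[OF k] by auto
    \<comment> \<open>With leading coefficient zero the vector would already lie in the preceding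
      member of \<open>U\<close>, against minimality of \<open>w k\<close>.\<close>
    have c0: "c \<noteq> 0"
    proof
      assume "c = 0"
      with c have "P k (w k - 1)" using x by (auto simp: P_def)
      then show False using w_min[of "w k - 1" k] w1[OF k] by auto
    qed
    let ?y = "(1 / c) *s x"
    have "?y \<in> V k" using x subV by (auto simp: vec.subspace_scale)
    moreover have "?y \<notin> V (k - 1)"
    proof
      assume "?y \<in> V (k - 1)"
      then have "c *s ?y \<in> V (k - 1)" by (rule vec.subspace_scale[OF subV])
      moreover have "c *s ?y = x" using c0 by (simp add: vector_smult_assoc)
      ultimately show False using x by simp
    qed
    moreover have y_eq: "?y - b (w k) = (1 / c) *s (x - c *s b (w k))"
      using c0 by (simp add: vec.scale_right_diff_distrib vector_smult_assoc)
    have "?y - b (w k) \<in> U (w k - 1)"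
      unfolding y_eq using c unfolding U_def by (rule vec.span_scale)
    ultimately show ?thesis by blast
  qed
  then obtain f where f: "\<And>k. k \<in> {1..n} \<Longrightarrow> f k \<in> V k \<and> f k \<notin> V (k - 1) \<and> f k - b (w k) \<in> U (w k - 1)"
    by metis
  \<comment> \<open>If two jumps coincided, the leading vectors would cancel in
    \<open>f k' - f k\<close>. The difference is still new at \<open>k'\<close> and lies in a
    smaller member of \<open>U\<close>, against minimality.\<close>
  have no_eq: False if "k \<in> {1..n}" "k' \<in> {1..n}" "k < k'" "w k = w k'" for k k'
  proof -
    have "f k' - f k = (f k' - b (w k')) - (f k - b (w k))" using that by simp
    also have "\<dots> \<in> U (w k' - 1)"
      unfolding U_def by (rule vec.span_diff) (use f[OF that(1)] f[OF that(2)] that(4) in \<open>simp_all add: U_def\<close>)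
    finally have in_U: "f k' - f k \<in> U (w k' - 1)" .
    have le: "k \<le> k' - 1" "k \<le> k'" using that by auto
    have fk: "f k \<in> V (k' - 1)" "f k \<in> V k'" using f[OF that(1)] monoV[OF le(1)] monoV[OF le(2)] by auto
    moreover have "f k' - f k \<in> V k'" using f[OF that(2)] fk by (auto intro: vec.subspace_diff[OF subV])
    moreover have "f k' - f k \<notin> V (k' - 1)"
    proof
      assume "f k' - f k \<in> V (k' - 1)"
      then have "(f k' - f k) + f k \<in> V (k' - 1)" using fk(1) by (rule vec.subspace_add[OF subV])
      then show False using f[OF that(2)] by simp
    qed
    ultimately have "P k' (w k' - 1)" using in_U by (auto simp: P_def)
    then show False using w_min[of "w k' - 1" k'] w1[OF that(2)] by auto
  qed
  define v where "v = (\<lambda>k. if k \<in> {1..n} then w k else k)"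
  have "inj_on v {1..n}"
    using no_eq by (intro inj_onI) (metis linorder_neqE_nat v_def)
  moreover have "v ` {1..n} \<subseteq> {1..n}" using wn w1 by (auto simp: v_def)
  ultimately have "bij_betw v {1..n} {1..n}" by (simp add: bij_betw_def endo_inj_surj)
  then have v: "v permutes {1..n}" by (rule bij_imp_permutes) (auto simp: v_def)
  have "V = flag_of f"
    by (rule flag_of_adapted[OF V]) (use f in \<open>simp_all add: n_def\<close>)
  moreover have "f k - b (v k) \<in> vec.span (b ` {1..<v k})" if "k \<in> {1..n}" for k
  proof -
    have "{1..<v k} = {1..v k - 1}" by auto
    then show ?thesis using f[OF that] that by (simp add: U_def v_def)
  qed
  ultimately show ?thesis using that v unfolding n_def by blast
qed

lemma flags_transitive:
  assumes "V \<in> (flags :: 'm::enum flag set)"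
  obtains A where "A \<in> SL" "V = act A std_flag"
proof -
  have "vec.span (e ` {1..2 * CARD('m)}) = (UNIV :: 'm cvec set)"
  proof -
    have "x \<in> (std_flag :: 'm flag) (2 * CARD('m))" for x :: "'m cvec"
      by (simp add: std_flag_iff flip: not_le)
    then show ?thesis by (auto simp: flag_of_def)
  qed
  then obtain f where f: "V = flag_of f" using flag_adapted_basis[OF assms] by metis
  then have V: "V = act (frame f) std_flag" by (simp add: flag_of_frame[of f])
  have "V (2 * CARD('m)) = UNIV"
  proof (rule vec.subspace_dim_equal)
    show "vec.subspace (V (2 * CARD('m)))" "vec.dim (UNIV :: 'm cvec set) \<le> vec.dim (V (2 * CARD('m)))"
      using assms by (auto simp: flags_def card_cart_basis)
  qed auto
  then have "surj ((*v) (frame f))" unfolding V act_def by auto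
  then have d: "det (frame f) \<noteq> 0"
    by (metis invertible_det_nz invertible_right_inverse matrix_right_invertible_surjective)
  then obtain c where "c \<noteq> 0" "smat c (frame f) \<in> SL" by (rule scale_to_SL)
  then show ?thesis using that[of "smat c (frame f)"] V by (simp add: act_smat)
qed

lemma flags_eq_orbit: "flags = orbit SL std_flag"
  unfolding orbit_def using flags_transitive act_in_flags std_flag_in_flags SL_det_nz by blast

lemma act_std_fixed_iff:
  fixes A :: "'m::enum cmat"
  assumes "det A \<noteq> 0"
  shows "act A std_flag = std_flag \<longleftrightarrow> (\<forall>i j. idx j < idx i \<longrightarrow> A $ i $ j = 0)"
proof
  assume L: "act A std_flag = std_flag"
  show "\<forall>i j. idx j < idx i \<longrightarrow> A $ i $ j = 0"
  proof (intro allI impI)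
    fix i j :: "'m + 'm" assume ij: "idx j < idx i"
    have "(e (idx j) :: 'm cvec) \<in> std_flag (idx j)" by (simp add: std_flag_iff e_component)
    then have "A *v e (idx j) \<in> act A std_flag (idx j)" by (auto simp: act_def)
    then have "A *v e (idx j) \<in> std_flag (idx j)" by (simp only: L)
    then show "A $ i $ j = 0" using ij by (auto simp: std_flag_iff matrix_vector_e)
  qed
next
  assume R: "\<forall>i j. idx j < idx i \<longrightarrow> A $ i $ j = 0"
  show "act A std_flag = std_flag"
  proof
    fix k
    have "(*v) A ` std_flag k \<subseteq> (std_flag k :: 'm cvec set)"
    proof clarify
      fix x :: "'m cvec" assume x: "x \<in> std_flag k"
      show "A *v x \<in> std_flag k"
        unfolding std_flag_iff
      proof (intro allI impI)
        fix i :: "'m + 'm" assume i: "k < idx i"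
        have "A $ i $ j * x $ j = 0" for j
          using x R i by (cases "k < idx j") (auto simp: std_flag_iff)
        then show "(A *v x) $ i = 0" unfolding matrix_vector_mult_def by (simp add: sum.neutral del: mult_eq_0_iff)
      qed
    qed
    then show "act A std_flag k = std_flag k" unfolding act_def
      by (rule vec.subspace_dim_equal[rotated 2]) (auto simp: vec.subspace_image dim_image_matrix[OF assms])
  qed
qed

section \<open>Unipotent matrices as coordinates for flags\<close>

lemma act_cancel:
  assumes "det A \<noteq> 0" "act A V = act A W"
  shows "V = W"
proof -
  obtain B where "B ** A = mat 1" using inverse_matrix[OF assms(1)] by metis
  then show ?thesis using assms(2) by (metis act_mult act_one)
qed

text \<open>A nonzero term of the Leibniz formula needs \<open>r (p i) \<le> r i\<close> for all
  \<open>i\<close>. Both sides have the same sum over all \<open>i\<close>, so they are equal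
  throughout and \<open>p\<close> is the identity.\<close>

lemma det_triangular:
  fixes A :: "'a::comm_ring_1 ^ 'n ^ 'n::finite" and r :: "'n \<Rightarrow> nat"
  assumes r: "inj r" and A: "\<And>i j. r i < r j \<Longrightarrow> A $ i $ j = 0"
  shows "det A = (\<Prod>i\<in>UNIV. A $ i $ i)"
proof -
  have zero: "(\<Prod>i\<in>UNIV. A $ i $ p i) = 0" if p: "p permutes UNIV" "p \<noteq> id" for p
  proof (rule ccontr)
    assume nz: "(\<Prod>i\<in>UNIV. A $ i $ p i) \<noteq> 0"
    have le: "r (p i) \<le> r i" for i
    proof (rule ccontr)
      assume "\<not> r (p i) \<le> r i"
      then have "A $ i $ p i = 0" by (intro A) simp
      then have "(\<Prod>i\<in>UNIV. A $ i $ p i) = 0" by (intro prod_zero) auto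
      with nz show False by simp
    qed
    have "(\<Sum>i\<in>UNIV. r (p i)) = (\<Sum>i\<in>UNIV. r i)"
      using sum.permute[OF p(1), of r] by (simp add: o_def)
    then have "r (p i) = r i" for i
      using sum_mono_inv[of "\<lambda>i. r (p i)" UNIV r] le by auto
    then have "p = id" using r by (auto simp: fun_eq_iff dest: injD)
    with p show False by simp
  qed
  have "det A = (\<Sum>p\<in>{p. p permutes UNIV}. of_int (sign p) * (\<Prod>i\<in>UNIV. A $ i $ p i))"
    by (simp add: det_def)
  also have "\<dots> = (\<Sum>p\<in>{id}. of_int (sign p) * (\<Prod>i\<in>UNIV. A $ i $ p i))"
    by (rule sum.mono_neutral_right) (auto simp: zero permutes_id finite_permutations)
  finally show ?thesis by simp
qed

text \<open>The matrix \<open>1 + X\<close> of the standard chart. Entries of \<open>X\<close> on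
  and above the diagonal are ignored, so that the map is defined on the full coordinate
  space.\<close>

definition unip :: "'m::enum coords \<Rightarrow> 'm cmat" where
  "unip X = (\<chi> i j. if i = j then 1 else if idx j < idx i then X $ (i, j) else 0)"

lemma det_unip [simp]: "det (unip X) = 1"
  by (subst det_triangular[where r = idx]) (auto simp: unip_def inj_idx)

lemma unip_SL: "unip X \<in> SL" by (simp add: SL_def)

lemma unip_e:
  assumes k: "k \<in> {1..2 * CARD('m)}"
  shows "unip X *v e k = (e k + (\<Sum>l\<in>{k<..2 * CARD('m)}. X $ (coord l, coord k) *s e l) :: 'm::enum cvec)"
proof -
  have "(\<Sum>l\<in>{k<..2 * CARD('m)}. X $ (coord l, coord k) * (if idx i = l then 1 else 0)) =
      (if k < idx i then X $ (i, coord k) else 0)" for i :: "'m + 'm"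
  proof -
    have "(\<Sum>l\<in>{k<..2 * CARD('m)}. X $ (coord l, coord k) * (if idx i = l then 1 else 0)) =
      (\<Sum>l\<in>{k<..2 * CARD('m)}. (if idx i = l then X $ (coord l, coord k) else 0))"
      by (rule sum.cong) auto
    then show ?thesis by (simp add: sum.delta')
  qed
  moreover have "(e l :: 'm cvec) $ i = (if idx i = l then 1 else 0)" if "l \<in> {k<..2 * CARD('m)}" for l i
    using that k by (intro e_component) auto
  ultimately show ?thesis
    using k by (auto simp: vec_eq_iff matrix_vector_e unip_def e_component)
qed

lemma flag_param_eq: "flag_param g X = act (g ** unip X) (std_flag :: 'm::enum flag)"
  unfolding act_mult act_flag_of flag_param_def
  by (rule flag_of_cong) (simp only: unip_e matrix_vector_mul_assoc[symmetric])

lemma unip_vector: "(unip X *v x) $ i = x $ i + (\<Sum>j\<in>{j. idx j < idx i}. X $ (i, j) * x $ j)"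
proof -
  have "(unip X *v x) $ i = (\<Sum>j\<in>UNIV. (if j = i then x $ i else 0) + (if idx j < idx i then X $ (i, j) * x $ j else 0))"
    unfolding matrix_vector_mult_def unip_def by (auto intro!: sum.cong)
  then show ?thesis by (simp add: sum.distrib sum.delta sum.If_cases)
qed

text \<open>The column \<open>unip X *v e k\<close> lies in the \<open>k\<close>-th member of the
  flag of \<open>Y\<close>, so it is \<open>unip Y *v x\<close> with \<open>x\<close> in the
  standard \<open>k\<close>-th member. Comparing coordinates from the top gives zeros before
  position \<open>k\<close> and then a one, so \<open>x = e k\<close> and the columns agree.\<close>

lemma unip_flag_inj:
  assumes "act (unip X) std_flag = act (unip Y) (std_flag :: 'm::enum flag)" and "idx j < idx i"
  shows "X $ (i, j) = Y $ (i, j)"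
proof -
  let ?k = "idx j"
  have "e ?k \<in> (std_flag :: 'm flag) ?k" by (simp add: std_flag_iff e_component)
  then have "unip X *v e ?k \<in> act (unip X) std_flag ?k" by (auto simp: act_def)
  then have "unip X *v e ?k \<in> act (unip Y) std_flag ?k" by (simp only: assms(1))
  then obtain x where x: "x \<in> std_flag ?k" "unip X *v e ?k = unip Y *v x"
    by (auto simp: act_def)
  have comp: "(unip X *v e ?k) $ i' = (if i' = j then 1 else if ?k < idx i' then X $ (i', j) else 0)" for i'
    by (simp add: matrix_vector_e unip_def)
  have low: "x $ i' = 0" if "idx i' < ?k" for i'
    using that
  proof (induction "idx i'" arbitrary: i' rule: less_induct)
    case less
    have "(unip Y *v x) $ i' = x $ i'"
      unfolding unip_vector using less by (auto intro!: sum.neutral)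
    moreover have "i' \<noteq> j" "\<not> ?k < idx i'" using less.prems by auto
    ultimately show ?case using comp[of i'] unfolding x(2) by simp
  qed
  have "(unip Y *v x) $ j = x $ j"
    unfolding unip_vector using low by (auto intro!: sum.neutral)
  then have xj: "x $ j = 1" using comp[of j] unfolding x(2) by simp
  have "x = e ?k"
    unfolding vec_eq_iff
  proof
    fix i'
    show "x $ i' = e ?k $ i'"
      using low[of i'] xj x(1) by (cases "idx i'" "idx j" rule: linorder_cases) (auto simp: e_component std_flag_iff)
  qed
  then have "unip X *v e ?k = unip Y *v e ?k" using x by simp
  then have "(unip X *v e ?k) $ i = (unip Y *v e ?k) $ i" by simp
  moreover have "i \<noteq> j" using assms(2) by auto
  ultimately show ?thesis using assms(2) by (simp add: matrix_vector_e unip_def)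
qed

definition mat_coords :: "'m::enum cmat \<Rightarrow> 'm coords" where
  "mat_coords M = (\<chi> p. M $ fst p $ snd p)"

lemma mat_coords_component [simp]: "mat_coords M $ (i, j) = M $ i $ j"
  by (simp add: mat_coords_def)

lemma strictly_lower_iff: "X \<in> strictly_lower \<longleftrightarrow> (\<forall>i j. idx i \<le> idx j \<longrightarrow> X $ (i, j) = 0)"
proof
  assume X: "X \<in> strictly_lower"
  show "\<forall>i j. idx i \<le> idx j \<longrightarrow> X $ (i, j) = 0"
  proof (intro allI impI)
    fix i j :: "'a + 'a" assume "idx i \<le> idx j"
    then have "X $ (coord (idx i), coord (idx j)) = 0"
      using X idx_range[of i] idx_range[of j] unfolding strictly_lower_def by fastforce
    then show "X $ (i, j) = 0" by simp
  qed
next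
  assume "\<forall>i j. idx i \<le> idx j \<longrightarrow> X $ (i, j) = 0"
  then show "X \<in> strictly_lower" by (auto simp: strictly_lower_def)
qed

lemma unip_mult:
  fixes X Y :: "'m::enum coords"
  shows "unip X ** unip Y = unip (mat_coords (unip X ** unip Y))"
proof -
  have entry: "(unip X ** unip Y) $ i $ j = (if i = j then 1 else 0)" if "idx i \<le> idx j" for i j
  proof -
    have "unip X $ i $ k * unip Y $ k $ j = (if k = i then (if i = j then 1 else 0) else 0)" for k
      using that by (auto simp: unip_def)
    then show ?thesis by (simp add: matrix_matrix_mult_def)
  qed
  have "(unip X ** unip Y) $ i $ j = unip (mat_coords (unip X ** unip Y)) $ i $ j" for i j
    using entry[of i j] by (auto simp: unip_def not_less)
  then show ?thesis by (simp add: vec_eq_iff)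
qed

lemma scaleR_eq_smult: "r *\<^sub>R (x :: complex ^ 'n) = of_real r *s x"
  by (simp add: vec_eq_iff scaleR_conv_of_real[where 'a = complex])

lemma vec_linear_imp_linear:
  fixes f :: "complex ^ 'a::finite \<Rightarrow> complex ^ 'b::finite"
  assumes "Vector_Spaces.linear (*s) (*s) f"
  shows "linear f"
proof
  interpret f: Vector_Spaces.linear "(*s)" "(*s)" f by (rule assms)
  show "f (x + y) = f x + f y" for x y by (rule f.add)
  show "f (r *\<^sub>R x) = r *\<^sub>R f x" for r x unfolding scaleR_eq_smult by (rule f.scale)
qed

lemma vec_linear_imp_bounded_linear:
  fixes f :: "complex ^ 'a::finite \<Rightarrow> complex ^ 'b::finite"
  assumes "Vector_Spaces.linear (*s) (*s) f"
  shows "bounded_linear f"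
  using vec_linear_imp_linear[OF assms] by (simp add: linear_conv_bounded_linear)

lemma vec_linearI:
  fixes f :: "complex ^ 'a::finite \<Rightarrow> complex ^ 'b::finite"
  assumes "\<And>x y. f (x + y) = f x + f y" "\<And>c x. f (c *s x) = c *s f x"
  shows "Vector_Spaces.linear (*s) (*s) f"
  by unfold_locales (use assms in \<open>auto simp: vector_add_ldistrib vector_sadd_rdistrib\<close>)

lemma vec_subspace_imp_subspace: "vec.subspace (L :: (complex ^ 'n::finite) set) \<Longrightarrow> subspace L"
  unfolding subspace_def vec.subspace_def scaleR_eq_smult by auto

lemma closed_vec_subspace: "vec.subspace (L :: (complex ^ 'n::finite) set) \<Longrightarrow> closed L"
  by (intro closed_subspace vec_subspace_imp_subspace)

section \<open>Holomorphic maps\<close>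

lemma holomorphic_map_on_subset: "holomorphic_map_on f U \<Longrightarrow> V \<subseteq> U \<Longrightarrow> holomorphic_map_on f V"
  by (auto simp: holomorphic_map_on_def)

lemma holomorphic_map_on_compose:
  assumes "holomorphic_map_on f U" "holomorphic_map_on g V" "f ` U \<subseteq> V"
  shows "holomorphic_map_on (\<lambda>x. g (f x)) U"
  unfolding holomorphic_map_on_def
proof
  fix x assume x: "x \<in> U"
  then obtain f' where f': "(f has_derivative f') (at x)" "\<And>c v. f' (c *s v) = c *s f' v"
    using assms(1) by (auto simp: holomorphic_map_on_def)
  from x assms(3) have "f x \<in> V" by auto
  then obtain g' where g': "(g has_derivative g') (at (f x))" "\<And>c v. g' (c *s v) = c *s g' v"
    using assms(2) by (auto simp: holomorphic_map_on_def)
  have "((\<lambda>x. g (f x)) has_derivative (\<lambda>v. g' (f' v))) (at x)"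
    using has_derivative_compose[OF f'(1) g'(1)] .
  then show "\<exists>f'. ((\<lambda>x. g (f x)) has_derivative f') (at x) \<and> (\<forall>c v. f' (c *s v) = c *s f' v)"
    using f'(2) g'(2) by (intro exI[of _ "\<lambda>v. g' (f' v)"]) simp
qed

lemma holomorphic_map_on_add:
  assumes "holomorphic_map_on f U" "holomorphic_map_on g U"
  shows "holomorphic_map_on (\<lambda>x. f x + g x) U"
  unfolding holomorphic_map_on_def
proof
  fix x assume x: "x \<in> U"
  then obtain f' g' where f': "(f has_derivative f') (at x)" "\<And>c v. f' (c *s v) = c *s f' v"
    and g': "(g has_derivative g') (at x)" "\<And>c v. g' (c *s v) = c *s g' v"
    using assms unfolding holomorphic_map_on_def by metis
  have "((\<lambda>x. f x + g x) has_derivative (\<lambda>v. f' v + g' v)) (at x)"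
    using f'(1) g'(1) by (rule has_derivative_add)
  then show "\<exists>f'. ((\<lambda>x. f x + g x) has_derivative f') (at x) \<and> (\<forall>c v. f' (c *s v) = c *s f' v)"
    using f'(2) g'(2) by (intro exI[of _ "\<lambda>v. f' v + g' v"]) (simp add: vector_add_ldistrib)
qed

lemma holomorphic_map_on_linear:
  assumes "Vector_Spaces.linear (*s) (*s) f"
  shows "holomorphic_map_on f U"
  unfolding holomorphic_map_on_def
proof
  fix x assume "x \<in> U"
  interpret f: Vector_Spaces.linear "(*s)" "(*s)" f by (rule assms)
  have "(f has_derivative f) (at x)"
    using vec_linear_imp_bounded_linear[OF assms] by (rule bounded_linear_imp_has_derivative)
  then show "\<exists>f'. (f has_derivative f') (at x) \<and> (\<forall>c v. f' (c *s v) = c *s f' v)"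
    using f.scale by blast
qed

lemma holomorphic_map_on_const: "holomorphic_map_on (\<lambda>x. a) U"
  unfolding holomorphic_map_on_def
proof
  fix x :: "complex ^ 'a"
  show "\<exists>f'. ((\<lambda>x. a) has_derivative f') (at x) \<and> (\<forall>c v. f' (c *s v) = c *s f' v)"
    by (intro exI[of _ "\<lambda>v. 0"]) (simp add: vector_smult_rzero)
qed

lemma holomorphic_map_on_continuous: "holomorphic_map_on f U \<Longrightarrow> continuous_on U f"
  unfolding holomorphic_map_on_def
  by (meson continuous_at_imp_continuous_on has_derivative_continuous)

lemma holomorphic_map_on_cong:
  assumes "holomorphic_map_on f U" "open U" "\<And>x. x \<in> U \<Longrightarrow> f x = g x"
  shows "holomorphic_map_on g U"
  unfolding holomorphic_map_on_def
proof
  fix x assume x: "x \<in> U"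
  then obtain f' where f': "(f has_derivative f') (at x)" "\<And>c v. f' (c *s v) = c *s f' v"
    using assms(1) by (auto simp: holomorphic_map_on_def)
  have "(g has_derivative f') (at x)"
    using has_derivative_transform_within_open[OF f'(1) assms(2) x assms(3)] .
  then show "\<exists>f'. (g has_derivative f') (at x) \<and> (\<forall>c v. f' (c *s v) = c *s f' v)"
    using f'(2) by blast
qed

lemma biholomorphicI:
  assumes "open U" "open U'" "holomorphic_map_on f U" "holomorphic_map_on g U'"
    and "\<And>x. x \<in> U \<Longrightarrow> f x \<in> U'" "\<And>y. y \<in> U' \<Longrightarrow> g y \<in> U"
    and "\<And>x. x \<in> U \<Longrightarrow> g (f x) = x" "\<And>y. y \<in> U' \<Longrightarrow> f (g y) = y"
  shows "biholomorphic f U U'"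
proof -
  have bij: "bij_betw f U U'"
    by (rule bij_betw_byWitness[where f' = g]) (use assms in auto)
  have "inv_into U f y = g y" if "y \<in> U'" for y
    using bij that assms by (metis bij_betw_inv_into_left)
  then have "holomorphic_map_on (inv_into U f) U'"
    using holomorphic_map_on_cong[OF assms(4,2)] by metis
  with bij assms show ?thesis by (simp add: biholomorphic_def)
qed

lemma biholomorphicE:
  assumes "biholomorphic f U U'"
  obtains g where "open U" "open U'" "holomorphic_map_on f U" "holomorphic_map_on g U'"
    "\<And>x. x \<in> U \<Longrightarrow> f x \<in> U'" "\<And>y. y \<in> U' \<Longrightarrow> g y \<in> U"
    "\<And>x. x \<in> U \<Longrightarrow> g (f x) = x" "\<And>y. y \<in> U' \<Longrightarrow> f (g y) = y"
proof
  have bij: "bij_betw f U U'" using assms by (simp add: biholomorphic_def)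
  show "open U" "open U'" "holomorphic_map_on f U" "holomorphic_map_on (inv_into U f) U'"
    using assms by (simp_all add: biholomorphic_def)
  show "f x \<in> U'" "inv_into U f (f x) = x" if "x \<in> U" for x
    using bij that by (auto simp: bij_betw_def)
  show "inv_into U f y \<in> U" "f (inv_into U f y) = y" if "y \<in> U'" for y
    using bij that by (auto simp: bij_betw_def f_inv_into_f inv_into_into)
qed

lemma open_Int_preimage:
  assumes "continuous_on U f" "open U" "open V"
  shows "open {x \<in> U. f x \<in> V}"
  using continuous_open_preimage[OF assms] by (simp add: Int_def vimage_def)

text \<open>The derivative at \<open>p\<close> is \<open>v \<mapsto> A v + B v p + B p v\<close>;
  injectivity makes it invertible in finite dimension, so the inverse function theorem applies. The
  derivative of the local inverse is complex linear because it inverts a complex-linear map.\<close>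

lemma quadratic_local_biholomorphic:
  fixes B :: "complex ^ 'k::finite \<Rightarrow> complex ^ 'k \<Rightarrow> complex ^ 'k"
  assumes A: "Vector_Spaces.linear (*s) (*s) A"
    and B1: "\<And>y. Vector_Spaces.linear (*s) (*s) (\<lambda>x. B x y)"
    and B2: "\<And>x. Vector_Spaces.linear (*s) (*s) (B x)"
    and inj: "\<And>v. A v + B v p + B p v = 0 \<Longrightarrow> v = 0"
  obtains U U' where "p \<in> U" "biholomorphic (\<lambda>x. A x + B x x) U U'"
proof -
  define f where "f = (\<lambda>x. A x + B x x)"
  define f' where "f' = (\<lambda>x v. A v + B v x + B x v)"
  interpret A: Vector_Spaces.linear "(*s)" "(*s)" A by (rule A)
  interpret B1: Vector_Spaces.linear "(*s)" "(*s)" "\<lambda>x. B x y" for y by (rule B1)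
  interpret B2: Vector_Spaces.linear "(*s)" "(*s)" "B x" for x by (rule B2)
  have "bilinear B" unfolding bilinear_def using B1 B2 vec_linear_imp_linear by blast
  then interpret B: bounded_bilinear B by (simp add: bilinear_conv_bounded_bilinear)
  have blA: "bounded_linear A" by (rule vec_linear_imp_bounded_linear[OF A])
  have der: "(f has_derivative f' x) (at x)" for x
  proof -
    have "(f has_derivative (\<lambda>v. A v + (B x v + B v x))) (at x)"
      unfolding f_def
      by (intro has_derivative_add B.FDERIV has_derivative_ident bounded_linear_imp_has_derivative blA)
    then show ?thesis by (simp add: f'_def add.assoc add.commute[of "B _ x"])
  qed
  have lin: "f' x (c *s v) = c *s f' x v" "f' x (v + w) = f' x v + f' x w" for x c v w
    unfolding f'_def by (simp_all add: A.scale B1.scale B2.scale A.add B1.add B2.add vector_add_ldistrib)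
  have linf: "linear (f' x)" for x by (rule vec_linear_imp_linear[OF vec_linearI]) (simp_all add: lin)
  have blf: "bounded_linear (f' x)" for x using linf by (simp add: linear_conv_bounded_linear)
  \<comment> \<open>The inverse function theorem asks for the derivative as a continuous function
    into bounded linear maps.\<close>
  define F where "F = (\<lambda>x. Blinfun (f' x))"
  have F: "blinfun_apply (F x) = f' x" for x
    unfolding F_def by (rule bounded_linear_Blinfun_apply[OF blf])
  have contF: "continuous_on UNIV F"
    by (rule continuous_on_blinfun_componentwise) (auto simp: F f'_def intro!: continuous_intros B.continuous_on)
  have "inj (f' p)"
    unfolding linear_injective_0[OF linf] using inj unfolding f'_def by blast
  then obtain g where g: "linear g" "g \<circ> f' p = id"
    using linear_injective_left_inverse[OF linf] by blast
  have invF: "Blinfun g o\<^sub>L F p = id_blinfun"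
    by (rule blinfun_eqI)
      (use g in \<open>simp add: F bounded_linear_Blinfun_apply linear_conv_bounded_linear fun_eq_iff\<close>)
  have derF: "(f has_derivative blinfun_apply (F x)) (at x)" for x using der[of x] by (simp add: F)
  obtain U V h h' where UV: "open U" "p \<in> U" "open V" "homeomorphism U V f h"
    "\<And>y. y \<in> V \<Longrightarrow> (h has_derivative (h' y)) (at y)"
    "\<And>y. y \<in> V \<Longrightarrow> h' y = inv (blinfun_apply (F (h y)))"
    "\<And>y. y \<in> V \<Longrightarrow> bij (blinfun_apply (F (h y)))"
    by (rule inverse_function_theorem[OF open_UNIV derF contF UNIV_I invF]) (rule that)
  have "biholomorphic f U V"
  proof (rule biholomorphicI[where g = h])
    show "holomorphic_map_on f U"
      unfolding holomorphic_map_on_def using der lin by blast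
    show "holomorphic_map_on h V"
      unfolding holomorphic_map_on_def
    proof
      fix y assume y: "y \<in> V"
      have bij: "bij (f' (h y))" using UV(7)[OF y] by (simp add: F)
      have "h' y (c *s v) = c *s h' y v" for c v
      proof -
        have "f' (h y) (c *s inv (f' (h y)) v) = c *s v"
          using bij by (simp add: lin bij_is_surj surj_f_inv_f)
        then have "inv (f' (h y)) (c *s v) = c *s inv (f' (h y)) v"
          using bij by (metis bij_is_inj inv_f_f)
        then show ?thesis by (simp add: UV(6)[OF y] F)
      qed
      then show "\<exists>f'. (h has_derivative f') (at y) \<and> (\<forall>c v. f' (c *s v) = c *s f' v)"
        using UV(5)[OF y] by blast
    qed
  qed (use UV(1,3,4) in \<open>auto simp: homeomorphism_def\<close>)
  then show ?thesis using that UV(2) unfolding f_def by blast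
qed

section \<open>Local straightening of subsets\<close>

definition straight_at :: "nat \<Rightarrow> (complex ^ 'k::finite) set \<Rightarrow> complex ^ 'k \<Rightarrow> bool" where
  "straight_at d S p \<longleftrightarrow> (\<exists>U U' h L. p \<in> U \<and> biholomorphic h U U' \<and>
     vec.subspace L \<and> vec.dim L = d \<and> h ` (S \<inter> U) = L \<inter> U')"

lemma submanifold_of_space_iff: "submanifold_of_space d S \<longleftrightarrow> (\<forall>p\<in>S. straight_at d S p)"
  by (simp add: submanifold_of_space_def straight_at_def)

lemma straight_atE:
  assumes "straight_at d S p"
  obtains U U' h g L where "p \<in> U" "open U" "open U'" "holomorphic_map_on h U" "holomorphic_map_on g U'"
    "\<And>x. x \<in> U \<Longrightarrow> h x \<in> U'" "\<And>y. y \<in> U' \<Longrightarrow> g y \<in> U"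
    "\<And>x. x \<in> U \<Longrightarrow> g (h x) = x" "\<And>y. y \<in> U' \<Longrightarrow> h (g y) = y"
    "vec.subspace L" "vec.dim L = d" "\<And>x. x \<in> U \<Longrightarrow> x \<in> S \<longleftrightarrow> h x \<in> L"
proof -
  obtain U U' h L where U: "p \<in> U" "biholomorphic h U U'" "vec.subspace L" "vec.dim L = d"
    "h ` (S \<inter> U) = L \<inter> U'"
    using assms by (auto simp: straight_at_def)
  obtain g where g: "open U" "open U'" "holomorphic_map_on h U" "holomorphic_map_on g U'"
    "\<And>x. x \<in> U \<Longrightarrow> h x \<in> U'" "\<And>y. y \<in> U' \<Longrightarrow> g y \<in> U"
    "\<And>x. x \<in> U \<Longrightarrow> g (h x) = x" "\<And>y. y \<in> U' \<Longrightarrow> h (g y) = y"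
    by (rule biholomorphicE[OF U(2)]) (rule that)
  have "x \<in> S \<longleftrightarrow> h x \<in> L" if x: "x \<in> U" for x
  proof
    show "x \<in> S \<Longrightarrow> h x \<in> L" using U(5) x by blast
    assume "h x \<in> L"
    then obtain y where y: "h x = h y" "y \<in> S" "y \<in> U" using U(5) g(5)[OF x] by blast
    have "x = g (h y)" using g(7)[OF x] y(1) by simp
    also have "\<dots> = y" using y(3) by (rule g(7))
    finally show "x \<in> S" using y(2) by simp
  qed
  with U(1) g U(3,4) show ?thesis by (rule that)
qed

lemma straight_atI:
  assumes "p \<in> U" "biholomorphic h U U'" "vec.subspace L" "vec.dim L = d"
    "\<And>x. x \<in> U \<Longrightarrow> x \<in> S \<longleftrightarrow> h x \<in> L"
  shows "straight_at d S p"
proof -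
  obtain g where g: "\<And>x. x \<in> U \<Longrightarrow> h x \<in> U'" "\<And>y. y \<in> U' \<Longrightarrow> g y \<in> U" "\<And>y. y \<in> U' \<Longrightarrow> h (g y) = y"
    by (rule biholomorphicE[OF assms(2)]) blast
  have "h ` (S \<inter> U) = L \<inter> U'"
  proof
    show "h ` (S \<inter> U) \<subseteq> L \<inter> U'" using assms(5) g(1) by auto
    show "L \<inter> U' \<subseteq> h ` (S \<inter> U)"
    proof
      fix y assume y: "y \<in> L \<inter> U'"
      then have "h (g y) = y" "g y \<in> U" using g by auto
      with y assms(5) show "y \<in> h ` (S \<inter> U)" by (intro image_eqI[of _ _ "g y"]) auto
    qed
  qed
  then show ?thesis using assms(1-4) unfolding straight_at_def by blast
qed

text \<open>Composing a straightening with a biholomorphic map straightens the preimage, once both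
  domains are cut down to where the composite is defined.\<close>

lemma straight_at_transfer:
  assumes \<phi>: "biholomorphic \<phi> W W'" and p: "p \<in> W" and st: "straight_at d S' (\<phi> p)"
    and iff: "\<And>x. x \<in> W \<Longrightarrow> x \<in> S \<longleftrightarrow> \<phi> x \<in> S'"
  shows "straight_at d S p"
proof -
  obtain U U' h g L where U: "\<phi> p \<in> U" "open U" "open U'" "holomorphic_map_on h U" "holomorphic_map_on g U'"
    "\<And>x. x \<in> U \<Longrightarrow> h x \<in> U'" "\<And>y. y \<in> U' \<Longrightarrow> g y \<in> U"
    "\<And>x. x \<in> U \<Longrightarrow> g (h x) = x" "\<And>y. y \<in> U' \<Longrightarrow> h (g y) = y"
    "vec.subspace L" "vec.dim L = d" "\<And>x. x \<in> U \<Longrightarrow> x \<in> S' \<longleftrightarrow> h x \<in> L"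
    by (rule straight_atE[OF st]) (rule that)
  obtain \<psi> where \<psi>: "open W" "open W'" "holomorphic_map_on \<phi> W" "holomorphic_map_on \<psi> W'"
    "\<And>x. x \<in> W \<Longrightarrow> \<phi> x \<in> W'" "\<And>y. y \<in> W' \<Longrightarrow> \<psi> y \<in> W"
    "\<And>x. x \<in> W \<Longrightarrow> \<psi> (\<phi> x) = x" "\<And>y. y \<in> W' \<Longrightarrow> \<phi> (\<psi> y) = y"
    by (rule biholomorphicE[OF \<phi>]) (rule that)
  define W0 where "W0 = {x \<in> W. \<phi> x \<in> U}"
  define U0 where "U0 = {y \<in> U'. g y \<in> W'}"
  have "biholomorphic (\<lambda>x. h (\<phi> x)) W0 U0"
  proof (rule biholomorphicI[where g = "\<lambda>y. \<psi> (g y)"])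
    show "open W0" "open U0" unfolding W0_def U0_def
      using U \<psi> by (auto intro!: open_Int_preimage holomorphic_map_on_continuous)
    show "holomorphic_map_on (\<lambda>x. h (\<phi> x)) W0"
      by (rule holomorphic_map_on_compose[OF holomorphic_map_on_subset[OF \<psi>(3)] U(4)]) (auto simp: W0_def)
    show "holomorphic_map_on (\<lambda>y. \<psi> (g y)) U0"
      by (rule holomorphic_map_on_compose[OF holomorphic_map_on_subset[OF U(5)] \<psi>(4)]) (auto simp: U0_def)
  qed (auto simp: W0_def U0_def U \<psi>)
  moreover have "p \<in> W0" using p U(1) by (simp add: W0_def)
  ultimately show ?thesis
    by (intro straight_atI[OF _ _ U(10,11)]) (auto simp: W0_def iff U)
qed

lemma biholomorphic_id: "open W \<Longrightarrow> biholomorphic (\<lambda>x. x) W W"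
  by (rule biholomorphicI[where g = "\<lambda>x. x"]) (auto intro!: holomorphic_map_on_linear vec_linearI)

lemma straight_at_local:
  assumes "straight_at d S' p" "open W" "p \<in> W" "\<And>x. x \<in> W \<Longrightarrow> x \<in> S \<longleftrightarrow> x \<in> S'"
  shows "straight_at d S p"
  using straight_at_transfer[OF biholomorphic_id[OF assms(2)] assms(3)] assms by simp

lemma straight_at_subspace:
  assumes "vec.subspace L"
  shows "straight_at (vec.dim L) L p"
  by (rule straight_atI[OF UNIV_I biholomorphic_id[OF open_UNIV] assms refl]) simp

lemma holomorphic_inverse_derivative:
  fixes h g :: "complex ^ 'k::finite \<Rightarrow> complex ^ 'k"
  assumes "(h has_derivative h') (at (g y))" "(g has_derivative g') (at y)"
    and "open V" "y \<in> V" "\<And>z. z \<in> V \<Longrightarrow> h (g z) = z"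
  shows "h' (g' v) = v"
proof -
  have "((\<lambda>z. h (g z)) has_derivative (\<lambda>v. h' (g' v))) (at y)"
    using has_derivative_compose[OF assms(2,1)] .
  then have "((\<lambda>z. z) has_derivative (\<lambda>v. h' (g' v))) (at y)"
    by (rule has_derivative_transform_within_open[OF _ assms(3,4)]) (use assms(5) in auto)
  moreover have "((\<lambda>z. z) has_derivative (\<lambda>v. v)) (at y)" by (rule has_derivative_ident)
  ultimately have "(\<lambda>v. h' (g' v)) = (\<lambda>v. v)" by (rule has_derivative_unique)
  then show ?thesis by (rule fun_cong)
qed

text \<open>The passage from one straightening to the other has an injective complex-linear
  derivative \<open>T\<close>. Near the base point it maps \<open>L\<close> into \<open>M\<close>,
  hence \<open>T\<close> maps \<open>L\<close> into \<open>M\<close>, and the dimensions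
  compare.\<close>

lemma straight_at_dim_le:
  fixes S :: "(complex ^ 'k::finite) set"
  assumes "p \<in> S" "straight_at d S p" "straight_at d' S p"
  shows "d \<le> d'"
proof -
  obtain U U' h g L where U: "p \<in> U" "open U" "open U'" "holomorphic_map_on h U" "holomorphic_map_on g U'"
    "\<And>x. x \<in> U \<Longrightarrow> h x \<in> U'" "\<And>y. y \<in> U' \<Longrightarrow> g y \<in> U"
    "\<And>x. x \<in> U \<Longrightarrow> g (h x) = x" "\<And>y. y \<in> U' \<Longrightarrow> h (g y) = y"
    "vec.subspace L" "vec.dim L = d" "\<And>x. x \<in> U \<Longrightarrow> x \<in> S \<longleftrightarrow> h x \<in> L"
    by (rule straight_atE[OF assms(2)]) (rule that)
  obtain W W' k l M where W: "p \<in> W" "open W" "open W'" "holomorphic_map_on k W" "holomorphic_map_on l W'"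
    "\<And>x. x \<in> W \<Longrightarrow> k x \<in> W'" "\<And>y. y \<in> W' \<Longrightarrow> l y \<in> W"
    "\<And>x. x \<in> W \<Longrightarrow> l (k x) = x" "\<And>y. y \<in> W' \<Longrightarrow> k (l y) = y"
    "vec.subspace M" "vec.dim M = d'" "\<And>x. x \<in> W \<Longrightarrow> x \<in> S \<longleftrightarrow> k x \<in> M"
    by (rule straight_atE[OF assms(3)]) (rule that)
  define q where "q = h p"
  have q: "q \<in> U'" "g q = p" "q \<in> L" using U assms(1) by (auto simp: q_def)
  obtain g' where g': "(g has_derivative g') (at q)" "\<And>c v. g' (c *s v) = c *s g' v"
    using U(5) q by (auto simp: holomorphic_map_on_def)
  obtain h' where h': "(h has_derivative h') (at (g q))" using U(4) U(1) q by (auto simp: holomorphic_map_on_def)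
  obtain k' where k': "(k has_derivative k') (at p)" "\<And>c v. k' (c *s v) = c *s k' v"
    using W(1,4) by (auto simp: holomorphic_map_on_def)
  obtain l' where l': "(l has_derivative l') (at (k p))" using W(5) W(6)[OF W(1)] by (auto simp: holomorphic_map_on_def)
  have hg: "h' (g' v) = v" for v using holomorphic_inverse_derivative[OF h' g'(1) U(3) q(1) U(9)] .
  have "(k has_derivative k') (at (l (k p)))" using k' W by simp
  have lk: "l' (k' v) = v" for v using holomorphic_inverse_derivative[OF l' k'(1) W(2,1) W(8)] .
  define T where "T = (\<lambda>v. k' (g' v))"
  have T: "((\<lambda>y. k (g y)) has_derivative T) (at q)"
    unfolding T_def using has_derivative_compose[OF g'(1)] k'(1) q(2) by simp
  have T_lin: "Vector_Spaces.linear (*s) (*s) T"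
  proof (rule vec_linearI)
    show "T (x + y) = T x + T y" for x y by (rule linear_add[OF has_derivative_linear[OF T]])
    show "T (c *s x) = c *s T x" for c x by (simp add: T_def g' k')
  qed
  have T_inj: "inj T"
    unfolding T_def by (rule inj_on_inverseI[where g = "\<lambda>w. h' (l' w)"]) (simp add: hg lk)
  define O1 where "O1 = {y \<in> U'. g y \<in> W}"
  have O1: "open O1" "q \<in> O1" using open_Int_preimage[OF holomorphic_map_on_continuous[OF U(5)] U(3) W(2)] q W(1)
    by (auto simp: O1_def)
  \<comment> \<open>\<open>T v\<close> is the limit of difference quotients along the real line
    \<open>q + t v\<close>. This line stays in \<open>L\<close>, so the quotients lie in
    \<open>M\<close>, and a linear subspace is closed.\<close>
  have "T v \<in> M" if v: "v \<in> L" for v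
  proof -
    have line: "((\<lambda>t::real. q + t *\<^sub>R v) has_derivative (\<lambda>t. t *\<^sub>R v)) (at 0)"
      by (auto intro!: derivative_eq_intros)
    have "((\<lambda>t::real. k (g (q + t *\<^sub>R v))) has_derivative (\<lambda>t. T (t *\<^sub>R v))) (at 0)"
      using has_derivative_compose[OF line, of "\<lambda>y. k (g y)" T] T by simp
    moreover have "T (t *\<^sub>R v) = t *\<^sub>R T v" for t :: real
      using linear_scale[OF vec_linear_imp_linear[OF T_lin]] .
    ultimately have "(\<lambda>t::real. norm (k (g (q + t *\<^sub>R v)) - k (g q) - t *\<^sub>R T v) / norm t) \<midarrow>0\<rightarrow> 0"
      by (simp add: has_derivative_at)
    then have "(\<lambda>t::real. norm ((k (g (q + t *\<^sub>R v)) - k (g q)) /\<^sub>R t - T v)) \<midarrow>0\<rightarrow> 0"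
    proof (rule Lim_transform_eventually)
      have key: "norm (x - t *\<^sub>R y) / norm t = norm (x /\<^sub>R t - y)" if "t \<noteq> 0" for x y :: "complex ^ 'k" and t :: real
      proof -
        have "x /\<^sub>R t - y = (x - t *\<^sub>R y) /\<^sub>R t" using that by (simp add: scaleR_diff_right)
        then show ?thesis by (simp add: divide_inverse mult.commute)
      qed
      show "\<forall>\<^sub>F t::real in at 0. norm (k (g (q + t *\<^sub>R v)) - k (g q) - t *\<^sub>R T v) / norm t =
          norm ((k (g (q + t *\<^sub>R v)) - k (g q)) /\<^sub>R t - T v)"
        unfolding eventually_at_filter by (rule always_eventually) (intro allI impI key)
    qed
    then have lim: "((\<lambda>t::real. (k (g (q + t *\<^sub>R v)) - k (g q)) /\<^sub>R t) \<longlongrightarrow> T v) (at 0)"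
      by (rule LIM_zero_cancel[OF tendsto_norm_zero_cancel])
    have ev: "\<forall>\<^sub>F t::real in at 0. (k (g (q + t *\<^sub>R v)) - k (g q)) /\<^sub>R t \<in> M"
    proof -
      have "continuous (at 0) (\<lambda>t::real. q + t *\<^sub>R v)" by (intro continuous_intros)
      then have "((\<lambda>t::real. q + t *\<^sub>R v) \<longlongrightarrow> q) (at 0)" by (simp add: continuous_at)
      then have "\<forall>\<^sub>F t::real in at 0. q + t *\<^sub>R v \<in> O1" using O1 by (rule topological_tendstoD)
      then show ?thesis
      proof (rule eventually_mono)
        fix t :: real assume t: "q + t *\<^sub>R v \<in> O1"
        have in_M: "k (g y) \<in> M" if "y \<in> O1" "y \<in> L" for y
        proof -
          from that have "y \<in> U'" "g y \<in> W" by (auto simp: O1_def)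
          moreover from this have "g y \<in> S" using U(7,9,12) that(2) by simp
          ultimately show ?thesis using W(12) by simp
        qed
        have "q + t *\<^sub>R v \<in> L" using q(3) v U(10) unfolding scaleR_eq_smult
          by (simp add: vec.subspace_add vec.subspace_scale)
        then show "(k (g (q + t *\<^sub>R v)) - k (g q)) /\<^sub>R t \<in> M"
          using in_M t O1(2) q(3) W(10) unfolding scaleR_eq_smult
          by (intro vec.subspace_scale vec.subspace_diff) (auto simp: scaleR_eq_smult)
      qed
    qed
    show ?thesis
      by (rule Lim_in_closed_set[OF closed_vec_subspace[OF W(10)] ev _ lim]) simp
  qed
  then have "T ` L \<subseteq> M" by auto
  moreover have "vec.dim (T ` L) = vec.dim L"
    by (rule vec.dim_image_eq[OF T_lin]) (rule inj_on_subset[OF T_inj], simp)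
  ultimately show ?thesis using vec.dim_subset[of "T ` L" M] U(11) W(11) by simp
qed

lemma straight_at_dim_unique:
  "p \<in> S \<Longrightarrow> straight_at d S p \<Longrightarrow> straight_at d' S p \<Longrightarrow> d = d'"
  by (meson straight_at_dim_le le_antisym)

section \<open>Charts of the flag manifold\<close>

definition low :: "'m::enum coords \<Rightarrow> 'm coords" where
  "low X = (\<chi> p. if idx (snd p) < idx (fst p) then X $ p else 0)"

text \<open>The diagonal is included, so that \<open>low\<close> and \<open>up\<close> add up to the
  identity. Chart changes live on the whole matrix space and are made to preserve this part; thereby
  they preserve \<open>strictly_lower\<close> as well.\<close>

definition up :: "'m::enum coords \<Rightarrow> 'm coords" where
  "up X = (\<chi> p. if idx (fst p) \<le> idx (snd p) then X $ p else 0)"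

definition coords_mat :: "'m::enum coords \<Rightarrow> 'm cmat" where
  "coords_mat X = (\<chi> i j. X $ (i, j))"

lemma low_component [simp]: "low X $ (i, j) = (if idx j < idx i then X $ (i, j) else 0)"
  by (simp add: low_def)

lemma up_component [simp]: "up X $ (i, j) = (if idx i \<le> idx j then X $ (i, j) else 0)"
  by (simp add: up_def)

lemma coords_mat_component [simp]: "coords_mat X $ i $ j = X $ (i, j)"
  by (simp add: coords_mat_def)

lemma coords_eq_iff: "X = Y \<longleftrightarrow> (\<forall>i j. X $ (i, j) = Y $ (i, j))"
  by (auto simp: vec_eq_iff)

lemma coords_mat_inverse [simp]: "coords_mat (mat_coords M) = M" "mat_coords (coords_mat X) = X"
  by (simp_all add: vec_eq_iff coords_eq_iff)

lemma low_linear: "Vector_Spaces.linear (*s) (*s) low"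
  by (rule vec_linearI) (simp_all add: coords_eq_iff)

lemma up_linear: "Vector_Spaces.linear (*s) (*s) up"
  by (rule vec_linearI) (simp_all add: coords_eq_iff)

lemma low_up: "low X + up X = X"
  by (auto simp: coords_eq_iff)

lemma up_eq_0_iff: "up X = 0 \<longleftrightarrow> X \<in> strictly_lower"
  by (simp add: coords_eq_iff strictly_lower_iff)

lemma low_strictly_lower: "X \<in> strictly_lower \<Longrightarrow> low X = X"
  by (auto simp: coords_eq_iff strictly_lower_iff)

lemma low_in_strictly_lower: "low X \<in> strictly_lower"
  by (auto simp: strictly_lower_iff)

lemma unip_low: "unip X = mat 1 + coords_mat (low X)"
  by (auto simp: vec_eq_iff unip_def mat_def)

lemma matrix_add_rdistrib: "(A + B) ** C = A ** C + B ** (C :: 'a::semiring_1 ^ 'n ^ 'k::finite)"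
  by (simp add: vec_eq_iff matrix_matrix_mult_def distrib_right sum.distrib)

lemma mult_linear: "Vector_Spaces.linear (*s) (*s) (\<lambda>X. mat_coords (A ** coords_mat (low X) ** B))"
proof (rule vec_linearI)
  have lin: "coords_mat (low (X + Y)) = coords_mat (low X) + coords_mat (low Y)"
    "coords_mat (low (c *s X)) = smat c (coords_mat (low X))" for X Y c
    by (simp_all add: vec_eq_iff smat_def)
  show "mat_coords (A ** coords_mat (low (X + Y)) ** B) =
      mat_coords (A ** coords_mat (low X) ** B) + mat_coords (A ** coords_mat (low Y) ** B)" for X Y
    unfolding lin by (simp add: coords_eq_iff matrix_add_ldistrib matrix_add_rdistrib)
  show "mat_coords (A ** coords_mat (low (c *s X)) ** B) = c *s mat_coords (A ** coords_mat (low X) ** B)" for c X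
    unfolding lin
    by (simp add: coords_eq_iff smat_def matrix_matrix_mult_def sum_distrib_left sum_distrib_right mult_ac)
qed

text \<open>The \<open>LU\<close> factorisation near the identity, as the local inverse of
  \<open>X \<mapsto> (1 + L) U\<close> with \<open>L\<close> the strictly lower and \<open>U\<close> the upper part of \<open>X\<close>.\<close>

lemma lu_near_identity:
  obtains W lu where "open W" "mat_coords (mat 1) \<in> W" "holomorphic_map_on lu W"
    "\<And>M :: 'm::enum cmat. mat_coords M \<in> W \<Longrightarrow> det M \<noteq> 0 \<Longrightarrow>
      act M std_flag = act (unip (lu (mat_coords M))) std_flag"
    "\<And>Y. Y \<in> W \<Longrightarrow> lu Y \<in> strictly_lower"
proof -
  \<comment> \<open>With this bilinear map, \<open>up X + B X X\<close> is the product of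
    \<open>1 + low X\<close> and the upper part of \<open>X\<close>.\<close>
  define B where "B = (\<lambda>X Y :: 'm coords. mat_coords (coords_mat (low X) ** coords_mat (up Y)))"
  define p :: "'m coords" where "p = mat_coords (mat 1)"
  have B1: "Vector_Spaces.linear (*s) (*s) (\<lambda>X. B X Y)" for Y
    using mult_linear[of "mat 1" "coords_mat (up Y)"] by (simp add: B_def)
  have B2: "Vector_Spaces.linear (*s) (*s) (B X)" for X
  proof (rule vec_linearI)
    show "B X (Y + Z) = B X Y + B X Z" for Y Z
      unfolding B_def by (simp add: coords_eq_iff matrix_matrix_mult_def distrib_left sum.distrib if_distrib
          cong: if_cong)
        (auto simp: sum.distrib[symmetric] distrib_left intro!: sum.cong)
    show "B X (c *s Y) = c *s B X Y" for c Y
      unfolding B_def by (auto simp: coords_eq_iff matrix_matrix_mult_def sum_distrib_left intro!: sum.cong)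
  qed
  have p: "low p = 0" "coords_mat (up p) = mat 1"
    by (auto simp: p_def coords_eq_iff vec_eq_iff mat_def)
  \<comment> \<open>At the identity the lower part vanishes and the upper part is 1, so the
    derivative is \<open>v \<mapsto> up v + low v\<close>, the identity map.\<close>
  have inj: "v = 0" if "up v + B v p + B p v = 0" for v
  proof -
    have "B v p = low v" unfolding B_def p by simp
    moreover have "B p v = 0" unfolding B_def p(1) by (simp add: coords_eq_iff matrix_matrix_mult_def)
    ultimately show ?thesis using that low_up[of v] by (simp add: add.commute)
  qed
  obtain U U' where U: "p \<in> U" "biholomorphic (\<lambda>X. up X + B X X) U U'"
    using quadratic_local_biholomorphic[OF up_linear B1 B2 inj] by blast
  obtain g where g: "open U" "open U'" "holomorphic_map_on (\<lambda>X. up X + B X X) U" "holomorphic_map_on g U'"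
    "\<And>x. x \<in> U \<Longrightarrow> up x + B x x \<in> U'" "\<And>y. y \<in> U' \<Longrightarrow> g y \<in> U"
    "\<And>x. x \<in> U \<Longrightarrow> g (up x + B x x) = x" "\<And>y. y \<in> U' \<Longrightarrow> up (g y) + B (g y) (g y) = y"
    by (rule biholomorphicE[OF U(2)]) (rule that)
  show ?thesis
  proof
    show "open U'" by (rule g)
    have "up p + B p p = p" using p by (simp add: B_def low_up coords_eq_iff p_def mat_def matrix_matrix_mult_def)
    then show "mat_coords (mat 1) \<in> U'" using g(5)[OF U(1)] by (simp add: p_def)
    show "holomorphic_map_on (\<lambda>Y. low (g Y)) U'"
      by (rule holomorphic_map_on_compose[OF g(4) holomorphic_map_on_linear[OF low_linear, where U = UNIV]]) simp
    show "low (g Y) \<in> strictly_lower" for Y by (rule low_in_strictly_lower)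
    show "act M std_flag = act (unip (low (g (mat_coords M)))) std_flag"
      if M: "mat_coords M \<in> U'" "det M \<noteq> 0" for M :: "'m cmat"
    proof -
      define X where "X = g (mat_coords M)"
      define R where "R = coords_mat (up X)"
      have "unip (low X) ** R = R + coords_mat (low X) ** R"
        unfolding unip_low by (simp add: matrix_add_rdistrib coords_eq_iff low_strictly_lower low_in_strictly_lower)
      also have "\<dots> = coords_mat (up X + B X X)"
        by (simp add: R_def B_def vec_eq_iff)
      also have "\<dots> = M" using g(8)[OF M(1)] by (simp add: X_def)
      finally have M_eq: "M = unip (low X) ** R" by simp
      then have "det R \<noteq> 0" using M(2) by (auto simp: det_mul)
      \<comment> \<open>The factor \<open>R\<close> is upper triangular, so only the unipotent
        factor moves the standard flag.\<close>
      then have "act R std_flag = std_flag"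
        by (subst act_std_fixed_iff) (auto simp: R_def)
      then show ?thesis unfolding X_def[symmetric] by (subst M_eq) (simp add: act_mult)
    qed
  qed
qed

lemma unip_cong: "low X = low Y \<Longrightarrow> unip X = unip Y"
  unfolding unip_low by simp

lemma flag_param_inj:
  assumes "det g \<noteq> 0" "flag_param g X = flag_param g Y"
  shows "low X = low Y"
proof -
  have "act (unip X) std_flag = act (unip Y) std_flag"
    using assms act_cancel[OF assms(1)] unfolding flag_param_eq act_mult by blast
  then show ?thesis using unip_flag_inj[of X Y] by (simp add: coords_eq_iff)
qed

text \<open>LU factorisation is available only near the identity. Since the two parameters give the
  same flag, \<open>c = H ** g ** unip X0\<close> fixes the standard flag, and so does its inverse
  \<open>c'\<close>. Multiplying by \<open>c'\<close> on the right changes no flag and makes the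
  family \<open>M X\<close> pass through the identity at \<open>X0\<close>.\<close>

lemma chart_transition_half:
  fixes g g' :: "'m::enum cmat"
  assumes g: "g \<in> SL" "g' \<in> SL" and eq: "flag_param g X0 = flag_param g' X0'"
  obtains W \<psi> where "open W" "X0 \<in> W" "holomorphic_map_on \<psi> W"
    "\<And>X. X \<in> W \<Longrightarrow> flag_param g' (\<psi> X) = flag_param g X" "\<And>X. X \<in> W \<Longrightarrow> up (\<psi> X) = up X"
proof -
  obtain W0 lu where W0: "open W0" "mat_coords (mat 1) \<in> W0" "holomorphic_map_on lu W0"
    "\<And>M :: 'm::enum cmat. mat_coords M \<in> W0 \<Longrightarrow> det M \<noteq> 0 \<Longrightarrow>
      act M std_flag = act (unip (lu (mat_coords M))) std_flag"
    "\<And>Y. Y \<in> W0 \<Longrightarrow> lu Y \<in> strictly_lower"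
    by (rule lu_near_identity) (rule that)
  obtain H where H: "H \<in> SL" "g' ** unip X0' ** H = mat 1" "H ** (g' ** unip X0') = mat 1"
    using SL_inverse[OF SL_mult[OF g(2) unip_SL]] by metis
  define c where "c = H ** g ** unip X0"
  have c_SL: "c \<in> SL" unfolding c_def by (intro SL_mult H g unip_SL)
  have "act c std_flag = act H (flag_param g X0)"
    unfolding c_def flag_param_eq by (simp add: act_mult)
  also have "\<dots> = act H (act (g' ** unip X0') std_flag)"
    using eq by (simp only: flag_param_eq)
  also have "\<dots> = act (H ** (g' ** unip X0')) std_flag"
    by (rule act_mult[symmetric])
  finally have c_fix: "act c std_flag = std_flag" unfolding H(3) by simp
  obtain c' where c': "c' \<in> SL" "c ** c' = mat 1" "c' ** c = mat 1" by (rule SL_inverse[OF c_SL])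
  have c'_fix: "act c' std_flag = std_flag"
    by (metis act_mult act_one c'(3) c_fix)
  define M where "M = (\<lambda>X. H ** g ** unip X ** c')"
  have M_eq: "mat_coords (M X) = mat_coords (H ** g ** c') + mat_coords (H ** g ** coords_mat (low X) ** c')" for X
    unfolding M_def unip_low by (simp add: coords_eq_iff matrix_add_ldistrib matrix_add_rdistrib)
  have hol_M: "holomorphic_map_on (\<lambda>X. mat_coords (M X)) UNIV"
    unfolding M_eq by (intro holomorphic_map_on_add holomorphic_map_on_const holomorphic_map_on_linear mult_linear)
  define W where "W = {X. mat_coords (M X) \<in> W0}"
  define Y where "Y = (\<lambda>X. lu (mat_coords (M X)))"
  \<comment> \<open>The two lower terms are those of the product
    \<open>unip X0' ** unip (Y X)\<close>, written as a constant plus a linear image of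
    \<open>low (Y X)\<close> so that holomorphy is visible; the upper part of \<open>X\<close> is
    carried along.\<close>
  define \<psi> where "\<psi> = (\<lambda>X. (up X + low (mat_coords (unip X0'))) + low (mat_coords (unip X0' ** coords_mat (low (Y X)) ** mat 1)))"
  have W: "open W"
    using open_Int_preimage[OF holomorphic_map_on_continuous[OF hol_M] open_UNIV W0(1)] by (simp add: W_def)
  have hol_Y: "holomorphic_map_on Y W" unfolding Y_def
    by (rule holomorphic_map_on_compose[OF holomorphic_map_on_subset[OF hol_M] W0(3)]) (auto simp: W_def)
  show ?thesis
  proof
    show "open W" by (rule W)
    have "M X0 = mat 1" using c'(2) by (simp add: M_def c_def)
    then show "X0 \<in> W" using W0(2) by (simp add: W_def)
    show "holomorphic_map_on \<psi> W"
      unfolding \<psi>_def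
      by (intro holomorphic_map_on_add holomorphic_map_on_const holomorphic_map_on_linear up_linear
        holomorphic_map_on_compose[OF holomorphic_map_on_compose[OF hol_Y holomorphic_map_on_linear[OF mult_linear, where U = UNIV]]
          holomorphic_map_on_linear[OF low_linear, where U = UNIV]]) auto
    fix X assume X: "X \<in> W"
    show "up (\<psi> X) = up X" by (auto simp: \<psi>_def coords_eq_iff)
    have "low (\<psi> X) = low (mat_coords (unip X0' ** unip (Y X)))"
      unfolding \<psi>_def unip_low[of "Y X"] by (auto simp: coords_eq_iff matrix_add_ldistrib)
    then have "unip (\<psi> X) = unip (mat_coords (unip X0' ** unip (Y X)))" by (rule unip_cong)
    then have unip_\<psi>: "unip (\<psi> X) = unip X0' ** unip (Y X)" using unip_mult[of X0' "Y X"] by simp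
    have "det (M X) \<noteq> 0" unfolding M_def by (intro SL_det_nz SL_mult H g c' unip_SL)
    then have "act (unip (Y X)) std_flag = act (M X) std_flag"
      using W0(4)[of "M X"] X by (simp add: W_def Y_def)
    then have "flag_param g' (\<psi> X) = act (g' ** unip X0') (act (M X) std_flag)"
      unfolding flag_param_eq unip_\<psi> by (simp add: act_mult)
    also have "\<dots> = act ((g' ** unip X0' ** H) ** (g ** unip X)) (act c' std_flag)"
      unfolding M_def by (simp add: act_mult)
    also have "\<dots> = flag_param g X" unfolding H(2) c'_fix by (simp add: flag_param_eq)
    finally show "flag_param g' (\<psi> X) = flag_param g X" .
  qed
qed

text \<open>The two halves invert each other because a coordinate vector is determined by its flag,
  which gives the lower part, together with its upper part.\<close>

lemma chart_transition:
  fixes g g' :: "'m::enum cmat"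
  assumes g: "g \<in> SL" "g' \<in> SL" and eq: "flag_param g X0 = flag_param g' X0'"
    and X0: "X0 \<in> strictly_lower" "X0' \<in> strictly_lower"
  obtains W W' \<phi> where "biholomorphic \<phi> W W'" "X0 \<in> W" "\<phi> X0 = X0'"
    "\<And>X. X \<in> W \<Longrightarrow> flag_param g' (\<phi> X) = flag_param g X"
    "\<And>X. X \<in> W \<Longrightarrow> \<phi> X \<in> strictly_lower \<longleftrightarrow> X \<in> strictly_lower"
proof -
  obtain W \<psi> where W: "open W" "X0 \<in> W" "holomorphic_map_on \<psi> W"
    "\<And>X. X \<in> W \<Longrightarrow> flag_param g' (\<psi> X) = flag_param g X" "\<And>X. X \<in> W \<Longrightarrow> up (\<psi> X) = up X"
    by (rule chart_transition_half[OF g eq]) (rule that)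
  obtain W' \<psi>' where W': "open W'" "X0' \<in> W'" "holomorphic_map_on \<psi>' W'"
    "\<And>X. X \<in> W' \<Longrightarrow> flag_param g (\<psi>' X) = flag_param g' X" "\<And>X. X \<in> W' \<Longrightarrow> up (\<psi>' X) = up X"
    by (rule chart_transition_half[OF g(2,1) eq[symmetric]]) (rule that)
  have eqI: "X = Y" if "h \<in> SL" "flag_param h X = flag_param h Y" "up X = up Y" for h X Y
  proof -
    have "low X + up X = low Y + up Y"
      using flag_param_inj[OF SL_det_nz[OF that(1)] that(2)] that(3) by (simp only:)
    then show ?thesis unfolding low_up .
  qed
  have inv1: "\<psi>' (\<psi> X) = X" if "X \<in> W" "\<psi> X \<in> W'" for X
    by (rule eqI[OF g(1)]) (simp_all add: that W W')
  have inv2: "\<psi> (\<psi>' X) = X" if "X \<in> W'" "\<psi>' X \<in> W" for X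
    by (rule eqI[OF g(2)]) (simp_all add: that W W')
  have \<psi>X0: "\<psi> X0 = X0'"
  proof (rule eqI[OF g(2)])
    show "flag_param g' (\<psi> X0) = flag_param g' X0'" using W(4)[OF W(2)] eq by simp
    show "up (\<psi> X0) = up X0'" using W(5)[OF W(2)] X0 unfolding up_eq_0_iff[symmetric] by simp
  qed
  show ?thesis
  proof
    show "biholomorphic \<psi> {X \<in> W. \<psi> X \<in> W'} {X \<in> W'. \<psi>' X \<in> W}"
    proof (rule biholomorphicI[where g = \<psi>'])
      show "open {X \<in> W. \<psi> X \<in> W'}" "open {X \<in> W'. \<psi>' X \<in> W}"
        using W W' by (auto intro!: open_Int_preimage holomorphic_map_on_continuous)
      show "holomorphic_map_on \<psi> {X \<in> W. \<psi> X \<in> W'}" "holomorphic_map_on \<psi>' {X \<in> W'. \<psi>' X \<in> W}"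
        using W(3) W'(3) by (auto intro: holomorphic_map_on_subset)
    qed (auto simp: inv1 inv2)
    show "X0 \<in> {X \<in> W. \<psi> X \<in> W'}" "\<psi> X0 = X0'" using W W' \<psi>X0 by auto
    show "flag_param g' (\<psi> X) = flag_param g X" if "X \<in> {X \<in> W. \<psi> X \<in> W'}" for X
      using that W(4) by simp
    show "\<psi> X \<in> strictly_lower \<longleftrightarrow> X \<in> strictly_lower" if "X \<in> {X \<in> W. \<psi> X \<in> W'}" for X
      using that W(5) by (simp flip: up_eq_0_iff)
  qed
qed

text \<open>The definition quantifies over all charts; by \<open>chart_transition\<close> one chart
  around each point is enough.\<close>

lemma complex_submanifoldI:
  fixes S :: "'m::enum flag set"
  assumes S: "S \<subseteq> flags"
    and local: "\<And>V. V \<in> S \<Longrightarrow> \<exists>g\<in>SL. \<exists>X\<in>strictly_lower. flag_param g X = V \<and>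
      straight_at d {X \<in> strictly_lower. flag_param g X \<in> S} X"
  shows "complex_submanifold d S"
  unfolding complex_submanifold_def submanifold_of_space_iff
proof (intro conjI S ballI)
  fix g X assume g: "g \<in> SL" and X: "X \<in> {X \<in> strictly_lower. flag_param g X \<in> S}"
  then obtain g' X' where g': "g' \<in> SL" "X' \<in> strictly_lower" "flag_param g X = flag_param g' X'"
    and st: "straight_at d {X \<in> strictly_lower. flag_param g' X \<in> S} X'"
    using local[of "flag_param g X"] by auto
  from X have XL: "X \<in> strictly_lower" by simp
  obtain W W' \<phi> where "biholomorphic \<phi> W W'" "X \<in> W" "\<phi> X = X'"
    "\<And>X. X \<in> W \<Longrightarrow> flag_param g' (\<phi> X) = flag_param g X"
    "\<And>X. X \<in> W \<Longrightarrow> \<phi> X \<in> strictly_lower \<longleftrightarrow> X \<in> strictly_lower"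
    by (rule chart_transition[OF g g'(1,3) XL g'(2)]) (rule that)
  then show "straight_at d {X \<in> strictly_lower. flag_param g X \<in> S} X"
    using st by (intro straight_at_transfer[of \<phi> W W' X d "{X \<in> strictly_lower. flag_param g' X \<in> S}"]) auto
qed

lemma flag_param_0 [simp]: "flag_param g 0 = act g std_flag"
proof -
  have "unip (0 :: 'a coords) = mat 1" by (simp add: vec_eq_iff unip_def mat_def)
  then show ?thesis by (simp add: flag_param_eq)
qed

lemma zero_strictly_lower [simp]: "0 \<in> strictly_lower"
  by (simp add: strictly_lower_iff)

text \<open>By homogeneity only the base point has to be examined: the chart centred at
  \<open>h ** g0\<close> is the translate by \<open>h\<close> of the chart at \<open>g0\<close>, and
  \<open>h\<close> preserves \<open>S\<close>.\<close>

lemma complex_submanifold_orbit: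
  assumes H: "H \<subseteq> SL" "\<And>h W. h \<in> H \<Longrightarrow> act h W \<in> S \<longleftrightarrow> W \<in> S"
    and S: "S = orbit H (act g0 std_flag)" "g0 \<in> SL"
    and st: "straight_at d {X \<in> strictly_lower. flag_param g0 X \<in> S} 0"
  shows "complex_submanifold d S"
proof (rule complex_submanifoldI)
  show "S \<subseteq> flags"
    using H(1) S by (auto simp: orbit_def intro!: act_in_flags std_flag_in_flags SL_det_nz)
  fix V assume "V \<in> S"
  then obtain h where h: "h \<in> H" "V = act h (act g0 std_flag)" using S by (auto simp: orbit_def)
  have "flag_param (h ** g0) X \<in> S \<longleftrightarrow> flag_param g0 X \<in> S" for X
    using H(2)[OF h(1)] by (simp add: flag_param_eq act_mult)
  then have "straight_at d {X \<in> strictly_lower. flag_param (h ** g0) X \<in> S} 0" using st by simp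
  moreover have "flag_param (h ** g0) 0 = V" "h ** g0 \<in> SL"
    using h H(1) S(2) by (auto simp: act_mult intro: SL_mult)
  ultimately show "\<exists>g\<in>SL. \<exists>X\<in>strictly_lower. flag_param g X = V \<and>
      straight_at d {X \<in> strictly_lower. flag_param g X \<in> S} X"
    using zero_strictly_lower by blast
qed

section \<open>Topology and dimension\<close>

lemma openin_flag_topology: "openin flag_topology U \<longleftrightarrow> U \<subseteq> flags \<and>
    openin (top_of_set SL) {g \<in> SL. act g std_flag \<in> U}"
  unfolding flag_topology_def by (simp add: topology_inverse'[OF istopology_flag_topology])

lemma SL_act_in_flags: "g \<in> SL \<Longrightarrow> act g std_flag \<in> flags"
  by (intro act_in_flags std_flag_in_flags SL_det_nz)

lemma topspace_flag_topology [simp]: "topspace flag_topology = (flags :: 'm::enum flag set)"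
proof
  show "topspace flag_topology \<subseteq> (flags :: 'm flag set)"
    by (auto simp: topspace_def openin_flag_topology)
  have "{g \<in> SL. act g std_flag \<in> (flags :: 'm flag set)} = SL" using SL_act_in_flags by auto
  then have "openin flag_topology (flags :: 'm flag set)" by (simp add: openin_flag_topology)
  then show "(flags :: 'm flag set) \<subseteq> topspace flag_topology" by (simp add: openin_subset)
qed

lemma openin_flags: "openin flag_topology flags"
  using openin_topspace[of flag_topology] by simp

lemma openin_flag_topologyE:
  assumes "openin flag_topology U"
  obtains T where "open T" "\<And>g. g \<in> SL \<Longrightarrow> act g std_flag \<in> U \<longleftrightarrow> g \<in> T"
proof -
  obtain T where "open T" "{g \<in> SL. act g std_flag \<in> U} = SL \<inter> T"
    using assms unfolding openin_flag_topology openin_open by blast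
  then show ?thesis using that by blast
qed

lemma openin_flag_topologyI:
  assumes "U \<subseteq> flags"
    and "\<And>g. g \<in> SL \<Longrightarrow> act g std_flag \<in> U \<Longrightarrow> \<exists>T. open T \<and> g \<in> T \<and> (\<forall>h\<in>SL \<inter> T. act h std_flag \<in> U)"
  shows "openin flag_topology U"
  unfolding openin_flag_topology
proof (intro conjI assms(1))
  show "openin (top_of_set SL) {g \<in> SL. act g std_flag \<in> U}"
  proof (subst openin_subopen, intro ballI)
    fix g assume "g \<in> {g \<in> SL. act g std_flag \<in> U}"
    then obtain T where "open T" "g \<in> T" "g \<in> SL" "\<forall>h\<in>SL \<inter> T. act h std_flag \<in> U" using assms(2)[of g] by auto
    then show "\<exists>T. openin (top_of_set SL) T \<and> g \<in> T \<and> T \<subseteq> {g \<in> SL. act g std_flag \<in> U}"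
      by (intro exI[of _ "SL \<inter> T"]) (auto simp: openin_open)
  qed
qed

lemma continuous_on_matrix_mult:
  fixes f g :: "'a::topological_space \<Rightarrow> complex ^ 'n::finite ^ 'n"
  assumes "continuous_on S f" "continuous_on S g"
  shows "continuous_on S (\<lambda>x. f x ** g x)"
  unfolding matrix_matrix_mult_def
  by (intro continuous_on_vec_lambda continuous_on_sum continuous_on_mult continuous_on_component assms)

lemma continuous_on_unip: "continuous_on S unip"
proof -
  have "continuous_on S (\<lambda>X. (if i = j then 1 else if idx j < idx i then X $ (i, j) else 0) :: complex)" for i j
    by (cases "i = j"; cases "idx j < idx i") (auto intro!: continuous_intros)
  then show ?thesis unfolding unip_def by (intro continuous_on_vec_lambda)
qed

lemma open_flag_param_preimage:
  assumes U: "openin flag_topology U" and g: "g \<in> SL"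
  shows "open {X. flag_param g X \<in> U}"
proof -
  obtain T where T: "open T" "\<And>g. g \<in> SL \<Longrightarrow> act g std_flag \<in> U \<longleftrightarrow> g \<in> T"
    by (rule openin_flag_topologyE[OF U]) (rule that)
  have "open {X \<in> UNIV. g ** unip X \<in> T}"
    by (intro open_Int_preimage continuous_on_matrix_mult continuous_on_unip continuous_on_const T open_UNIV)
  then show ?thesis
    unfolding flag_param_eq using T(2)[OF SL_mult[OF g unip_SL]] by simp
qed

lemma complex_submanifold_Int_open:
  assumes S: "complex_submanifold d S" and U: "openin flag_topology U"
  shows "complex_submanifold d (S \<inter> U)"
  unfolding complex_submanifold_def submanifold_of_space_iff
proof (intro conjI ballI)
  show "S \<inter> U \<subseteq> flags" using S by (auto simp: complex_submanifold_def)
  fix g X assume g: "g \<in> SL" and X: "X \<in> {X \<in> strictly_lower. flag_param g X \<in> S \<inter> U}"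
  have "straight_at d {X \<in> strictly_lower. flag_param g X \<in> S} X"
    using S g X by (auto simp: complex_submanifold_def submanifold_of_space_iff)
  then show "straight_at d {X \<in> strictly_lower. flag_param g X \<in> S \<inter> U} X"
    by (rule straight_at_local[OF _ open_flag_param_preimage[OF U g]]) (use X in auto)
qed

lemma complex_submanifold_dim_unique:
  assumes "complex_submanifold d S" "complex_submanifold d' S" "S \<noteq> {}"
  shows "d = d'"
proof -
  obtain V where V: "V \<in> S" using assms(3) by auto
  then have "V \<in> flags" using assms(1) by (auto simp: complex_submanifold_def)
  then obtain g where g: "g \<in> SL" "V = act g std_flag" by (rule flags_transitive)
  then have 0: "0 \<in> {X \<in> strictly_lower. flag_param g X \<in> S}" using V by simp
  then have "straight_at d {X \<in> strictly_lower. flag_param g X \<in> S} 0"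
    "straight_at d' {X \<in> strictly_lower. flag_param g X \<in> S} 0"
    using assms(1,2) g(1) unfolding complex_submanifold_def submanifold_of_space_iff by blast+
  then show ?thesis using straight_at_dim_unique[OF 0] by blast
qed

text \<open>The set whose maximum is taken is the singleton of \<open>d\<close>: any open piece of
  \<open>A\<close> that is a submanifold meets the dense relatively open part \<open>S\<close>,
  where the dimension is already known.\<close>

lemma complex_dim_eq:
  assumes S: "complex_submanifold d S" "S \<noteq> {}" and U0: "openin flag_topology U0" "A \<inter> U0 = S"
    and dense: "\<And>U. openin flag_topology U \<Longrightarrow> A \<inter> U \<noteq> {} \<Longrightarrow> S \<inter> U \<noteq> {}"
  shows "complex_dim A = d"
proof -
  have "{d. \<exists>U. openin flag_topology U \<and> A \<inter> U \<noteq> {} \<and> complex_submanifold d (A \<inter> U)} = {d}"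
  proof (intro equalityI subsetI)
    fix d' assume "d' \<in> {d. \<exists>U. openin flag_topology U \<and> A \<inter> U \<noteq> {} \<and> complex_submanifold d (A \<inter> U)}"
    then obtain U where U: "openin flag_topology U" "A \<inter> U \<noteq> {}" "complex_submanifold d' (A \<inter> U)" by auto
    have "A \<inter> U \<inter> U0 = S \<inter> U" using U0(2) by auto
    then have "complex_submanifold d' (S \<inter> U)" using complex_submanifold_Int_open[OF U(3) U0(1)] by simp
    then show "d' \<in> {d}"
      using complex_submanifold_dim_unique[OF complex_submanifold_Int_open[OF S(1) U(1)]] dense[OF U(1,2)] by simp
  qed (use S U0 in auto)
  then show ?thesis by (simp add: complex_dim_def)
qed

section \<open>The quaternionic structure\<close>

lemma jmap_Inl [simp]: "jmap v $ Inl a = cnj (v $ Inr a)"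
  and jmap_Inr [simp]: "jmap v $ Inr a = - cnj (v $ Inl a)"
  by (simp_all add: jmap_def)

lemma vec_sum_eq_iff: "x = y \<longleftrightarrow> (\<forall>a. x $ Inl a = y $ Inl a) \<and> (\<forall>a. x $ Inr a = y $ Inr a)"
  by (auto simp: vec_eq_iff split_sum_all)

lemma sum_UNIV_Plus: "(\<Sum>i\<in>(UNIV :: ('m::finite + 'm) set). f i) = (\<Sum>a\<in>UNIV. f (Inl a)) + (\<Sum>a\<in>UNIV. f (Inr a))"
  by (subst UNIV_Plus_UNIV[symmetric], subst sum.Plus) auto

lemma jmap_add: "jmap (x + y) = jmap x + jmap y"
  by (simp add: vec_sum_eq_iff)

lemma jmap_scale: "jmap (c *s x) = cnj c *s jmap x"
  by (simp add: vec_sum_eq_iff)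

lemma jmap_jmap [simp]: "jmap (jmap x) = - x"
  by (simp add: vec_sum_eq_iff)

lemma jmap_minus: "jmap (- x) = - jmap x"
  by (simp add: vec_sum_eq_iff)

lemma jmap_0 [simp]: "jmap 0 = 0"
  by (simp add: vec_sum_eq_iff)

lemma jmap_sum: "jmap (\<Sum>i\<in>A. f i) = (\<Sum>i\<in>A. jmap (f i))"
  by (induction A rule: infinite_finite_induct) (simp_all add: jmap_add)

lemma jmap_eq_0_iff [simp]: "jmap x = 0 \<longleftrightarrow> x = 0"
  by (metis jmap_0 jmap_jmap neg_equal_0_iff_equal)

lemma mem_jmap_image:
  assumes "vec.subspace S"
  shows "x \<in> jmap ` S \<longleftrightarrow> jmap x \<in> S"
proof
  show "x \<in> jmap ` S \<Longrightarrow> jmap x \<in> S" using assms by (auto simp: vec.subspace_neg)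
  assume "jmap x \<in> S"
  then have "- jmap x \<in> S" using assms by (simp add: vec.subspace_neg)
  moreover have "x = jmap (- jmap x)" by (simp add: jmap_minus)
  ultimately show "x \<in> jmap ` S" by blast
qed

lemma subspace_jmap_image:
  assumes "vec.subspace S"
  shows "vec.subspace (jmap ` S)"
proof (rule vec.subspaceI)
  show "0 \<in> jmap ` S" using assms by (simp add: mem_jmap_image vec.subspace_0)
  show "x + y \<in> jmap ` S" if "x \<in> jmap ` S" "y \<in> jmap ` S" for x y
    using that unfolding mem_jmap_image[OF assms] jmap_add by (rule vec.subspace_add[OF assms])
  show "c *s x \<in> jmap ` S" if "x \<in> jmap ` S" for c x
    using that unfolding mem_jmap_image[OF assms] jmap_scale by (rule vec.subspace_scale[OF assms])
qed

text \<open>The map is only conjugate-linear, so the dimension formula for linear images does not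
  apply; but it sends a spanning set to a spanning set.\<close>

lemma dim_jmap_image_le:
  fixes S :: "'m::finite cvec set"
  assumes "vec.subspace S"
  shows "vec.dim (jmap ` S) \<le> vec.dim S"
proof -
  obtain B where B: "B \<subseteq> S" "S \<subseteq> vec.span B" "card B = vec.dim S" "vec.independent B"
    by (rule vec.basis_exists[of S]) auto
  have finB: "finite B" using B(4) by (rule vec.finiteI_independent)
  have "jmap x \<in> vec.span (jmap ` B)" if "x \<in> vec.span B" for x
    using that
  proof (induction rule: vec.span_induct_alt)
    case base
    then show ?case by (simp add: vec.span_zero)
  next
    case (step c x y)
    then show ?case unfolding jmap_add jmap_scale
      by (intro vec.span_add vec.span_scale) (auto intro: vec.span_base)
  qed
  then have "vec.dim (jmap ` S) \<le> card (jmap ` B)"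
    using B(2) finB by (intro vec.dim_le_card) auto
  also have "\<dots> \<le> vec.dim S" using card_image_le[OF finB] B(3) by metis
  finally show ?thesis .
qed

lemma dim_jmap_image:
  fixes S :: "'m::finite cvec set"
  assumes "vec.subspace S"
  shows "vec.dim (jmap ` S) = vec.dim S"
proof (rule antisym[OF dim_jmap_image_le[OF assms]])
  have "S \<subseteq> jmap ` (jmap ` S)"
    using assms by (auto simp: mem_jmap_image subspace_jmap_image vec.subspace_neg)
  then have "vec.dim S \<le> vec.dim (jmap ` (jmap ` S))" by (rule vec.dim_subset)
  also have "\<dots> \<le> vec.dim (jmap ` S)" by (rule dim_jmap_image_le[OF subspace_jmap_image[OF assms]])
  finally show "vec.dim S \<le> vec.dim (jmap ` S)" .
qed

section \<open>The Hermitian inner product\<close>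

definition hprod :: "'m::finite cvec \<Rightarrow> 'm cvec \<Rightarrow> complex" where
  "hprod x y = (\<Sum>i\<in>UNIV. x $ i * cnj (y $ i))"

lemma hprod_add_left: "hprod (x + x') y = hprod x y + hprod x' y"
  by (simp add: hprod_def distrib_right sum.distrib)

lemma hprod_add_right: "hprod x (y + y') = hprod x y + hprod x y'"
  by (simp add: hprod_def distrib_left sum.distrib)

lemma hprod_scale_left: "hprod (c *s x) y = c * hprod x y"
  by (simp add: hprod_def sum_distrib_left mult.assoc)

lemma hprod_scale_right: "hprod x (c *s y) = cnj c * hprod x y"
  by (simp add: hprod_def sum_distrib_left mult_ac)

lemma hprod_zero [simp]: "hprod 0 y = 0" "hprod x 0 = 0"
  by (simp_all add: hprod_def)

lemma hprod_minus [simp]: "hprod (- x) y = - hprod x y" "hprod x (- y) = - hprod x y"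
  by (simp_all add: hprod_def sum_negf)

lemma hprod_commute: "hprod y x = cnj (hprod x y)"
  by (simp add: hprod_def cnj_sum mult.commute)

lemma hprod_self: "hprod x x = of_real (\<Sum>i\<in>UNIV. (cmod (x $ i))\<^sup>2)"
  unfolding hprod_def of_real_sum complex_norm_square ..

lemma hprod_self_eq_0_iff [simp]: "hprod x x = 0 \<longleftrightarrow> x = 0"
proof -
  have "hprod x x = 0 \<longleftrightarrow> (\<Sum>i\<in>UNIV. (cmod (x $ i))\<^sup>2) = 0"
    unfolding hprod_self by (simp only: of_real_eq_0_iff)
  also have "\<dots> \<longleftrightarrow> (\<forall>i. (cmod (x $ i))\<^sup>2 = 0)" by (subst sum_nonneg_eq_0_iff) auto
  finally show ?thesis by (simp add: vec_eq_iff)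
qed

lemma hprod_jmap_jmap: "hprod (jmap x) (jmap y) = hprod y x"
  unfolding hprod_def sum_UNIV_Plus by (simp add: mult.commute add.commute)

lemma SU_hprod:
  assumes "A \<in> SU"
  shows "hprod (A *v x) (A *v y) = hprod x y"
proof -
  have 1: "(\<Sum>i\<in>UNIV. cnj (A $ i $ k) * A $ i $ j) = (if k = j then 1 else 0)" for k j
  proof -
    have "(conj_transpose A ** A) $ k $ j = (mat 1 :: 'a cmat) $ k $ j" using assms by (simp add: SU_def)
    then show ?thesis by (simp add: matrix_matrix_mult_def conj_transpose_def mat_def)
  qed
  have "hprod (A *v x) (A *v y) = (\<Sum>i\<in>UNIV. \<Sum>j\<in>UNIV. \<Sum>k\<in>UNIV. x $ j * cnj (y $ k) * (cnj (A $ i $ k) * A $ i $ j))"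
    unfolding hprod_def matrix_vector_mult_def
    by (simp add: cnj_sum sum_product mult_ac)
  also have "\<dots> = (\<Sum>j\<in>UNIV. \<Sum>k\<in>UNIV. \<Sum>i\<in>UNIV. x $ j * cnj (y $ k) * (cnj (A $ i $ k) * A $ i $ j))"
    by (subst sum.swap, rule sum.cong[OF refl], rule sum.swap)
  also have "\<dots> = (\<Sum>j\<in>UNIV. \<Sum>k\<in>UNIV. x $ j * cnj (y $ k) * (if k = j then 1 else 0))"
    by (simp add: 1 flip: sum_distrib_left)
  also have "\<dots> = hprod x y" by (simp add: hprod_def if_distrib cong: if_cong)
  finally show ?thesis .
qed

section \<open>Quaternionic matrices and the sign of their determinants\<close>

text \<open>A matrix commuting with j is determined by its first \<open>m\<close> columns. The sign
  in the other columns comes from j(e_i) = -e_(m+i).\<close>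

definition quat_mat :: "('m::finite \<Rightarrow> 'm cvec) \<Rightarrow> 'm cmat" where
  "quat_mat f = (\<chi> i c. case c of Inl a \<Rightarrow> f a $ i | Inr a \<Rightarrow> - jmap (f a) $ i)"

lemma quat_mat_vector: "quat_mat f *v x = (\<Sum>a\<in>UNIV. x $ Inl a *s f a) - (\<Sum>a\<in>UNIV. x $ Inr a *s jmap (f a))"
  by (simp add: vec_eq_iff matrix_vector_mult_def quat_mat_def sum_UNIV_Plus sum_negf mult.commute)

lemma quat_mat_jmap: "jmap (quat_mat f *v x) = quat_mat f *v jmap x"
proof -
  have "jmap (x - y) = jmap x - jmap y" for x y :: "'a cvec" by (simp add: vec_sum_eq_iff)
  then show ?thesis
    unfolding quat_mat_vector jmap_sum jmap_scale
    by (simp add: jmap_sum jmap_scale vec_eq_iff sum_negf)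
qed

definition std_col :: "'m::finite \<Rightarrow> 'm cvec" where
  "std_col a = axis (Inl a) 1"

lemma jmap_std_col: "jmap (std_col a) = - axis (Inr a) 1"
  by (auto simp: vec_sum_eq_iff std_col_def axis_def)

lemma quat_mat_std_col: "quat_mat std_col = mat 1"
  by (auto simp: vec_eq_iff quat_mat_def mat_def std_col_def axis_def jmap_def split: sum.splits)

lemma quat_mat_axis: "quat_mat f *v std_col a = f a"
  by (simp add: quat_mat_vector std_col_def axis_def vec_eq_iff mult_delta_left)

lemma commuting_eq_quat_mat:
  assumes "\<And>v. jmap (X *v v) = X *v jmap v"
  shows "X = quat_mat (\<lambda>a. X *v std_col a)"
proof -
  have "X *v axis (Inr a) 1 = - jmap (X *v std_col a)" for a
    using assms[of "std_col a"] unfolding jmap_std_col by (simp add: vec.neg)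
  then show ?thesis
    by (auto simp: vec_eq_iff quat_mat_def std_col_def matrix_vector_mult_def axis_def if_distrib
        split: sum.splits cong: if_cong)
qed

text \<open>A permutation contributing to the Leibniz formula must fix every index other than
  \<open>p\<close> and \<open>q\<close>, so only the identity and the transposition remain.\<close>

lemma det_two_columns:
  fixes M :: "'a::comm_ring_1 ^ 'n::finite ^ 'n"
  assumes pq: "p \<noteq> q" and M: "\<And>i k. k \<noteq> p \<Longrightarrow> k \<noteq> q \<Longrightarrow> M $ i $ k = (if i = k then 1 else 0)"
  shows "det M = M $ p $ p * M $ q $ q - M $ p $ q * M $ q $ p"
proof -
  let ?t = "Transposition.transpose p q"
  have rest: "(\<Prod>i\<in>UNIV. f i) = f p * f q" if "\<And>i. i \<noteq> p \<Longrightarrow> i \<noteq> q \<Longrightarrow> f i = 1" for f :: "'n \<Rightarrow> 'a"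
  proof -
    have "(\<Prod>i\<in>UNIV. f i) = (\<Prod>i\<in>{p, q}. f i)"
      by (rule prod.mono_neutral_right) (use that in auto)
    then show ?thesis using pq by simp
  qed
  have zero: "(\<Prod>i\<in>UNIV. M $ i $ s i) = 0" if s: "s permutes UNIV" "s \<noteq> id" "s \<noteq> ?t" for s
  proof (rule ccontr)
    assume nz: "(\<Prod>i\<in>UNIV. M $ i $ s i) \<noteq> 0"
    have nzi: "M $ i $ s i \<noteq> 0" for i
      using nz by (metis UNIV_I finite prod_zero)
    have fix_k: "s k = k" if "k \<noteq> p" "k \<noteq> q" for k
    proof -
      obtain i where "s i = k" using permutes_surj[OF s(1)] by (metis surjD)
      then show ?thesis using M[OF that, of i] nzi[of i] by (auto split: if_splits)
    qed
    have inj: "s x = s y \<Longrightarrow> x = y" for x y using permutes_inj[OF s(1)] by (auto dest: injD)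
    have "s p \<in> {p, q}" "s q \<in> {p, q}" using fix_k inj by (metis insertCI)+
    then consider "s p = p" "s q = q" | "s p = q" "s q = p" using inj pq by blast
    then show False
    proof cases
      case 1
      then have "s k = id k" for k using fix_k[of k] by (cases "k = p"; cases "k = q") auto
      with s(2) show False by blast
    next
      case 2
      then have "s k = ?t k" for k using fix_k[of k] by (auto simp: Transposition.transpose_def)
      with s(3) show False by blast
    qed
  qed
  have id_t: "id \<noteq> ?t" using pq by (metis id_apply transpose_apply_first)
  have perm: "?t permutes UNIV" by (rule permutes_swap_id) auto
  have "det M = (\<Sum>s\<in>{s. s permutes UNIV}. of_int (sign s) * (\<Prod>i\<in>UNIV. M $ i $ s i))"
    by (simp add: det_def)
  also have "\<dots> = (\<Sum>s\<in>{id, ?t}. of_int (sign s) * (\<Prod>i\<in>UNIV. M $ i $ s i))"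
    by (rule sum.mono_neutral_right) (auto simp: zero permutes_id perm finite_permutations)
  also have "\<dots> = (\<Prod>i\<in>UNIV. M $ i $ i) - (\<Prod>i\<in>UNIV. M $ i $ ?t i)"
    using id_t pq by (simp add: sign_swap_id)
  also have "(\<Prod>i\<in>UNIV. M $ i $ i) = M $ p $ p * M $ q $ q" by (rule rest) (simp add: M)
  also have "(\<Prod>i\<in>UNIV. M $ i $ ?t i) = M $ p $ q * M $ q $ p"
    by (subst rest) (auto simp: M Transposition.transpose_def)
  finally show ?thesis .
qed

text \<open>The new matrix is \<open>quat_mat f ** E\<close>, where \<open>E\<close> differs from
  the identity only in the two columns belonging to \<open>a\<close>. Its 2 by 2 determinant is the
  norm of the quaternion with components \<open>c $ Inl a\<close> and
  \<open>c $ Inr a\<close>.\<close>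

lemma quat_mat_update:
  fixes f :: "'m::finite \<Rightarrow> 'm cvec"
  shows "det (quat_mat (f(a := quat_mat f *v c))) =
    of_real ((cmod (c $ Inl a))\<^sup>2 + (cmod (c $ Inr a))\<^sup>2) * det (quat_mat f)"
proof -
  define E where "E = quat_mat (std_col(a := c))"
  have "quat_mat (f(a := quat_mat f *v c)) = quat_mat f ** E"
  proof -
    define X where "X = quat_mat f ** E"
    have "jmap (X *v v) = X *v jmap v" for v
      unfolding X_def E_def by (simp add: quat_mat_jmap flip: matrix_vector_mul_assoc)
    then have "X = quat_mat (\<lambda>b. X *v std_col b)" by (rule commuting_eq_quat_mat)
    also have "(\<lambda>b. X *v std_col b) = f(a := quat_mat f *v c)"
      unfolding X_def E_def by (auto simp: fun_eq_iff quat_mat_axis simp flip: matrix_vector_mul_assoc)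
    finally show ?thesis unfolding X_def by (simp add: fun_upd_def)
  qed
  moreover have "det E = E $ Inl a $ Inl a * E $ Inr a $ Inr a - E $ Inl a $ Inr a * E $ Inr a $ Inl a"
    by (rule det_two_columns)
      (auto simp: E_def quat_mat_def std_col_def axis_def jmap_def split: sum.splits)
  moreover have "E $ Inl a $ Inl a * E $ Inr a $ Inr a - E $ Inl a $ Inr a * E $ Inr a $ Inl a =
      of_real ((cmod (c $ Inl a))\<^sup>2 + (cmod (c $ Inr a))\<^sup>2)"
    unfolding of_real_add complex_norm_square by (simp add: E_def quat_mat_def mult.commute)
  ultimately show ?thesis by (simp add: det_mul mult.commute)
qed

definition pos_real :: "complex \<Rightarrow> bool" where
  "pos_real z \<longleftrightarrow> (\<exists>r::real. 0 < r \<and> z = of_real r)"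

lemma pos_real_mult: "pos_real x \<Longrightarrow> pos_real y \<Longrightarrow> pos_real (x * y)"
  unfolding pos_real_def by (metis mult_pos_pos of_real_mult)

lemma pos_real_inverse: "pos_real x \<Longrightarrow> pos_real (1 / x)"
  unfolding pos_real_def by (metis of_real_1 of_real_divide zero_less_divide_1_iff)

lemma quat_mat_update_pos:
  fixes f :: "'m::enum \<Rightarrow> 'm cvec"
  assumes "det (quat_mat f) \<noteq> 0" "det (quat_mat (f(a := y))) \<noteq> 0"
  shows "pos_real (det (quat_mat (f(a := y))) / det (quat_mat f))"
proof -
  obtain R where "quat_mat f ** R = mat 1" using inverse_matrix[OF assms(1)] by metis
  then have y: "y = quat_mat f *v (R *v y)" by (simp add: matrix_vector_mul_assoc)
  define c where "c = R *v y"
  define s where "s = (cmod (c $ Inl a))\<^sup>2 + (cmod (c $ Inr a))\<^sup>2"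
  have eq: "det (quat_mat (f(a := y))) = of_real s * det (quat_mat f)"
    unfolding s_def c_def using quat_mat_update[of f a "R *v y"] y by simp
  then have "s \<noteq> 0" using assms(2) by auto
  then have "0 < s" using sum_power2_ge_zero[of "cmod (c $ Inl a)" "cmod (c $ Inr a)"] unfolding s_def by linarith
  then show ?thesis using eq assms(1) by (auto simp: pos_real_def)
qed

text \<open>In the basis given by \<open>f\<close>, the vectors with vanishing determinant are those
  whose two coordinates at \<open>a\<close> are zero. They form a linear subspace, and adding an
  element of it to a vector outside stays outside.\<close>

lemma quat_mat_update_sum:
  fixes f :: "'m::enum \<Rightarrow> 'm cvec"
  assumes "det (quat_mat f) \<noteq> 0" "det (quat_mat (f(a := y))) = 0" "det (quat_mat (f(a := z))) \<noteq> 0"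
  shows "det (quat_mat (f(a := y + z))) \<noteq> 0"
proof -
  obtain R where R: "quat_mat f ** R = mat 1" using inverse_matrix[OF assms(1)] by metis
  then have id: "quat_mat f *v (R *v x) = x" for x by (simp add: matrix_vector_mul_assoc)
  have iff: "det (quat_mat (f(a := x))) = 0 \<longleftrightarrow> (R *v x) $ Inl a = 0 \<and> (R *v x) $ Inr a = 0" for x
  proof -
    have "det (quat_mat (f(a := x))) = of_real ((cmod ((R *v x) $ Inl a))\<^sup>2 + (cmod ((R *v x) $ Inr a))\<^sup>2) * det (quat_mat f)"
      using quat_mat_update[of f a "R *v x"] unfolding id .
    then have "det (quat_mat (f(a := x))) = 0 \<longleftrightarrow> (cmod ((R *v x) $ Inl a))\<^sup>2 + (cmod ((R *v x) $ Inr a))\<^sup>2 = 0"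
      using assms(1) by (simp only: mult_eq_0_iff of_real_eq_0_iff simp_thms)
    then show ?thesis by (simp add: sum_power2_eq_zero_iff)
  qed
  show ?thesis using assms(2,3) unfolding iff by (auto simp: matrix_vector_right_distrib)
qed

text \<open>The sign of \<open>det [x, j x, \<dots>]\<close> does not depend on \<open>x\<close>, so two quaternionic bases can be
  exchanged into each other one pair of columns at a time; the new vector only has to avoid two
  proper subspaces.\<close>

lemma quat_mat_exchange:
  fixes f g :: "'m::enum \<Rightarrow> 'm cvec"
  assumes "finite S" "\<And>a. a \<notin> S \<Longrightarrow> f a = g a" "det (quat_mat f) \<noteq> 0" "det (quat_mat g) \<noteq> 0"
  shows "pos_real (det (quat_mat g) / det (quat_mat f))"
  using assms
proof (induction S arbitrary: f g rule: finite_induct)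
  case empty
  then have "f = g" by auto
  with empty show ?case by (auto simp: pos_real_def intro!: exI[of _ 1])
next
  case (insert a S)
  \<comment> \<open>If \<open>f a\<close> does not fit into \<open>g\<close> and \<open>g a\<close>
    does not fit into \<open>f\<close>, then their sum fits into both.\<close>
  obtain y where y: "det (quat_mat (f(a := y))) \<noteq> 0" "det (quat_mat (g(a := y))) \<noteq> 0"
  proof -
    have ff: "det (quat_mat (f(a := f a))) \<noteq> 0" "det (quat_mat (g(a := g a))) \<noteq> 0" using insert.prems by simp_all
    show ?thesis
    proof (cases "det (quat_mat (g(a := f a))) \<noteq> 0 \<or> det (quat_mat (f(a := g a))) \<noteq> 0")
      case True
      then show ?thesis using that[of "f a"] that[of "g a"] ff by blast
    next
      case False
      then have "det (quat_mat (g(a := f a + g a))) \<noteq> 0"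
        using insert.prems(3) ff(2) by (intro quat_mat_update_sum) auto
      moreover have "det (quat_mat (f(a := g a + f a))) \<noteq> 0"
        using False insert.prems(2) ff(1) by (intro quat_mat_update_sum) auto
      ultimately show ?thesis using that[of "f a + g a"] by (simp add: add.commute)
    qed
  qed
  have "pos_real (det (quat_mat (g(a := y))) / det (quat_mat (f(a := y))))"
  proof (rule insert.IH)
    show "(f(a := y)) b = (g(a := y)) b" if "b \<notin> S" for b using insert.prems(1)[of b] that by simp
  qed (fact y)+
  moreover have "pos_real (det (quat_mat (f(a := y))) / det (quat_mat f))"
    by (rule quat_mat_update_pos) (use y insert.prems in auto)
  moreover have "pos_real (1 / (det (quat_mat (g(a := y))) / det (quat_mat g)))"
    by (rule pos_real_inverse[OF quat_mat_update_pos]) (use y insert.prems in auto)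
  ultimately have "pos_real (det (quat_mat (g(a := y))) / det (quat_mat (f(a := y))) *
      (det (quat_mat (f(a := y))) / det (quat_mat f)) * (1 / (det (quat_mat (g(a := y))) / det (quat_mat g))))"
    by (intro pos_real_mult)
  then show ?case using y insert.prems by simp
qed

lemma det_quat_mat_pos:
  fixes f :: "'m::enum \<Rightarrow> 'm cvec"
  assumes "det (quat_mat f) \<noteq> 0"
  shows "pos_real (det (quat_mat f))"
  using quat_mat_exchange[of UNIV std_col f] assms by (simp add: quat_mat_std_col)

section \<open>The open orbit\<close>

lemma SLH_mult: "A \<in> SLH \<Longrightarrow> B \<in> SLH \<Longrightarrow> A ** B \<in> SLH"
  unfolding SLH_def by (auto simp: SL_mult simp flip: matrix_vector_mul_assoc)

lemma SLH_inverse: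
  assumes "A \<in> SLH"
  obtains B where "B \<in> SLH" "A ** B = mat 1" "B ** A = mat 1"
proof -
  have A: "A \<in> SL" "jmap (A *v v) = A *v jmap v" for v using assms by (auto simp: SLH_def)
  obtain B where B: "B \<in> SL" "A ** B = mat 1" "B ** A = mat 1" by (rule SL_inverse[OF A(1)])
  have AB: "A *v (B *v v) = v" "B *v (A *v v) = v" for v
    using B by (simp_all add: matrix_vector_mul_assoc)
  have "jmap (B *v v) = B *v jmap v" for v
    using A(2)[of "B *v v"] AB by metis
  then show ?thesis using that B by (auto simp: SLH_def)
qed

lemma SLH_subset_SL: "SLH \<subseteq> SL" by (auto simp: SLH_def)

lemma K0_hprod: "A \<in> K0 \<Longrightarrow> hprod (A *v x) (A *v y) = hprod x y"
  by (simp add: K0_def SU_hprod)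

lemma conj_transpose_mult: "conj_transpose (A ** B) = conj_transpose B ** conj_transpose A"
  by (simp add: vec_eq_iff conj_transpose_def matrix_matrix_mult_def cnj_sum mult.commute)

lemma K0_mult: "A \<in> K0 \<Longrightarrow> B \<in> K0 \<Longrightarrow> A ** B \<in> K0"
proof -
  assume AB: "A \<in> K0" "B \<in> K0"
  have "conj_transpose (A ** B) ** (A ** B) = conj_transpose B ** (conj_transpose A ** A) ** B"
    by (simp add: conj_transpose_mult matrix_mul_assoc)
  also have "\<dots> = mat 1" using AB by (simp add: K0_def SU_def)
  finally show "A ** B \<in> K0" using AB SLH_mult SL_mult by (auto simp: K0_def SU_def)
qed

lemma K0_inverse:
  assumes "A \<in> K0"
  obtains B where "B \<in> K0" "A ** B = mat 1" "B ** A = mat 1"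
proof -
  obtain B where B: "B \<in> SLH" "A ** B = mat 1" "B ** A = mat 1"
    using assms SLH_inverse by (auto simp: K0_def)
  have "conj_transpose A = B"
  proof -
    have "conj_transpose A ** (A ** B) = B" using assms by (simp add: matrix_mul_assoc K0_def SU_def)
    then show ?thesis by (simp add: B)
  qed
  moreover have "conj_transpose (conj_transpose A) = A" by (simp add: vec_eq_iff conj_transpose_def)
  ultimately have "conj_transpose B ** B = mat 1" using B by simp
  then have "B \<in> K0" using B SLH_subset_SL by (auto simp: K0_def SU_def)
  then show ?thesis using that B by blast
qed

definition opposite_flags :: "'m::enum flag set" where
  "opposite_flags = {V \<in> flags. \<forall>k \<le> 2 * CARD('m). V k \<inter> jmap ` V (2 * CARD('m) - k) = {0}}"

definition isotropic_flags :: "'m::enum flag set" where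
  "isotropic_flags = {V \<in> flags. \<forall>k \<le> 2 * CARD('m). \<forall>x \<in> V k. \<forall>y \<in> V (2 * CARD('m) - k). hprod x (jmap y) = 0}"

lemma flags_subspace: "V \<in> flags \<Longrightarrow> vec.subspace (V k)"
  by (simp add: flags_def)

lemma flags_mono: "V \<in> flags \<Longrightarrow> k \<le> l \<Longrightarrow> V k \<subseteq> V l"
  by (simp add: flags_def mono_def)

lemma flags_dim: "V \<in> flags \<Longrightarrow> vec.dim ((V :: 'm::finite flag) k) = min k (2 * CARD('m))"
  by (simp add: flags_def)

lemma isotropic_subset_opposite: "(isotropic_flags :: 'm::enum flag set) \<subseteq> opposite_flags"
proof
  fix V :: "'m flag" assume V: "V \<in> isotropic_flags"
  then have VF: "V \<in> flags" by (simp add: isotropic_flags_def)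
  have "V k \<inter> jmap ` V (2 * CARD('m) - k) = {0}" if "k \<le> 2 * CARD('m)" for k
  proof
    show "V k \<inter> jmap ` V (2 * CARD('m) - k) \<subseteq> {0}"
    proof
      fix x assume "x \<in> V k \<inter> jmap ` V (2 * CARD('m) - k)"
      then obtain y where "x \<in> V k" "x = jmap y" "y \<in> V (2 * CARD('m) - k)" by auto
      then have "hprod x x = 0" using V that unfolding isotropic_flags_def by blast
      then show "x \<in> {0}" by simp
    qed
    show "{0} \<subseteq> V k \<inter> jmap ` V (2 * CARD('m) - k)"
      using VF by (auto simp: flags_subspace mem_jmap_image vec.subspace_0)
  qed
  then show "V \<in> opposite_flags" using VF by (simp add: opposite_flags_def)
qed

lemma SLH_act_opposite:
  assumes "A \<in> SLH" "V \<in> opposite_flags"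
  shows "act A V \<in> opposite_flags"
proof -
  have A: "A \<in> SL" "\<And>v. jmap (A *v v) = A *v jmap v" using assms(1) by (auto simp: SLH_def)
  have "jmap ` (*v) A ` S = (*v) A ` jmap ` S" for S
    by (simp add: image_image A)
  then have "act A V k \<inter> jmap ` act A V l = (*v) A ` (V k \<inter> jmap ` V l)" for k l
    unfolding act_def by (simp add: image_Int[OF inj_matrix[OF SL_det_nz[OF A(1)]]])
  then show ?thesis
    using assms(2) act_in_flags[OF SL_det_nz[OF A(1)]] by (auto simp: opposite_flags_def)
qed

lemma K0_act_isotropic:
  assumes "A \<in> K0" "V \<in> isotropic_flags"
  shows "act A V \<in> isotropic_flags"
proof -
  have A: "A \<in> SL" "\<And>v. jmap (A *v v) = A *v jmap v" using assms(1) by (auto simp: SLH_def K0_def)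
  then show ?thesis
    using assms act_in_flags[OF SL_det_nz[OF A(1)]]
    by (auto simp: isotropic_flags_def act_def K0_hprod)
qed

text \<open>\<open>V k\<close> and the j-image of \<open>V (n + 1 - k)\<close> have dimensions
  adding up to \<open>n + 1\<close>, so they share a nonzero vector. Applying j exchanges the
  conditions for \<open>k\<close> and for \<open>n + 1 - k\<close>.\<close>

lemma opposite_adapted_basis:
  assumes V: "V \<in> (opposite_flags :: 'm::enum flag set)"
  obtains f where "V = flag_of f"
    "\<And>k. k \<in> {1..2 * CARD('m)} \<Longrightarrow> f k \<noteq> 0 \<and> f k \<in> V k \<and> f k \<in> jmap ` V (2 * CARD('m) + 1 - k)"
    "\<And>k. k \<in> {1..CARD('m)} \<Longrightarrow> f (2 * CARD('m) + 1 - k) = jmap (f k)"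
proof -
  define n where "n = 2 * CARD('m)"
  have opp: "V k \<inter> jmap ` V (n - k) = {0}" if "k \<le> n" for k
    using V that by (auto simp: opposite_flags_def n_def)
  have VF: "V \<in> flags" using V by (simp add: opposite_flags_def)
  have sub: "vec.subspace (V k)" and dim: "vec.dim (V k) = min k n" for k
    using VF by (auto simp: flags_subspace flags_dim n_def)
  have "\<exists>x. x \<noteq> 0 \<and> x \<in> V k \<and> x \<in> jmap ` V (n + 1 - k)" if k: "k \<in> {1..n}" for k
  proof (rule ccontr)
    assume "\<not> ?thesis"
    then have "V k \<inter> jmap ` V (n + 1 - k) \<subseteq> {0}" by auto
    then have int: "vec.dim (V k \<inter> jmap ` V (n + 1 - k)) = 0" by (simp only: vec.dim_eq_0)
    have "vec.dim {x + y |x y. x \<in> V k \<and> y \<in> jmap ` V (n + 1 - k)} + vec.dim (V k \<inter> jmap ` V (n + 1 - k)) =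
        vec.dim (V k) + vec.dim (jmap ` V (n + 1 - k))"
      by (rule vec.dim_sums_Int) (auto intro: sub subspace_jmap_image)
    also have "\<dots> = n + 1" using k by (auto simp: dim dim_jmap_image sub min_def)
    finally have "vec.dim {x + y |x y. x \<in> V k \<and> y \<in> jmap ` V (n + 1 - k)} = n + 1"
      unfolding int by simp
    moreover have "vec.dim {x + y |x y. x \<in> V k \<and> y \<in> jmap ` V (n + 1 - k)} \<le> n"
      using dim_subset_UNIV_cart_gen[of "{x + y |x y. x \<in> V k \<and> y \<in> jmap ` V (n + 1 - k)}"] by (simp add: n_def)
    ultimately show False by simp
  qed
  then obtain f0 where f0: "\<And>k. k \<in> {1..n} \<Longrightarrow> f0 k \<noteq> 0 \<and> f0 k \<in> V k \<and> f0 k \<in> jmap ` V (n + 1 - k)"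
    by metis
  \<comment> \<open>Only the first half is chosen; the second half is its j-image in reverse order,
    which makes the basis quaternionic.\<close>
  define f where "f = (\<lambda>k. if k \<le> CARD('m) then f0 k else jmap (f0 (n + 1 - k)))"
  have f: "f k \<noteq> 0 \<and> f k \<in> V k \<and> f k \<in> jmap ` V (n + 1 - k)" if k: "k \<in> {1..n}" for k
  proof (cases "k \<le> CARD('m)")
    case True
    then show ?thesis using f0[OF k] by (simp add: f_def)
  next
    case False
    have "n + 1 - k \<in> {1..n}" "n + 1 - (n + 1 - k) = k" using k by auto
    then show ?thesis using f0[of "n + 1 - k"] False sub by (simp add: f_def mem_jmap_image vec.subspace_neg)
  qed
  \<comment> \<open>Opposition at \<open>k - 1\<close> pairs \<open>V (k - 1)\<close> with the
    j-image of \<open>V (n + 1 - k)\<close>, and \<open>f k\<close> lies in the latter.\<close>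
  have "f k \<notin> V (k - 1)" if k: "k \<in> {1..n}" for k
  proof
    assume "f k \<in> V (k - 1)"
    moreover have "n - (k - 1) = n + 1 - k" "k - 1 \<le> n" using k by auto
    ultimately show False using f[OF k] opp[of "k - 1"] by auto
  qed
  then have "V = flag_of f" using f VF by (intro flag_of_adapted) (auto simp: n_def)
  moreover have "f (n + 1 - k) = jmap (f k)" if "k \<in> {1..CARD('m)}" for k
    using that by (auto simp: f_def n_def)
  ultimately show ?thesis using that f unfolding n_def by blast
qed

text \<open>The sequence e_1, ..., e_m, j e_m, ..., j e_1, the model of the adapted bases of
  opposite flags.\<close>

definition base_basis :: "nat \<Rightarrow> 'm::enum cvec" where
  "base_basis k = (if k \<le> CARD('m) then e k else jmap (e (2 * CARD('m) + 1 - k)))"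

definition base_flag :: "'m::enum flag" where
  "base_flag = flag_of base_basis"

lemma coord_Inl:
  assumes "k \<in> {1..CARD('m)}"
  obtains a where "coord k = (Inl a :: 'm::enum + 'm)" "coord (CARD('m) + k) = (Inr a :: 'm::enum + 'm)"
proof
  have l: "length (enum_class.enum :: 'm list) = CARD('m)"
    by (simp add: card_UNIV_length_enum)
  show "coord k = (Inl (enum_class.enum ! (k - 1)) :: 'm + 'm)"
    using assms l by (auto simp: coord_def enum_sum_def nth_append)
  show "coord (CARD('m) + k) = (Inr (enum_class.enum ! (k - 1)) :: 'm + 'm)"
    using assms l by (auto simp: coord_def enum_sum_def nth_append)
qed

lemma e_Inl: "e (idx (Inl a)) = std_col a"
  by (simp add: e_def std_col_def)

lemma quat_mat_e:
  assumes "k \<in> {1..CARD('m)}"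
  shows "quat_mat (\<lambda>a. f (idx (Inl a))) *v (e k :: 'm::enum cvec) = f k"
proof -
  obtain a where a: "coord k = (Inl a :: 'm + 'm)" using coord_Inl[OF assms] by metis
  then have "idx (Inl a :: 'm + 'm) = k" using idx_coord[where ?'m = 'm, of k] assms by simp
  then show ?thesis using quat_mat_axis[of "\<lambda>a. f (idx (Inl a))" a] by (simp flip: e_Inl)
qed

lemma quat_mat_base_basis:
  assumes "k \<in> {1..2 * CARD('m)}" and f: "\<And>k. k \<in> {1..CARD('m)} \<Longrightarrow> f (2 * CARD('m) + 1 - k) = jmap (f k)"
  shows "quat_mat (\<lambda>a. f (idx (Inl a))) *v (base_basis k :: 'm::enum cvec) = f k"
proof (cases "k \<le> CARD('m)")
  case True
  then show ?thesis using assms(1) by (simp add: base_basis_def quat_mat_e)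
next
  case False
  then have k: "2 * CARD('m) + 1 - k \<in> {1..CARD('m)}" "2 * CARD('m) + 1 - (2 * CARD('m) + 1 - k) = k"
    using assms(1) by auto
  then show ?thesis
    using False f[OF k(1)] by (simp add: base_basis_def quat_mat_e flip: quat_mat_jmap)
qed

lemma flag_of_det:
  assumes "flag_of f \<in> (flags :: 'm::enum flag set)"
  shows "det (frame f) \<noteq> 0"
proof -
  have "flag_of f (2 * CARD('m)) = UNIV"
  proof (rule vec.subspace_dim_equal)
    show "vec.dim (UNIV :: 'm cvec set) \<le> vec.dim (flag_of f (2 * CARD('m)))"
      using flags_dim[OF assms, of "2 * CARD('m)"] by (simp add: card_cart_basis)
  qed (auto simp: subspace_flag_of)
  then have "surj ((*v) (frame f))" unfolding flag_of_frame[of f] act_def by auto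
  then show ?thesis
    by (metis invertible_det_nz invertible_right_inverse matrix_right_invertible_surjective)
qed

lemma opposite_quat_mat:
  fixes f :: "nat \<Rightarrow> 'm::enum cvec"
  assumes V: "flag_of f \<in> flags" and f: "\<And>k. k \<in> {1..CARD('m)} \<Longrightarrow> f (2 * CARD('m) + 1 - k) = jmap (f k)"
  shows "flag_of f = act (quat_mat (\<lambda>a. f (idx (Inl a)))) base_flag" "pos_real (det (quat_mat (\<lambda>a. f (idx (Inl a)))))"
proof -
  let ?X = "quat_mat (\<lambda>a. f (idx (Inl a)))"
  show eq: "flag_of f = act ?X base_flag"
    unfolding base_flag_def act_flag_of by (rule flag_of_cong, rule quat_mat_base_basis[symmetric], assumption, erule f)
  have "frame f = ?X ** frame base_basis"
  proof -
    have "frame f *v e k = ?X ** frame base_basis *v e k" if k: "k \<in> {1..2 * CARD('m)}" for k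
      unfolding matrix_vector_mul_assoc[symmetric] frame_e[OF k] by (rule quat_mat_base_basis[OF k, symmetric]) (rule f)
    then have "frame f $ i $ j = (?X ** frame base_basis) $ i $ j" for i j
      using idx_range[of j] by (metis coord_idx matrix_vector_e)
    then show ?thesis by (simp add: vec_eq_iff)
  qed
  then have "det ?X \<noteq> 0" using flag_of_det[OF V] by (auto simp: det_mul)
  then show "pos_real (det ?X)" by (rule det_quat_mat_pos)
qed

text \<open>The quaternionic matrix of an adapted basis must be normalised to determinant 1. A real
  scalar commutes with j, and a positive determinant permits a real root.\<close>

lemma opposite_flags_in_orbit:
  assumes V: "V \<in> (opposite_flags :: 'm::enum flag set)"
  shows "V \<in> orbit SLH base_flag"
proof -
  have VF: "V \<in> flags" using V by (simp add: opposite_flags_def)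
  obtain f where f: "V = flag_of f" "\<And>k. k \<in> {1..CARD('m)} \<Longrightarrow> f (2 * CARD('m) + 1 - k) = jmap (f k)"
    using opposite_adapted_basis[OF V] by metis
  define X where "X = quat_mat (\<lambda>a. f (idx (Inl a)))"
  have X: "V = act X base_flag" "pos_real (det X)"
    unfolding X_def f(1) using opposite_quat_mat[of f] f VF by auto
  obtain r where r: "0 < r" "det X = of_real r" using X(2) by (auto simp: pos_real_def)
  define c where "c = root (2 * CARD('m)) (1 / r)"
  have c: "0 < c" "c ^ (2 * CARD('m)) = 1 / r" using r(1) by (simp_all add: c_def)
  have "det (smat (of_real c) X) = of_real (c ^ (2 * CARD('m)) * r)"
    unfolding det_smat r(2) by simp
  also have "\<dots> = 1" unfolding c(2) using r(1) by simp
  finally have "smat (of_real c) X \<in> SL" by (simp add: SL_def)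
  moreover have "jmap (smat (of_real c) X *v v) = smat (of_real c) X *v jmap v" for v
    by (simp add: smat_vector jmap_scale X_def quat_mat_jmap)
  ultimately have "smat (of_real c) X \<in> SLH" by (simp add: SLH_def)
  moreover have "act (smat (of_real c) X) base_flag = V"
    unfolding X(1) using c(1) by (intro act_smat) (auto simp: base_flag_def subspace_flag_of)
  ultimately show ?thesis by (auto simp: orbit_def)
qed

lemma orthonormal_in_SU_form:
  assumes "\<And>i j. hprod (A *v axis j 1) (A *v axis i 1) = (if i = j then 1 else 0)"
  shows "conj_transpose A ** A = mat 1"
proof -
  have "(conj_transpose A ** A) $ i $ j = hprod (A *v axis j 1) (A *v axis i 1)" for i j
    by (simp add: hprod_def conj_transpose_def matrix_matrix_mult_def matrix_vector_mult_def axis_def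
        if_distrib mult.commute cong: if_cong)
  then show ?thesis by (simp add: vec_eq_iff assms mat_def)
qed

lemma hprod_e:
  assumes "k \<in> {1..2 * CARD('m)}" "l \<in> {1..2 * CARD('m)}"
  shows "hprod (e k) (e l :: 'm::enum cvec) = (if k = l then 1 else 0)"
proof -
  have "coord k = (coord l :: 'm + 'm) \<longleftrightarrow> k = l" using assms by (metis idx_coord)
  then show ?thesis by (simp add: hprod_def e_def axis_def mult_delta_left)
qed

text \<open>For \<open>k < l\<close> the vector \<open>f0 l\<close> is the j-image of an element of
  \<open>V (n - k)\<close>, so isotropy says precisely that \<open>f0 k\<close> and
  \<open>f0 l\<close> are orthogonal. Normalising respects the pairing by j, because j preserves
  lengths.\<close>

lemma isotropic_in_orbit:
  assumes V: "V \<in> (isotropic_flags :: 'm::enum flag set)"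
  shows "V \<in> orbit K0 base_flag"
proof -
  define n where "n = 2 * CARD('m)"
  have VO: "V \<in> opposite_flags" using V isotropic_subset_opposite by blast
  have VF: "V \<in> flags" using V by (simp add: isotropic_flags_def)
  obtain f0 where f0: "V = flag_of f0"
    "\<And>k. k \<in> {1..n} \<Longrightarrow> f0 k \<noteq> 0 \<and> f0 k \<in> V k \<and> f0 k \<in> jmap ` V (n + 1 - k)"
    "\<And>k. k \<in> {1..CARD('m)} \<Longrightarrow> f0 (n + 1 - k) = jmap (f0 k)"
    by (rule opposite_adapted_basis[OF VO, folded n_def]) (rule that)
  define r where "r = (\<lambda>k. sqrt (\<Sum>i\<in>UNIV. (cmod (f0 k $ i))\<^sup>2))"
  have r_sq: "hprod (f0 k) (f0 k) = of_real ((r k)\<^sup>2)" for k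
    unfolding hprod_self r_def by (simp add: sum_nonneg)
  have r_pos: "0 < r k" if "k \<in> {1..n}" for k
  proof -
    have "r k \<noteq> 0" using f0(2)[OF that] r_sq[of k] by auto
    moreover have "0 \<le> r k" unfolding r_def by (simp add: sum_nonneg)
    ultimately show ?thesis by simp
  qed
  have r_refl: "r (n + 1 - k) = r k" if k: "k \<in> {1..CARD('m)}" for k
  proof -
    have "complex_of_real ((r (n + 1 - k))\<^sup>2) = of_real ((r k)\<^sup>2)"
      unfolding r_sq[symmetric] f0(3)[OF k] hprod_jmap_jmap ..
    then have "(r (n + 1 - k))\<^sup>2 = (r k)\<^sup>2" by (simp only: of_real_eq_iff)
    moreover have "0 < r k" "0 < r (n + 1 - k)" using k by (auto intro!: r_pos simp: n_def)
    ultimately show ?thesis by (simp add: power2_eq_iff_nonneg)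
  qed
  define f where "f = (\<lambda>k. of_real (1 / r k) *s f0 k)"
  have f_refl: "f (n + 1 - k) = jmap (f k)" if "k \<in> {1..CARD('m)}" for k
    using r_refl[OF that] f0(3)[OF that] by (simp add: f_def jmap_scale)
  have V_eq: "V = flag_of f"
  proof -
    have "f0 k \<notin> V (k - 1)" if k: "k \<in> {1..n}" for k
    proof
      assume "f0 k \<in> V (k - 1)"
      moreover have "n - (k - 1) = n + 1 - k" "k - 1 \<le> n" using k by auto
      moreover have "V (k - 1) \<inter> jmap ` V (n - (k - 1)) = {0}"
        using VO \<open>k - 1 \<le> n\<close> unfolding opposite_flags_def n_def by blast
      ultimately show False using f0(2)[OF k] by auto
    qed
    moreover have "f k \<in> S \<longleftrightarrow> f0 k \<in> S" if k: "k \<in> {1..n}" and S: "vec.subspace S" for k S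
    proof -
      have "f0 k = of_real (r k) *s f k" using r_pos[OF k] by (simp add: f_def vector_smult_assoc)
      then show ?thesis using S vec.subspace_scale unfolding f_def by metis
    qed
    ultimately show ?thesis
      using f0(2) VF by (intro flag_of_adapted) (auto simp: flags_subspace n_def)
  qed
  have orth0: "hprod (f0 k) (f0 l) = 0" if k: "k \<in> {1..n}" and l: "l \<in> {1..n}" and kl: "k < l" for k l
  proof -
    obtain y where y: "f0 l = jmap y" "y \<in> V (n + 1 - l)" using f0(2)[OF l] by auto
    have "n + 1 - l \<le> n - k" using kl l by auto
    then have "y \<in> V (n - k)" using y(2) flags_mono[OF VF] by blast
    then show ?thesis using V f0(2)[OF k] k unfolding y(1) isotropic_flags_def n_def by auto
  qed
  have orth: "hprod (f k) (f l) = (if k = l then 1 else 0)" if k: "k \<in> {1..n}" and l: "l \<in> {1..n}" for k l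
  proof (cases "k = l")
    case True
    have "hprod (f k) (f k) = of_real ((1 / r k)\<^sup>2 * (r k)\<^sup>2)"
      unfolding f_def hprod_scale_left hprod_scale_right r_sq by (simp add: power2_eq_square)
    also have "\<dots> = 1" using r_pos[OF k] by (simp add: power_divide)
    finally show ?thesis using True by simp
  next
    case False
    then have "hprod (f0 k) (f0 l) = 0"
      using orth0[OF k l] orth0[OF l k] hprod_commute[of "f0 k" "f0 l"] by (cases "k < l") auto
    then show ?thesis using False by (simp add: f_def hprod_scale_left hprod_scale_right)
  qed
  define X where "X = quat_mat (\<lambda>a. f (idx (Inl a)))"
  have X: "V = act X base_flag" "pos_real (det X)"
    unfolding X_def V_eq using opposite_quat_mat[of f] f_refl VF V_eq by (auto simp: n_def)
  have "conj_transpose X ** X = mat 1"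
  proof (rule orthonormal_in_SU_form)
    have X_e: "X *v axis i 1 = (if idx i \<le> CARD('m) then f (idx i) else - f (n + 1 - (idx i - CARD('m))))" for i
    proof (cases "idx i \<le> CARD('m)")
      case True
      then show ?thesis using quat_mat_e[of "idx i" f] by (simp add: X_def e_def)
    next
      case False
      define k where "k = idx i - CARD('m)"
      have k: "k \<in> {1..CARD('m)}" "CARD('m) + k = idx i" 
        using False idx_bounds[of i] unfolding k_def atLeastAtMost_iff by linarith+
      have "axis i 1 = - jmap (e k)" using jmap_e[OF k(1)] k(2) by (simp add: e_def)
      then have "X *v axis i 1 = - jmap (X *v e k)" by (simp add: X_def quat_mat_jmap vec.neg)
      also have "\<dots> = - f (n + 1 - k)" using quat_mat_e[OF k(1), of f] f_refl[OF k(1)] by (simp add: X_def)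
      finally show ?thesis using False by (simp add: k_def)
    qed
    fix i j :: "'m + 'm"
    \<comment> \<open>The place in the adapted basis that corresponds to column \<open>i\<close>:
      columns beyond \<open>m\<close> hold the negatives of the second half in reverse
      order.\<close>
    define a where "a = (\<lambda>i :: 'm + 'm. if idx i \<le> CARD('m) then idx i else n + 1 - (idx i - CARD('m)))"
    have a_range: "(if x \<le> CARD('m) then x else n + 1 - (x - CARD('m))) \<in> {1..n}" if "x \<in> {1..n}" for x
      using that by (auto simp: n_def)
    have a_eq: "(if x \<le> CARD('m) then x else n + 1 - (x - CARD('m))) =
        (if y \<le> CARD('m) then y else n + 1 - (y - CARD('m))) \<longleftrightarrow> x = y"
      if "x \<in> {1..n}" "y \<in> {1..n}" for x y
      using that by (auto simp: n_def)
    have a: "a i \<in> {1..n}" for i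
      unfolding a_def using a_range idx_range[of i] unfolding n_def by blast
    have a_inj: "a i = a j \<longleftrightarrow> i = j" "a i = a j \<Longrightarrow> idx i \<le> CARD('m) \<longleftrightarrow> idx j \<le> CARD('m)" for i j
    proof -
      show "a i = a j \<longleftrightarrow> i = j"
        unfolding a_def idx_eq_iff[of i j, symmetric]
        by (rule a_eq) (use idx_range[of i] idx_range[of j] in \<open>auto simp: n_def\<close>)
      then show "a i = a j \<Longrightarrow> idx i \<le> CARD('m) \<longleftrightarrow> idx j \<le> CARD('m)" by simp
    qed
    have "X *v axis i 1 = (if idx i \<le> CARD('m) then 1 else -1) *s f (a i)" for i
      unfolding X_e a_def by (simp add: vec_eq_iff)
    then have "hprod (X *v axis j 1) (X *v axis i 1) =
        (if idx j \<le> CARD('m) then 1 else -1) * ((if idx i \<le> CARD('m) then 1 else -1) * hprod (f (a j)) (f (a i)))"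
      by (simp add: hprod_scale_left hprod_scale_right)
    also have "\<dots> = (if i = j then 1 else 0)"
      unfolding orth[OF a a] a_inj by auto
    finally show "hprod (X *v axis j 1) (X *v axis i 1) = (if i = j then 1 else 0)" .
  qed
  \<comment> \<open>Unitarity gives modulus one, and a quaternionic determinant is a positive
    real.\<close>
  moreover have "det X = 1"
  proof -
    have "det (conj_transpose X) = cnj (det X)"
    proof -
      have "conj_transpose X = transpose (\<chi> i j. cnj (X $ i $ j))"
        by (simp add: vec_eq_iff conj_transpose_def Finite_Cartesian_Product.transpose_def)
      then have "det (conj_transpose X) = det (\<chi> i j. cnj (X $ i $ j))" by (simp add: det_transpose)
      also have "\<dots> = cnj (det X)" unfolding det_def by (simp add: cnj_sum cnj_prod)
      finally show ?thesis .
    qed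
    then have "cnj (det X) * det X = 1" using \<open>conj_transpose X ** X = mat 1\<close> by (metis det_I det_mul)
    moreover obtain s where "0 < s" "det X = of_real s" using X(2) by (auto simp: pos_real_def)
    ultimately have "s * s = 1" "0 < s" by (auto simp flip: of_real_mult)
    then have "s = 1" by (simp add: square_eq_1_iff)
    then show ?thesis using \<open>det X = of_real s\<close> by simp
  qed
  ultimately have "X \<in> K0" by (simp add: K0_def SU_def SLH_def SL_def X_def quat_mat_jmap)
  then show ?thesis using X(1) by (auto simp: orbit_def)
qed

lemma det_frame_orthonormal:
  fixes b :: "nat \<Rightarrow> 'm::enum cvec"
  assumes "\<And>k l. k \<in> {1..2 * CARD('m)} \<Longrightarrow> l \<in> {1..2 * CARD('m)} \<Longrightarrow> hprod (b k) (b l) = (if k = l then 1 else 0)"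
  shows "det (frame b) \<noteq> 0"
proof -
  have "conj_transpose (frame b) ** frame b = mat 1"
  proof (rule orthonormal_in_SU_form)
    fix i j :: "'m + 'm"
    have "axis i 1 = e (idx i)" "axis j 1 = e (idx j)" by (simp_all add: e_def)
    then show "hprod (frame b *v axis j 1) (frame b *v axis i 1) = (if i = j then 1 else 0)"
      using assms[OF idx_range[of j] idx_range[of i]] by (auto simp: frame_e)
  qed
  then show ?thesis by (metis det_I det_mul mult_zero_right zero_neq_one)
qed

lemma flag_of_in_flags:
  assumes "det (frame b) \<noteq> 0"
  shows "flag_of b \<in> flags"
  unfolding flag_of_frame[of b] by (rule act_in_flags[OF assms std_flag_in_flags])

section \<open>The complex symplectic form\<close>

text \<open>Complex bilinear, since the conjugation in \<open>hprod\<close> cancels the one in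
  \<open>jmap\<close>. Therefore the isotropy conditions are holomorphic, whereas opposition is
  not.\<close>

definition omega :: "'m::finite cvec \<Rightarrow> 'm cvec \<Rightarrow> complex" where
  "omega x y = hprod x (jmap y)"

lemma omega_add_left: "omega (x + x') y = omega x y + omega x' y"
  by (simp add: omega_def hprod_add_left)

lemma omega_add_right: "omega x (y + y') = omega x y + omega x y'"
  by (simp add: omega_def jmap_add hprod_add_right)

lemma omega_scale_left: "omega (c *s x) y = c * omega x y"
  by (simp add: omega_def hprod_scale_left)

lemma omega_scale_right: "omega x (c *s y) = c * omega x y"
  by (simp add: omega_def jmap_scale hprod_scale_right)

lemma omega_zero [simp]: "omega 0 y = 0" "omega x 0 = 0"
  by (simp_all add: omega_def)

lemma omega_minus [simp]: "omega (- x) y = - omega x y" "omega x (- y) = - omega x y"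
  by (simp_all add: omega_def jmap_minus)

lemma omega_commute: "omega y x = - omega x y"
  using hprod_jmap_jmap[of "jmap x" y] by (simp add: omega_def)

lemma omega_sum_right: "omega x (\<Sum>i\<in>A. f i) = (\<Sum>i\<in>A. omega x (f i))"
  by (induction A rule: infinite_finite_induct) (simp_all add: omega_add_right)

lemma isotropic_flag_of_iff:
  fixes b :: "nat \<Rightarrow> 'm::enum cvec"
  assumes "flag_of b \<in> flags"
  shows "flag_of b \<in> isotropic_flags \<longleftrightarrow>
    (\<forall>k l. 1 \<le> k \<longrightarrow> 1 \<le> l \<longrightarrow> k + l \<le> 2 * CARD('m) \<longrightarrow> omega (b k) (b l) = 0)"
proof
  define n where "n = 2 * CARD('m)"
  assume iso: "flag_of b \<in> isotropic_flags"
  have "omega (b k) (b l) = 0" if kl: "1 \<le> k" "1 \<le> l" "k + l \<le> n" for k l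
  proof -
    have "b k \<in> flag_of b k" "b l \<in> flag_of b (n - k)"
      using kl by (auto simp: flag_of_def n_def intro!: vec.span_base)
    moreover have "k \<le> n" using kl by simp
    ultimately show ?thesis using iso unfolding isotropic_flags_def omega_def n_def by blast
  qed
  then show "\<forall>k l. 1 \<le> k \<longrightarrow> 1 \<le> l \<longrightarrow> k + l \<le> 2 * CARD('m) \<longrightarrow> omega (b k) (b l) = 0"
    by (simp add: n_def)
next
  define n where "n = 2 * CARD('m)"
  assume R: "\<forall>k l. 1 \<le> k \<longrightarrow> 1 \<le> l \<longrightarrow> k + l \<le> 2 * CARD('m) \<longrightarrow> omega (b k) (b l) = 0"
  have "omega x y = 0" if k: "k \<le> n" and x: "x \<in> flag_of b k" and y: "y \<in> flag_of b (n - k)" for k x y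
  proof -
    have x: "x \<in> vec.span (b ` {1..k})" and y: "y \<in> vec.span (b ` {1..n - k})"
      using x y k by (auto simp: flag_of_def n_def min_def)
    have 1: "omega (b i) y = 0" if "i \<in> {1..k}" for i
      using y
    proof (induction rule: vec.span_induct_alt)
      case (step c w z)
      then obtain l where "w = b l" "l \<in> {1..n - k}" by auto
      then have "omega (b i) w = 0" using R that k by (auto simp: n_def)
      with step show ?case by (simp add: omega_add_right omega_scale_right)
    qed simp
    show ?thesis using x
    proof (induction rule: vec.span_induct_alt)
      case (step c w z)
      then have "omega w y = 0" using 1 by auto
      with step show ?case by (simp add: omega_add_left omega_scale_left)
    qed simp
  qed
  then show "flag_of b \<in> isotropic_flags"
    using assms unfolding isotropic_flags_def omega_def n_def by auto
qed

lemma base_basis_e: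
  assumes "k \<in> {1..2 * CARD('m)}"
  shows "(base_basis k :: 'm::enum cvec) =
    (if k \<le> CARD('m) then e k else - e (CARD('m) + (2 * CARD('m) + 1 - k)))"
proof (cases "k \<le> CARD('m)")
  case False
  then have "2 * CARD('m) + 1 - k \<in> {1..CARD('m)}" using assms by auto
  then show ?thesis using False by (simp add: base_basis_def jmap_e)
qed (simp add: base_basis_def)

lemma base_basis_orthonormal:
  assumes k: "k \<in> {1..2 * CARD('m)}" and l: "l \<in> {1..2 * CARD('m)}"
  shows "hprod (base_basis k) (base_basis l :: 'm::enum cvec) = (if k = l then 1 else 0)"
proof -
  define t where "t = (\<lambda>k. if k \<le> CARD('m) then k else CARD('m) + (2 * CARD('m) + 1 - k))"
  have t: "t k \<in> {1..2 * CARD('m)}" "t l \<in> {1..2 * CARD('m)}" "t k = t l \<longleftrightarrow> k = l"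
    using k l by (auto simp: t_def)
  have "base_basis x = (if x \<le> CARD('m) then 1 else -1) *s (e (t x) :: 'm cvec)" if "x \<in> {1..2 * CARD('m)}" for x
    unfolding base_basis_e[OF that] t_def by (simp add: vec_eq_iff)
  then have "hprod (base_basis k) (base_basis l :: 'm cvec) =
      (if k \<le> CARD('m) then 1 else -1) * ((if l \<le> CARD('m) then 1 else -1) * hprod (e (t k)) (e (t l) :: 'm cvec))"
    using k l by (simp add: hprod_scale_left hprod_scale_right)
  then show ?thesis unfolding hprod_e[OF t(1,2)] t(3) by auto
qed

lemma jmap_base_basis:
  assumes k: "k \<in> {1..2 * CARD('m)}"
  shows "jmap (base_basis k :: 'm::enum cvec) = (if k \<le> CARD('m) then 1 else -1) *s base_basis (2 * CARD('m) + 1 - k)"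
  using k by (auto simp: base_basis_def vec_eq_iff)

text \<open>The Gram matrix is antidiagonal with entries of modulus one. Hence pairing with a basis
  vector reads off a single coordinate, which later makes the isotropy equations solvable.\<close>

lemma omega_base_basis:
  assumes k: "k \<in> {1..2 * CARD('m)}" and l: "l \<in> {1..2 * CARD('m)}"
  shows "omega (base_basis k) (base_basis l :: 'm::enum cvec) =
    (if k + l = 2 * CARD('m) + 1 then (if l \<le> CARD('m) then 1 else -1) else 0)"
proof -
  have "2 * CARD('m) + 1 - l \<in> {1..2 * CARD('m)}" "k = 2 * CARD('m) + 1 - l \<longleftrightarrow> k + l = 2 * CARD('m) + 1"
    using k l by auto
  then show ?thesis
    unfolding omega_def jmap_base_basis[OF l] hprod_scale_right
    by (subst base_basis_orthonormal[OF k]) auto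
qed

lemma det_frame_base_basis: "det (frame (base_basis :: nat \<Rightarrow> 'm::enum cvec)) \<noteq> 0"
  by (rule det_frame_orthonormal) (rule base_basis_orthonormal)

lemma base_flag_in_flags: "base_flag \<in> flags"
  unfolding base_flag_def by (rule flag_of_in_flags[OF det_frame_base_basis])

lemma base_flag_isotropic: "base_flag \<in> (isotropic_flags :: 'm::enum flag set)"
  using base_flag_in_flags unfolding base_flag_def
  by (subst isotropic_flag_of_iff) (auto simp: omega_base_basis)

lemma isotropic_eq_orbit: "isotropic_flags = orbit K0 base_flag"
  using isotropic_in_orbit K0_act_isotropic[OF _ base_flag_isotropic] by (auto simp: orbit_def)

lemma opposite_eq_orbit: "(opposite_flags :: 'm::enum flag set) = orbit SLH base_flag"
proof -
  have "base_flag \<in> (opposite_flags :: 'm flag set)" using base_flag_isotropic isotropic_subset_opposite by blast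
  then show ?thesis using opposite_flags_in_orbit SLH_act_opposite by (auto simp: orbit_def)
qed

lemma orbit_eq_of_mem:
  assumes mult: "\<And>g h. g \<in> H \<Longrightarrow> h \<in> H \<Longrightarrow> g ** h \<in> H"
    and inv: "\<And>g. g \<in> H \<Longrightarrow> \<exists>h\<in>H. h ** g = mat 1" and W: "W \<in> orbit H V"
  shows "orbit H W = orbit H V"
proof -
  obtain g where g: "g \<in> H" "W = act g V" using W by (auto simp: orbit_def)
  obtain g' where g': "g' \<in> H" "g' ** g = mat 1" using inv[OF g(1)] by blast
  have V: "V = act g' W" unfolding g(2) act_mult[symmetric] g'(2) by simp
  show ?thesis
  proof
    show "orbit H W \<subseteq> orbit H V"
      unfolding orbit_def g(2) by (auto simp: mult g(1) simp flip: act_mult)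
    show "orbit H V \<subseteq> orbit H W"
      by (subst V) (auto simp: orbit_def mult g'(1) simp flip: act_mult)
  qed
qed

lemma SLH_orbit_eq: "W \<in> orbit SLH V \<Longrightarrow> orbit SLH W = orbit SLH V"
  by (rule orbit_eq_of_mem) (auto simp: SLH_mult elim: SLH_inverse)

lemma K0_orbit_eq: "W \<in> orbit K0 V \<Longrightarrow> orbit K0 W = orbit K0 V"
  by (rule orbit_eq_of_mem) (auto simp: K0_mult elim: K0_inverse)

section \<open>Openness and density of the opposite flags\<close>

lemma continuous_on_det:
  fixes f :: "'a::topological_space \<Rightarrow> complex ^ 'n::finite ^ 'n"
  assumes "\<And>i j. continuous_on S (\<lambda>x. f x $ i $ j)"
  shows "continuous_on S (\<lambda>x. det (f x))"
  unfolding det_def by (intro continuous_on_sum continuous_on_mult continuous_on_prod continuous_on_const assms)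

lemma holomorphic_on_det:
  fixes f :: "complex \<Rightarrow> complex ^ 'n::finite ^ 'n"
  assumes "\<And>i j. (\<lambda>x. f x $ i $ j) holomorphic_on S"
  shows "(\<lambda>x. det (f x)) holomorphic_on S"
  unfolding det_def by (intro holomorphic_intros assms)

lemma continuous_on_matrix_vector:
  fixes f :: "'a::topological_space \<Rightarrow> complex ^ 'n::finite ^ 'k::finite"
  assumes "continuous_on S f"
  shows "continuous_on S (\<lambda>x. f x *v y)"
  unfolding matrix_vector_mult_def
  by (intro continuous_on_vec_lambda continuous_on_sum continuous_on_mult continuous_on_component
      continuous_on_const assms)

lemma continuous_on_jmap:
  fixes f :: "'a::topological_space \<Rightarrow> 'm::finite cvec"
  assumes "continuous_on S f"
  shows "continuous_on S (\<lambda>x. jmap (f x))"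
proof -
  have "linear (jmap :: 'm cvec \<Rightarrow> 'm cvec)"
    by (rule linearI) (simp_all add: jmap_add scaleR_eq_smult jmap_scale)
  then have "bounded_linear (jmap :: 'm cvec \<Rightarrow> 'm cvec)" by (simp add: linear_conv_bounded_linear)
  then show ?thesis using assms by (rule bounded_linear.continuous_on)
qed

lemma det_nz_expansion:
  assumes "det (\<chi> r i. f i $ r :: complex ^ 'n::finite ^ 'n) \<noteq> 0"
  obtains c where "z = (\<Sum>i\<in>UNIV. c i *s f i)"
proof -
  obtain B where "(\<chi> r i. f i $ r) ** B = mat 1"
    using assms by (metis invertible_def invertible_det_nz)
  then have "(\<chi> r i. f i $ r) *v (B *v z) = z" by (simp add: matrix_vector_mul_assoc)
  then have "z = (\<Sum>i\<in>UNIV. (B *v z) $ i *s f i)"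
    by (simp add: vec_eq_iff matrix_vector_mult_def mult.commute)
  then show ?thesis by (rule that)
qed

text \<open>The dimensions are complementary, so trivial intersection and full sum are equivalent.
  The sum has explicit witnesses that survive a perturbation of the flag.\<close>

lemma opposite_iff_sum:
  assumes V: "V \<in> (flags :: 'm::enum flag set)" and k: "k \<le> 2 * CARD('m)"
  shows "V k \<inter> jmap ` V (2 * CARD('m) - k) = {0} \<longleftrightarrow>
    (\<forall>z. \<exists>x\<in>V k. \<exists>y\<in>V (2 * CARD('m) - k). z = x + jmap y)"
proof -
  let ?W = "jmap ` V (2 * CARD('m) - k)"
  have sub: "vec.subspace (V k)" "vec.subspace ?W"
    using V by (auto simp: flags_subspace subspace_jmap_image)
  have "vec.dim {x + y |x y. x \<in> V k \<and> y \<in> ?W} + vec.dim (V k \<inter> ?W) = 2 * CARD('m)"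
    using vec.dim_sums_Int[OF sub] V k by (simp add: dim_jmap_image flags_subspace flags_dim)
  moreover have "vec.dim (V k \<inter> ?W) = 0 \<longleftrightarrow> V k \<inter> ?W = {0}"
    using sub by (auto simp: vec.dim_eq_0 vec.subspace_0)
  moreover have "vec.dim {x + y |x y. x \<in> V k \<and> y \<in> ?W} = 2 * CARD('m) \<longleftrightarrow>
      {x + y |x y. x \<in> V k \<and> y \<in> ?W} = UNIV"
  proof
    assume "vec.dim {x + y |x y. x \<in> V k \<and> y \<in> ?W} = 2 * CARD('m)"
    then show "{x + y |x y. x \<in> V k \<and> y \<in> ?W} = UNIV"
      by (intro vec.subspace_dim_equal vec.subspace_sums sub) (auto simp: card_cart_basis)
  qed (simp add: card_cart_basis)
  ultimately have "V k \<inter> ?W = {0} \<longleftrightarrow> {x + y |x y. x \<in> V k \<and> y \<in> ?W} = UNIV" by linarith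
  then show ?thesis by (auto simp: set_eq_iff) blast+
qed

text \<open>Witnesses for \<open>V\<^sub>k + j V\<^sub>n\<^sub>-\<^sub>k = \<complex>\<^sup>n\<close> at one matrix keep working wherever the
  determinants below do not vanish.\<close>

definition span_matrix :: "('m::finite + 'm \<Rightarrow> 'm cvec) \<Rightarrow> ('m + 'm \<Rightarrow> 'm cvec) \<Rightarrow> 'm cmat \<Rightarrow> 'm cmat" where
  "span_matrix x y A = (\<chi> r i. (A *v x i + jmap (A *v y i)) $ r)"

lemma opposite_witnesses:
  assumes "act A std_flag \<in> (opposite_flags :: 'm::enum flag set)"
  obtains x y where "\<And>k i. k \<le> 2 * CARD('m) \<Longrightarrow> x k i \<in> std_flag k \<and> y k i \<in> std_flag (2 * CARD('m) - k)"
    "\<And>k. k \<le> 2 * CARD('m) \<Longrightarrow> span_matrix (x k) (y k) A = mat 1"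
proof -
  have flag: "act A std_flag \<in> (flags :: 'm flag set)" using assms by (simp add: opposite_flags_def)
  have "\<exists>a b. a \<in> std_flag k \<and> b \<in> std_flag (2 * CARD('m) - k) \<and> axis i 1 = A *v a + jmap (A *v b)"
    if k: "k \<le> 2 * CARD('m)" for k i
  proof -
    have "act A std_flag k \<inter> jmap ` act A std_flag (2 * CARD('m) - k) = {0}"
      using assms k by (simp add: opposite_flags_def)
    then obtain a b where "a \<in> act A std_flag k" "b \<in> act A std_flag (2 * CARD('m) - k)" "axis i 1 = a + jmap b"
      unfolding opposite_iff_sum[OF flag k] by blast
    then show ?thesis by (auto simp: act_def)
  qed
  then obtain x y where xy: "\<And>k i. k \<le> 2 * CARD('m) \<Longrightarrow> x k i \<in> std_flag k \<and> y k i \<in> std_flag (2 * CARD('m) - k) \<and>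
      axis i 1 = A *v x k i + jmap (A *v y k i)" by metis
  show ?thesis
  proof
    show "x k i \<in> std_flag k \<and> y k i \<in> std_flag (2 * CARD('m) - k)" if "k \<le> 2 * CARD('m)" for k i
      using xy[OF that] by blast
    show "span_matrix (x k) (y k) A = mat 1" if "k \<le> 2 * CARD('m)" for k
    proof -
      have "span_matrix (x k) (y k) A $ r $ i = axis i 1 $ r" for r i
        using xy[OF that, of i] by (simp add: span_matrix_def)
      then show ?thesis by (simp add: vec_eq_iff mat_def axis_def)
    qed
  qed
qed

lemma opposite_of_span_matrix:
  fixes A :: "'m::enum cmat"
  assumes "det A \<noteq> 0" and xy: "\<And>k i. k \<le> 2 * CARD('m) \<Longrightarrow> x k i \<in> std_flag k \<and> y k i \<in> std_flag (2 * CARD('m) - k)"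
    and det: "\<And>k. k \<le> 2 * CARD('m) \<Longrightarrow> det (span_matrix (x k) (y k) A) \<noteq> 0"
  shows "act A std_flag \<in> opposite_flags"
proof -
  have flag: "act A std_flag \<in> flags" by (rule act_in_flags[OF assms(1) std_flag_in_flags])
  have "\<exists>a\<in>act A std_flag k. \<exists>b\<in>act A std_flag (2 * CARD('m) - k). z = a + jmap b"
    if k: "k \<le> 2 * CARD('m)" for k z
  proof -
    obtain c where c: "z = (\<Sum>i\<in>UNIV. c i *s (A *v x k i + jmap (A *v y k i)))"
      by (rule det_nz_expansion[OF det[OF k, unfolded span_matrix_def]]) (rule that)
    \<comment> \<open>The coefficients of the \<open>y\<close> vectors are conjugated because they
      are pulled through j.\<close>
    have "z = A *v (\<Sum>i\<in>UNIV. c i *s x k i) + jmap (A *v (\<Sum>i\<in>UNIV. cnj (c i) *s y k i))"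
      unfolding c by (simp add: vec.sum vec.scale jmap_sum jmap_scale vector_add_ldistrib sum.distrib)
    moreover have "(\<Sum>i\<in>UNIV. c i *s x k i) \<in> std_flag k" "(\<Sum>i\<in>UNIV. cnj (c i) *s y k i) \<in> std_flag (2 * CARD('m) - k)"
      using xy[OF k] by (auto intro!: vec.subspace_sum vec.subspace_scale)
    ultimately show ?thesis unfolding act_def by blast
  qed
  then show ?thesis using opposite_iff_sum[OF flag] flag by (auto simp: opposite_flags_def)
qed

lemma openin_opposite: "openin flag_topology (opposite_flags :: 'm::enum flag set)"
proof (rule openin_flag_topologyI)
  show "(opposite_flags :: 'm flag set) \<subseteq> flags" by (auto simp: opposite_flags_def)
  fix g :: "'m cmat" assume g: "g \<in> SL" "act g std_flag \<in> opposite_flags"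
  obtain x y where xy: "\<And>k i. k \<le> 2 * CARD('m) \<Longrightarrow> x k i \<in> std_flag k \<and> y k i \<in> std_flag (2 * CARD('m) - k)"
    "\<And>k. k \<le> 2 * CARD('m) \<Longrightarrow> span_matrix (x k) (y k) g = mat 1"
    by (rule opposite_witnesses[OF g(2)]) (rule that)
  define T where "T = (\<Inter>k\<in>{..2 * CARD('m)}. {A. det (span_matrix (x k) (y k) A) \<noteq> 0})"
  have "continuous_on UNIV (\<lambda>A. det (span_matrix (x k) (y k) A))" for k
    unfolding span_matrix_def
    by (rule continuous_on_det)
      (simp, intro continuous_intros continuous_on_matrix_vector continuous_on_jmap)
  then have "open T" unfolding T_def
    by (intro open_INT finite_atMost ballI open_Collect_neq continuous_on_const)
  moreover have "g \<in> T" using xy(2) by (simp add: T_def)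
  moreover have "act h std_flag \<in> opposite_flags" if "h \<in> SL \<inter> T" for h
    using that xy(1) by (intro opposite_of_span_matrix) (auto simp: T_def SL_det_nz)
  ultimately show "\<exists>T. open T \<and> g \<in> T \<and> (\<forall>h\<in>SL \<inter> T. act h std_flag \<in> opposite_flags)" by blast
qed

text \<open>The line \<open>P\<close> joins \<open>A\<close> to a matrix \<open>A1\<close>
  representing \<open>base_flag\<close>. Witnesses for opposition at \<open>A1\<close> give
  determinants that do not vanish at \<open>z = 1\<close>, so their zeros cannot accumulate at 0,
  and small real parameters give opposite flags close to \<open>A\<close>.\<close>

lemma opposite_dense:
  fixes A :: "'m::enum cmat"
  assumes A: "A \<in> SL" and T: "open T" "A \<in> T"
  obtains B where "B \<in> SL" "B \<in> T" "act B std_flag \<in> opposite_flags"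
proof -
  define n where "n = 2 * CARD('m)"
  obtain A1 :: "'m cmat" where A1: "A1 \<in> SL" "base_flag = act A1 std_flag"
    by (rule flags_transitive[OF base_flag_in_flags])
  have A1_opp: "act A1 std_flag \<in> (opposite_flags :: 'm flag set)"
    using base_flag_isotropic isotropic_subset_opposite A1(2) by auto
  obtain x y where xy: "\<And>k i. k \<le> n \<Longrightarrow> x k i \<in> std_flag k \<and> y k i \<in> std_flag (n - k)"
    "\<And>k. k \<le> n \<Longrightarrow> span_matrix (x k) (y k) A1 = mat 1"
    by (rule opposite_witnesses[OF A1_opp, folded n_def]) (rule that)
  define P where "P = (\<lambda>z. A + smat z (A1 - A))"
  \<comment> \<open>In the span matrix of \<open>P z\<close> the j-terms would involve the conjugate
    of \<open>z\<close>. Writing \<open>z\<close> there instead gives a holomorphic function with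
    the same values at real \<open>z\<close>.\<close>
  define Q where "Q = (\<lambda>k z. \<chi> r i. (A *v x k i + z *s ((A1 - A) *v x k i) + jmap (A *v y k i) +
      z *s jmap ((A1 - A) *v y k i)) $ r)"
  have P_vec: "P z *v w = A *v w + z *s ((A1 - A) *v w)" for z w
    unfolding P_def by (simp add: matrix_vector_mult_add_rdistrib smat_vector)
  have Q_real: "Q k (of_real t) = span_matrix (x k) (y k) (P (of_real t))" for k t
    unfolding Q_def span_matrix_def P_vec by (simp add: jmap_add jmap_scale vec_eq_iff)
  have P1: "P 1 = A1" and P0: "P 0 = A" by (simp_all add: P_def smat_def vec_eq_iff)
  have holQ: "(\<lambda>z. det (Q k z)) holomorphic_on UNIV" for k
    unfolding Q_def by (rule holomorphic_on_det) (simp, intro holomorphic_intros)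
  have evQ: "\<forall>\<^sub>F z in at 0. det (Q k z) \<noteq> 0" if "k \<le> n" for k
  proof -
    have "det (Q k 1) \<noteq> 0" using Q_real[of k 1] xy(2)[OF that] P1 by simp
    then show ?thesis
      using non_zero_neighbour_alt[OF holQ[of k] open_UNIV connected_UNIV UNIV_I UNIV_I, of 1 0]
      by (auto elim: eventually_mono)
  qed
  have contP: "continuous_on S P" for S
    unfolding P_def smat_def by (intro continuous_intros)
  \<comment> \<open>This factor returns \<open>P z\<close> to determinant 1. It tends to 1 as
    \<open>z\<close> tends to 0, so the rescaled matrix remains close to \<open>A\<close>.\<close>
  define c where "c = (\<lambda>z. exp (- Ln (det (P z)) / of_nat n))"
  have det0: "det (P 0) = 1" using A P0 by (simp add: SL_def)
  have lim_det: "((\<lambda>z. det (P z)) \<longlongrightarrow> 1) (at 0)"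
  proof -
    have "continuous_on UNIV (\<lambda>z. det (P z))"
      by (rule continuous_on_det) (intro continuous_on_component contP)
    then have "isCont (\<lambda>z. det (P z)) 0" by (simp add: continuous_on_eq_continuous_at)
    then show ?thesis using det0 by (simp add: isCont_def)
  qed
  have lim_P: "(P \<longlongrightarrow> A) (at 0)"
  proof -
    have "isCont P 0" using contP[of UNIV] by (simp add: continuous_on_eq_continuous_at)
    then show ?thesis using P0 by (simp add: isCont_def)
  qed
  have lim_Ln: "((\<lambda>z. Ln (det (P z))) \<longlongrightarrow> Ln 1) (at 0)"
    by (rule tendsto_Ln[OF lim_det]) (simp add: complex_nonpos_Reals_iff)
  have lim_c: "(c \<longlongrightarrow> exp (- Ln 1 / of_nat n)) (at 0)"
    unfolding c_def by (intro tendsto_exp tendsto_divide tendsto_minus tendsto_const lim_Ln) (simp add: n_def)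
  have "((\<lambda>z. smat (c z) (P z)) \<longlongrightarrow> smat (exp (- Ln 1 / of_nat n)) A) (at 0)"
    unfolding smat_def by (intro tendsto_vec_lambda tendsto_mult tendsto_vec_nth lim_c lim_P)
  moreover have "smat (exp (- Ln 1 / of_nat n)) A = A" by (simp add: smat_def vec_eq_iff)
  ultimately have "((\<lambda>z. smat (c z) (P z)) \<longlongrightarrow> A) (at 0)" by simp
  from topological_tendstoD[OF this T] have "\<forall>\<^sub>F z in at 0. smat (c z) (P z) \<in> T" .
  moreover have "\<forall>\<^sub>F z in at 0. det (P z) \<noteq> 0"
    using tendsto_imp_eventually_ne[OF lim_det, of 0] by simp
  moreover have "\<forall>\<^sub>F z in at 0. \<forall>k\<in>{..n}. det (Q k z) \<noteq> 0"
    by (rule eventually_ball_finite) (auto intro: evQ)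
  ultimately have "\<forall>\<^sub>F z in at 0. smat (c z) (P z) \<in> T \<and> det (P z) \<noteq> 0 \<and> (\<forall>k\<in>{..n}. det (Q k z) \<noteq> 0)"
    by eventually_elim simp
  then obtain d where d: "d > 0" "\<And>z. z \<noteq> 0 \<Longrightarrow> dist z 0 < d \<Longrightarrow>
      smat (c z) (P z) \<in> T \<and> det (P z) \<noteq> 0 \<and> (\<forall>k\<in>{..n}. det (Q k z) \<noteq> 0)"
    unfolding eventually_at by auto
  \<comment> \<open>The parameter must be real, since only there do \<open>Q\<close> and the span
    matrix agree.\<close>
  define t where "t = complex_of_real (d / 2)"
  have t: "smat (c t) (P t) \<in> T" "det (P t) \<noteq> 0" "\<And>k. k \<le> n \<Longrightarrow> det (Q k t) \<noteq> 0"
    using d(2)[of t] d(1) by (auto simp: t_def norm_divide)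
  have "act (P t) std_flag \<in> opposite_flags"
  proof (rule opposite_of_span_matrix[OF t(2)])
    show "x k i \<in> std_flag k \<and> y k i \<in> std_flag (2 * CARD('m) - k)" if "k \<le> 2 * CARD('m)" for k i
      using xy(1)[of k i] that by (simp add: n_def)
    show "det (span_matrix (x k) (y k) (P t)) \<noteq> 0" if "k \<le> 2 * CARD('m)" for k
      using t(3)[of k] that unfolding t_def Q_real n_def by simp
  qed
  moreover have "act (smat (c t) (P t)) std_flag = act (P t) (std_flag :: 'm flag)"
    by (rule act_smat) (auto simp: c_def)
  moreover have "smat (c t) (P t) \<in> SL"
  proof -
    have n0: "(of_nat n :: complex) \<noteq> 0" by (simp add: n_def)
    have "c t ^ n = exp (of_nat n * (- Ln (det (P t)) / of_nat n))"
      unfolding c_def by (rule exp_of_nat_mult[symmetric])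
    also have "of_nat n * (- Ln (det (P t)) / of_nat n) = - Ln (det (P t))" using n0 by simp
    also have "exp (- Ln (det (P t))) = 1 / det (P t)" using t(2) by (simp add: exp_minus divide_inverse)
    finally show ?thesis using t(2) by (simp add: SL_def det_smat n_def)
  qed
  ultimately show ?thesis using that t(1) by metis
qed

text \<open>Any open orbit meets the dense set \<open>opposite_flags\<close>, which is itself an
  orbit, and orbits with a common element coincide.\<close>

lemma open_orbit_eq: "open_orbit = (opposite_flags :: 'm::enum flag set)"
  unfolding open_orbit_def
proof (rule the_equality)
  show "(\<exists>V\<in>flags. (opposite_flags :: 'm flag set) = orbit SLH V) \<and> openin flag_topology (opposite_flags :: 'm flag set)"
    using opposite_eq_orbit base_flag_in_flags openin_opposite by blast
next
  fix D :: "'m flag set"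
  assume "(\<exists>V\<in>flags. D = orbit SLH V) \<and> openin flag_topology D"
  then obtain V where V: "V \<in> flags" "D = orbit SLH V" "openin flag_topology D" by blast
  obtain A :: "'m cmat" where A: "A \<in> SL" "V = act A std_flag" by (rule flags_transitive[OF V(1)])
  obtain T where T: "open T" "\<And>g. g \<in> SL \<Longrightarrow> act g std_flag \<in> D \<longleftrightarrow> g \<in> T"
    by (rule openin_flag_topologyE[OF V(3)]) (rule that)
  have "mat 1 \<in> (SLH :: 'm cmat set)" by (simp add: SLH_def SL_def)
  then have "V \<in> D" unfolding V(2) orbit_def by (metis act_one image_eqI)
  then have "A \<in> T" using A T(2) by simp
  then obtain B where B: "B \<in> SL" "B \<in> T" "act B std_flag \<in> (opposite_flags :: 'm flag set)"
    using opposite_dense[OF A(1) T(1)] by blast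
  then have "act B std_flag \<in> orbit SLH V" using T(2)[OF B(1)] V(2) by simp
  moreover have "act B std_flag \<in> orbit SLH base_flag" using B(3) by (simp only: opposite_eq_orbit)
  ultimately show "D = opposite_flags"
    unfolding V(2) opposite_eq_orbit using SLH_orbit_eq by metis
qed

section \<open>The isotropic flags form a complex submanifold\<close>

text \<open>The positions below the diagonal and not below the antidiagonal. They stay free, while
  each remaining lower position is determined by one isotropy equation.\<close>

definition isotropic_coords :: "(('m::enum + 'm) \<times> ('m + 'm)) set" where
  "isotropic_coords = {(i, j). idx j < idx i \<and> idx i + idx j \<le> 2 * CARD('m) + 1}"

lemma coord_subspace: "vec.subspace {Y :: complex ^ 'n::finite. \<forall>p. p \<notin> G \<longrightarrow> Y $ p = 0}"
  by (auto simp: vec.subspace_def)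

text \<open>In the chart at the base flag, the equation omega(phi_k, phi_l) = 0 with
  \<open>k < l\<close> and \<open>k + l \<le> n\<close> is attached to the position in row
  \<open>n + 1 - k\<close> and column \<open>l\<close>, because its linear part contains this
  coordinate with coefficient of modulus one. Using these equations in place of the coordinates in
  \<open>Eq\<close> is a local coordinate change that straightens the isotropic flags.\<close>

lemma straight_isotropic:
  assumes c: "c \<noteq> 0"
  shows "straight_at (card (isotropic_coords :: (('m::enum + 'm) \<times> ('m + 'm)) set))
    {X \<in> strictly_lower. flag_param (smat c (frame base_basis)) X \<in> (isotropic_flags :: 'm flag set)} 0"
proof -
  define n where "n = 2 * CARD('m)"
  define Eq :: "(('m + 'm) \<times> ('m + 'm)) set" where
    "Eq = {(i, j). idx j < idx i \<and> n + 1 < idx i + idx j}"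
  define bb :: "nat \<Rightarrow> 'm cvec" where "bb = base_basis"
  define \<psi> where "\<psi> = (\<lambda>k X. frame bb *v (coords_mat (low X) *v e k))"
  define K where "K = (\<lambda>p :: ('m + 'm) \<times> ('m + 'm). n + 1 - idx (fst p))"
  define l where "l = (\<lambda>p :: ('m + 'm) \<times> ('m + 'm). idx (snd p))"
  \<comment> \<open>On \<open>Eq\<close> this is the linear part of the attached equation and
    elsewhere the coordinate itself; \<open>B\<close> holds the quadratic part.\<close>
  define A :: "'m coords \<Rightarrow> 'm coords" where
    "A = (\<lambda>X. \<chi> p. if p \<in> Eq then omega (bb (K p)) (\<psi> (l p) X) + omega (\<psi> (K p) X) (bb (l p)) else X $ p)"
  define B :: "'m coords \<Rightarrow> 'm coords \<Rightarrow> 'm coords" where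
    "B = (\<lambda>X Y. \<chi> p. if p \<in> Eq then omega (\<psi> (K p) X) (\<psi> (l p) Y) else 0)"
  define h where "h = (\<lambda>X. A X + B X X)"
  have low_lin: "coords_mat (low (X + Y)) *v w = coords_mat (low X) *v w + coords_mat (low Y) *v w"
    "coords_mat (low (a *s X)) *v w = a *s (coords_mat (low X) *v w)" for X Y :: "'m coords" and w a
  proof -
    have "coords_mat (low (X + Y)) = coords_mat (low X) + coords_mat (low Y)"
      "coords_mat (low (a *s X)) = smat a (coords_mat (low X))"
      by (simp_all add: vec_eq_iff smat_def)
    then show "coords_mat (low (X + Y)) *v w = coords_mat (low X) *v w + coords_mat (low Y) *v w"
      "coords_mat (low (a *s X)) *v w = a *s (coords_mat (low X) *v w)"
      by (simp_all add: matrix_vector_mult_add_rdistrib smat_vector)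
  qed
  have \<psi>_add: "\<psi> k (X + Y) = \<psi> k X + \<psi> k Y" and \<psi>_scale: "\<psi> k (a *s X) = a *s \<psi> k X" for k X Y a
    by (simp_all add: \<psi>_def low_lin vec.add vec.scale)
  have \<psi>_expand: "\<psi> k X = (\<Sum>r\<in>{1..n}. (if k < r then X $ (coord r, coord k) else 0) *s bb r)"
    if "k \<in> {1..n}" for k X
    unfolding \<psi>_def frame_expansion
    by (rule sum.cong) (use that in \<open>auto simp: n_def matrix_vector_e\<close>)
  have om: "omega (bb k) (bb r) = (if k + r = n + 1 then (if r \<le> CARD('m) then 1 else -1) else 0)"
    if "k \<in> {1..n}" "r \<in> {1..n}" for k r
    using omega_base_basis[where ?'m = 'm, of k r] that by (simp add: bb_def n_def)
  have om_left: "omega (bb k) (\<psi> r X) = (if n + 1 - k \<le> CARD('m) then 1 else -1) *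
      (if r < n + 1 - k then X $ (coord (n + 1 - k), coord r) else 0)" if "k \<in> {1..n}" "r \<in> {1..n}" for k r X
  proof -
    have "omega (bb k) (\<psi> r X) = (\<Sum>s\<in>{1..n}. (if r < s then X $ (coord s, coord r) else 0) * omega (bb k) (bb s))"
      by (simp add: \<psi>_expand[OF that(2)] omega_sum_right omega_scale_right)
    also have "\<dots> = (\<Sum>s\<in>{1..n}. if s = n + 1 - k then (if n + 1 - k \<le> CARD('m) then 1 else -1) *
      (if r < n + 1 - k then X $ (coord (n + 1 - k), coord r) else 0) else 0)"
      by (rule sum.cong) (use that in \<open>auto simp: om\<close>)
    also have "\<dots> = (if n + 1 - k \<le> CARD('m) then 1 else -1) *
      (if r < n + 1 - k then X $ (coord (n + 1 - k), coord r) else 0)"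
      using that by (subst sum.delta) auto
    finally show ?thesis .
  qed
  have EqD: "K p \<in> {1..n}" "l p \<in> {1..n}" "K p < l p" "K p + l p \<le> n" "fst p = coord (n + 1 - K p)" "snd p = coord (l p)"
    if "p \<in> Eq" for p
  proof -
    have b: "idx (fst p) \<le> n" "1 \<le> idx (snd p)" by (simp_all add: n_def)
    have Eqp: "idx (snd p) < idx (fst p)" "n + 1 < idx (fst p) + idx (snd p)"
      using that by (auto simp: Eq_def)
    have "n + 1 - K p = idx (fst p)" unfolding K_def using b by linarith
    then show "fst p = coord (n + 1 - K p)" "snd p = coord (l p)" by (simp_all add: l_def)
    show "K p \<in> {1..n}" "l p \<in> {1..n}" "K p < l p" "K p + l p \<le> n"
      unfolding K_def l_def atLeastAtMost_iff using b Eqp by linarith+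
  qed
  have A_lin: "Vector_Spaces.linear (*s) (*s) A"
    by (rule vec_linearI) (auto simp: A_def vec_eq_iff \<psi>_add \<psi>_scale omega_add_left omega_add_right
        omega_scale_left omega_scale_right distrib_left)
  have B1: "Vector_Spaces.linear (*s) (*s) (\<lambda>X. B X Y)" for Y
    by (rule vec_linearI) (auto simp: B_def vec_eq_iff \<psi>_add \<psi>_scale omega_add_left omega_scale_left)
  have B2: "Vector_Spaces.linear (*s) (*s) (B X)" for X
    by (rule vec_linearI) (auto simp: B_def vec_eq_iff \<psi>_add \<psi>_scale omega_add_right omega_scale_right)
  have \<psi>0: "\<psi> k 0 = 0" for k using \<psi>_scale[of k 0 0] by simp
  have inj: "v = 0" if v: "A v + B v 0 + B 0 v = 0" for v
  proof -
    have "B v 0 = 0" "B 0 v = 0" by (simp_all add: B_def \<psi>0 vec_eq_iff)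
    then have Av: "A v $ p = 0" for p using v by simp
    have out: "v $ p = 0" if "p \<notin> Eq" for p using Av[of p] that by (simp add: A_def)
    have "v $ p = 0" if p: "p \<in> Eq" for p
    proof -
      note E = EqD[OF p]
      \<comment> \<open>The second term of the linear part involves only the position in row
        \<open>n + 1 - l p\<close> and column \<open>K p\<close>. It lies outside \<open>Eq\<close>,
        where \<open>v\<close> already vanishes, so the remaining term isolates
        \<open>v $ p\<close>.\<close>
      have "(coord (n + 1 - l p), coord (K p)) \<notin> Eq"
      proof -
        have "n + 1 - l p \<in> {1..2 * CARD('m)}" "K p \<in> {1..2 * CARD('m)}"
          using E(1,2) unfolding atLeastAtMost_iff n_def by linarith+
        then have "idx (coord (n + 1 - l p) :: 'm + 'm) = n + 1 - l p" "idx (coord (K p) :: 'm + 'm) = K p"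
          by (simp_all only: idx_coord)
        then show ?thesis using E by (auto simp: Eq_def)
      qed
      then have "omega (\<psi> (K p) v) (bb (l p)) = 0"
        using om_left[of "l p" "K p" v] E out unfolding omega_commute[of "\<psi> (K p) v"] by simp
      then have "omega (bb (K p)) (\<psi> (l p) v) = 0" using Av[of p] p by (simp add: A_def)
      moreover have "l p < n + 1 - K p" using E by auto
      ultimately have "v $ (coord (n + 1 - K p), coord (l p)) = 0"
        using om_left[of "K p" "l p" v] E by (auto split: if_splits)
      then show ?thesis using E(5,6) by (metis prod.collapse)
    qed
    then show ?thesis using out by (simp add: vec_eq_iff) blast
  qed
  obtain U U' where U: "0 \<in> U" "biholomorphic (\<lambda>x. A x + B x x) U U'"
    using quadratic_local_biholomorphic[OF A_lin B1 B2 inj] by blast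
  let ?L = "{Y :: 'm coords. \<forall>p. p \<notin> isotropic_coords \<longrightarrow> Y $ p = 0}"
  let ?S = "{X \<in> strictly_lower. flag_param (smat c (frame base_basis)) X \<in> (isotropic_flags :: 'm flag set)}"
  have iff: "X \<in> ?S \<longleftrightarrow> A X + B X X \<in> ?L" for X
  proof -
    define \<phi> where "\<phi> = (\<lambda>k. bb k + \<psi> k X)"
    have flag_eq: "flag_param (smat c (frame base_basis)) X = flag_of \<phi>"
    proof -
      have "flag_param (smat c (frame base_basis)) X = act (frame bb) (act (unip X) std_flag)"
        unfolding flag_param_eq act_mult bb_def
        by (rule act_smat[OF c]) (simp add: act_def vec.subspace_image)
      also have "\<dots> = flag_of (\<lambda>k. frame bb *v (unip X *v e k))" unfolding act_flag_of ..
      also have "\<dots> = flag_of \<phi>"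
        by (rule flag_of_cong)
          (simp add: \<phi>_def \<psi>_def unip_low matrix_vector_mult_add_rdistrib vec.add frame_e)
      finally show ?thesis .
    qed
    have "flag_of \<phi> \<in> flags" unfolding flag_eq[symmetric] flag_param_eq
      using c det_frame_base_basis[where ?'m = 'm]
      by (intro act_in_flags std_flag_in_flags) (simp add: det_mul det_smat)
    then have "flag_of \<phi> \<in> isotropic_flags \<longleftrightarrow> (\<forall>k r. 1 \<le> k \<longrightarrow> 1 \<le> r \<longrightarrow> k + r \<le> n \<longrightarrow> omega (\<phi> k) (\<phi> r) = 0)"
      using isotropic_flag_of_iff by (simp add: n_def)
    also have "\<dots> \<longleftrightarrow> (\<forall>p\<in>Eq. omega (\<phi> (K p)) (\<phi> (l p)) = 0)"
    proof
      assume R: "\<forall>p\<in>Eq. omega (\<phi> (K p)) (\<phi> (l p)) = 0"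
      \<comment> \<open>Antisymmetry of \<open>omega\<close> settles \<open>k = r\<close> and
        reduces \<open>r < k\<close> to this case.\<close>
      have lt: "omega (\<phi> k) (\<phi> r) = 0" if "1 \<le> k" "k < r" "k + r \<le> n" for k r
      proof -
        have "n + 1 - k \<in> {1..2 * CARD('m)}" "r \<in> {1..2 * CARD('m)}"
          using that unfolding atLeastAtMost_iff n_def by linarith+
        then have "idx (coord (n + 1 - k) :: 'm + 'm) = n + 1 - k" "idx (coord r :: 'm + 'm) = r"
          by (simp_all only: idx_coord)
        then have "(coord (n + 1 - k), coord r) \<in> Eq" "K (coord (n + 1 - k), coord r) = k" "l (coord (n + 1 - k), coord r) = r"
          using that by (auto simp: Eq_def K_def l_def)
        then show ?thesis using R by metis
      qed
      show "\<forall>k r. 1 \<le> k \<longrightarrow> 1 \<le> r \<longrightarrow> k + r \<le> n \<longrightarrow> omega (\<phi> k) (\<phi> r) = 0"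
      proof (intro allI impI)
        fix k r assume kr: "1 \<le> k" "1 \<le> r" "k + r \<le> n"
        consider "k < r" | "r < k" | "k = r" by linarith
        then show "omega (\<phi> k) (\<phi> r) = 0"
        proof cases
          case 2
          then have "omega (\<phi> r) (\<phi> k) = 0" using kr by (intro lt) auto
          then show ?thesis using omega_commute[of "\<phi> k" "\<phi> r"] by simp
        next
          case 3
          then show ?thesis using omega_commute[of "\<phi> k" "\<phi> k"] by simp
        qed (use kr lt in auto)
      qed
    qed (use EqD in fastforce)
    also have "\<dots> \<longleftrightarrow> (\<forall>p\<in>Eq. (A X + B X X) $ p = 0)"
    proof -
      have "omega (\<phi> (K p)) (\<phi> (l p)) = (A X + B X X) $ p" if p: "p \<in> Eq" for p
      proof -
        have "omega (bb (K p)) (bb (l p)) = 0" using om EqD[OF p] by simp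
        then show ?thesis using p by (simp add: \<phi>_def A_def B_def omega_add_left omega_add_right)
      qed
      then show ?thesis by simp
    qed
    finally have 1: "flag_of \<phi> \<in> isotropic_flags \<longleftrightarrow> (\<forall>p\<in>Eq. (A X + B X X) $ p = 0)" .
    have "(A X + B X X) $ p = X $ p" if "p \<notin> Eq" for p using that by (simp add: A_def B_def)
    moreover have "p \<notin> isotropic_coords \<longleftrightarrow> p \<in> Eq \<or> idx (fst p) \<le> idx (snd p)" for p :: "('m + 'm) \<times> ('m + 'm)"
      by (cases p) (auto simp: isotropic_coords_def Eq_def n_def)
    moreover have "idx (fst p) \<le> idx (snd p) \<Longrightarrow> p \<notin> Eq" for p by (cases p) (auto simp: Eq_def)
    moreover have "X \<in> strictly_lower \<longleftrightarrow> (\<forall>p. idx (fst p) \<le> idx (snd p) \<longrightarrow> X $ p = 0)"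
      by (auto simp: strictly_lower_iff)
    ultimately have "A X + B X X \<in> ?L \<longleftrightarrow> (\<forall>p\<in>Eq. (A X + B X X) $ p = 0) \<and> X \<in> strictly_lower" by auto
    then show ?thesis using 1 flag_eq by auto
  qed
  show ?thesis
    by (rule straight_atI[OF U coord_subspace[of isotropic_coords] dim_substandard_cart]) (rule iff)
qed

lemma complex_submanifold_isotropic:
  "complex_submanifold (card (isotropic_coords :: (('m::enum + 'm) \<times> ('m + 'm)) set)) (isotropic_flags :: 'm flag set)"
proof -
  obtain c where c: "c \<noteq> 0" "smat c (frame base_basis) \<in> (SL :: 'm cmat set)"
    by (rule scale_to_SL[OF det_frame_base_basis])
  have base: "act (smat c (frame base_basis)) std_flag = (base_flag :: 'm flag)"
    unfolding base_flag_def flag_of_frame[of base_basis] by (rule act_smat[OF c(1)]) simp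
  show ?thesis
  proof (rule complex_submanifold_orbit[of K0 _ "smat c (frame base_basis)"])
    show "K0 \<subseteq> (SL :: 'm cmat set)" by (auto simp: K0_def SLH_def)
    show "act h W \<in> isotropic_flags \<longleftrightarrow> W \<in> isotropic_flags" if h: "h \<in> K0" for h and W :: "'m flag"
    proof
      obtain h' where h': "h' \<in> K0" "h' ** h = mat 1" using K0_inverse[OF h] by metis
      assume "act h W \<in> isotropic_flags"
      then have "act h' (act h W) \<in> isotropic_flags" by (rule K0_act_isotropic[OF h'(1)])
      then show "W \<in> isotropic_flags" unfolding act_mult[symmetric] h'(2) by simp
    qed (rule K0_act_isotropic[OF h])
  qed (use c straight_isotropic base isotropic_eq_orbit in auto)
qed

section \<open>Holomorphic curves in complex submanifolds\<close>

text \<open>\<open>holomorphic_map_on\<close> relates a space to itself, so maps from the complex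
  line get their own notion; the form of the derivative expresses its complex linearity.\<close>

definition holomorphic_curve :: "(complex \<Rightarrow> complex ^ 'k::finite) \<Rightarrow> complex set \<Rightarrow> bool" where
  "holomorphic_curve c S \<longleftrightarrow> (\<forall>z\<in>S. \<exists>v. (c has_derivative (\<lambda>w. w *s v)) (at z))"

lemma bounded_linear_smult: "bounded_linear (\<lambda>w :: complex. w *s (a :: complex ^ 'k::finite))"
proof -
  have "linear (\<lambda>w :: complex. w *s a)"
    by (rule linearI) (simp_all add: vec.scale_left_distrib scaleR_conv_of_real[where 'a = complex] scaleR_eq_smult vector_smult_assoc)
  then show ?thesis by (simp add: linear_conv_bounded_linear)
qed

lemma holomorphic_curveI:
  fixes c :: "complex \<Rightarrow> complex ^ 'k::finite"
  assumes "\<And>i. (\<lambda>z. c z $ i) holomorphic_on UNIV"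
  shows "holomorphic_curve c S"
  unfolding holomorphic_curve_def
proof
  fix z
  have "\<exists>d. ((\<lambda>z. c z $ i) has_field_derivative d) (at z)" for i
    using assms[of i] by (auto simp: holomorphic_on_def field_differentiable_def)
  then obtain d where d: "\<And>i. ((\<lambda>z. c z $ i) has_field_derivative d i) (at z)" by metis
  have c_eq: "c = (\<lambda>z. \<Sum>i\<in>UNIV. c z $ i *s axis i 1)"
    by (simp add: fun_eq_iff basis_expansion)
  have "((\<lambda>z. \<Sum>i\<in>UNIV. c z $ i *s axis i 1) has_derivative (\<lambda>w. \<Sum>i\<in>UNIV. (d i * w) *s axis i 1)) (at z)"
    by (intro has_derivative_sum bounded_linear.has_derivative[OF bounded_linear_smult]
        d[unfolded has_field_derivative_def])
  moreover have "(\<Sum>i\<in>UNIV. (d i * w) *s axis i 1) = w *s (\<chi> i. d i)" for w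
    using basis_expansion[of "w *s (\<chi> i. d i)"] by (simp add: mult.commute)
  ultimately show "\<exists>v. (c has_derivative (\<lambda>w. w *s v)) (at z)"
    unfolding c_eq[symmetric] by auto
qed

lemma holomorphic_curve_compose:
  assumes "holomorphic_curve c S" "holomorphic_map_on f U" "c ` S \<subseteq> U"
  shows "holomorphic_curve (\<lambda>z. f (c z)) S"
  unfolding holomorphic_curve_def
proof
  fix z assume z: "z \<in> S"
  then obtain v where v: "(c has_derivative (\<lambda>w. w *s v)) (at z)"
    using assms(1) by (auto simp: holomorphic_curve_def)
  have "c z \<in> U" using assms(3) z by auto
  then obtain f' where f': "(f has_derivative f') (at (c z))" "\<And>a v. f' (a *s v) = a *s f' v"
    using assms(2) by (auto simp: holomorphic_map_on_def)
  have "((\<lambda>z. f (c z)) has_derivative (\<lambda>w. f' (w *s v))) (at z)"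
    using has_derivative_compose[OF v f'(1)] .
  then show "\<exists>v. ((\<lambda>z. f (c z)) has_derivative (\<lambda>w. w *s v)) (at z)"
    unfolding f'(2) by blast
qed

lemma holomorphic_curve_component:
  fixes c :: "complex \<Rightarrow> complex ^ 'k::finite"
  assumes "holomorphic_curve c S" "open S"
  shows "(\<lambda>z. c z $ i) holomorphic_on S"
proof (rule holomorphic_onI)
  fix z assume z: "z \<in> S"
  then obtain v where v: "(c has_derivative (\<lambda>w. w *s v)) (at z)"
    using assms(1) by (auto simp: holomorphic_curve_def)
  have "((\<lambda>z. c z $ i) has_derivative (\<lambda>w. (w *s v) $ i)) (at z)"
    by (rule bounded_linear.has_derivative[OF bounded_linear_vec_nth v])
  then have "((\<lambda>z. c z $ i) has_field_derivative v $ i) (at z)"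
    by (simp add: has_field_derivative_def mult.commute[of _ "v $ i"])
  then show "(\<lambda>z. c z $ i) field_differentiable at z within S"
    by (meson field_differentiable_at_within field_differentiable_def)
qed

lemma holomorphic_curve_continuous: "holomorphic_curve c S \<Longrightarrow> continuous_on S c"
  unfolding holomorphic_curve_def
  by (meson continuous_at_imp_continuous_on has_derivative_continuous)

text \<open>Extend a basis of \<open>L\<close> and project along it. Membership in \<open>L\<close>
  becomes the vanishing of finitely many functions, to which the identity theorem applies.\<close>

lemma subspace_eq_kernel:
  assumes "vec.subspace (L :: (complex ^ 'k::finite) set)"
  obtains P :: "complex ^ 'k \<Rightarrow> complex ^ 'k" where "Vector_Spaces.linear (*s) (*s) P" "\<And>y. P y = 0 \<longleftrightarrow> y \<in> L"
proof -
  obtain B where B: "B \<subseteq> L" "vec.independent B" "L \<subseteq> vec.span B"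
    by (rule vec.basis_exists[of L]) auto
  obtain B' where B': "B \<subseteq> B'" "vec.independent B'" "UNIV \<subseteq> vec.span B'"
    by (rule vec.maximal_independent_subset_extend[OF subset_UNIV B(2)]) auto
  obtain P where P: "Vector_Spaces.linear (*s) (*s) P" "\<forall>x\<in>B'. P x = (if x \<in> B then 0 else x)"
    using vec.linear_independent_extend[OF B'(2), of "\<lambda>x. if x \<in> B then 0 else x"] by blast
  interpret P: Vector_Spaces.linear "(*s)" "(*s)" P by (rule P(1))
  have "P y = 0" if "y \<in> vec.span B" for y
    using that
  proof (induction rule: vec.span_induct_alt)
    case (step c x y)
    then show ?case using P(2) B'(1) by (auto simp: P.add P.scale)
  qed (simp add: P.zero)
  moreover have "y - P y \<in> vec.span B" for y
  proof -
    have "y \<in> vec.span B'" using B'(3) by auto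
    then show ?thesis
    proof (induction rule: vec.span_induct_alt)
      case base
      then show ?case by (simp add: P.zero vec.span_zero)
    next
      case (step c x y)
      have "x - P x \<in> vec.span B" using P(2) step(1) by (auto simp: vec.span_zero vec.span_base)
      then have in_span: "c *s (x - P x) + (y - P y) \<in> vec.span B"
        using step(2) by (intro vec.span_add vec.span_scale)
      have eq: "c *s x + y - P (c *s x + y) = c *s (x - P x) + (y - P y)"
        by (simp add: P.add P.scale vec.scale_right_diff_distrib)
      show ?case unfolding eq by (rule in_span)
    qed
  qed
  moreover have "vec.span B = L" using B assms by (simp add: vec.span_minimal subset_antisym)
  ultimately have "P y = 0 \<longleftrightarrow> y \<in> L" for y
    by (metis diff_zero)
  then show ?thesis using that P(1) by blast
qed

lemma holomorphic_on_imp_continuous_matrix: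
  fixes A :: "complex \<Rightarrow> complex ^ 'n::finite ^ 'k::finite"
  assumes "\<And>i j. (\<lambda>z. A z $ i $ j) holomorphic_on UNIV"
  shows "continuous_on UNIV A"
proof -
  have "continuous_on UNIV (\<lambda>z. \<chi> i j. A z $ i $ j)"
    by (intro continuous_on_vec_lambda holomorphic_on_imp_continuous_on assms)
  then show ?thesis by simp
qed

text \<open>A holomorphic curve lying in a complex submanifold along the line \<open>z\<^sub>0 + i\<real>\<close> stays in it
  near \<open>z\<^sub>0\<close>: straighten the submanifold and apply the identity theorem to the transversal
  coordinates.\<close>

lemma curve_in_submanifold:
  fixes A :: "complex \<Rightarrow> 'm::enum cmat"
  assumes C: "complex_submanifold d C"
    and A: "\<And>z. A z \<in> SL" "\<And>i j. (\<lambda>z. A z $ i $ j) holomorphic_on UNIV"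
    and line: "\<And>y::real. act (A (z0 + \<i> * of_real y)) std_flag \<in> C"
  obtains r where "r > 0" "\<And>z. z \<in> ball z0 r \<Longrightarrow> act (A z) std_flag \<in> C"
proof -
  obtain W lu where W: "open W" "mat_coords (mat 1) \<in> W" "holomorphic_map_on lu W"
    "\<And>M :: 'm cmat. mat_coords M \<in> W \<Longrightarrow> det M \<noteq> 0 \<Longrightarrow>
      act M std_flag = act (unip (lu (mat_coords M))) std_flag"
    "\<And>Y. Y \<in> W \<Longrightarrow> lu Y \<in> strictly_lower"
    by (rule lu_near_identity) (rule that)
  obtain H where H: "H \<in> SL" "A z0 ** H = mat 1" "H ** A z0 = mat 1" by (rule SL_inverse[OF A(1)])
  define cM where "cM = (\<lambda>z. mat_coords (H ** A z))"
  have curve_M: "holomorphic_curve cM S" for S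
  proof (rule holomorphic_curveI)
    fix p :: "('m + 'm) \<times> ('m + 'm)"
    have "(\<lambda>z. \<Sum>k\<in>UNIV. H $ fst p $ k * A z $ k $ snd p) holomorphic_on UNIV"
      by (intro holomorphic_intros A(2))
    then show "(\<lambda>z. cM z $ p) holomorphic_on UNIV"
      by (simp add: cM_def mat_coords_def matrix_matrix_mult_def)
  qed
  define O1 where "O1 = {z. cM z \<in> W}"
  have O1: "open O1" "z0 \<in> O1"
    using open_Int_preimage[OF holomorphic_curve_continuous[OF curve_M] open_UNIV W(1)] W(2) H(3)
    by (simp_all add: O1_def cM_def)
  define X where "X = (\<lambda>z. lu (cM z))"
  have curve_X: "holomorphic_curve X O1"
    unfolding X_def by (rule holomorphic_curve_compose[OF curve_M W(3)]) (auto simp: O1_def)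
  have flag_X: "flag_param (A z0) (X z) = act (A z) std_flag" and X_low: "X z \<in> strictly_lower" if "z \<in> O1" for z
  proof -
    have "det (H ** A z) \<noteq> 0" by (intro SL_det_nz SL_mult H A)
    then have "act (unip (X z)) std_flag = act (H ** A z) std_flag"
      using W(4)[of "H ** A z"] that by (simp add: O1_def X_def cM_def)
    then have "flag_param (A z0) (X z) = act (A z0 ** H ** A z) std_flag"
      unfolding flag_param_eq by (simp add: act_mult)
    then show "flag_param (A z0) (X z) = act (A z) std_flag" unfolding H(2) by simp
    show "X z \<in> strictly_lower" unfolding X_def by (rule W(5)) (use that in \<open>simp add: O1_def\<close>)
  qed
  have "flag_param (A z0) (X z0) = flag_param (A z0) 0" using flag_X[OF O1(2)] by simp
  then have "low (X z0) = low 0" by (rule flag_param_inj[OF SL_det_nz[OF A(1)]])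
  then have X0: "X z0 = 0" using X_low[OF O1(2)] by (simp add: low_strictly_lower)
  let ?S = "{X \<in> strictly_lower. flag_param (A z0) X \<in> C}"
  have "0 \<in> ?S" using line[of 0] by simp
  then have "straight_at d ?S 0"
    using C A(1)[of z0] unfolding complex_submanifold_def submanifold_of_space_iff by blast
  then obtain U U' h g L where U: "0 \<in> U" "open U" "open U'" "holomorphic_map_on h U" "holomorphic_map_on g U'"
    "\<And>x. x \<in> U \<Longrightarrow> h x \<in> U'" "\<And>y. y \<in> U' \<Longrightarrow> g y \<in> U"
    "\<And>x. x \<in> U \<Longrightarrow> g (h x) = x" "\<And>y. y \<in> U' \<Longrightarrow> h (g y) = y"
    "vec.subspace L" "vec.dim L = d" "\<And>x. x \<in> U \<Longrightarrow> x \<in> ?S \<longleftrightarrow> h x \<in> L"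
    by (rule straight_atE) (rule that)
  obtain P :: "'m coords \<Rightarrow> 'm coords" where P: "Vector_Spaces.linear (*s) (*s) P" "\<And>y. P y = 0 \<longleftrightarrow> y \<in> L"
    by (rule subspace_eq_kernel[OF U(10)]) (rule that)
  define O2 where "O2 = {z \<in> O1. X z \<in> U}"
  have "open O2" unfolding O2_def
    by (rule open_Int_preimage[OF holomorphic_curve_continuous[OF curve_X] O1(1) U(2)])
  moreover have "z0 \<in> O2" using O1(2) X0 U(1) by (simp add: O2_def)
  ultimately obtain r where r: "r > 0" "ball z0 r \<subseteq> O2" by (rule openE)
  have in_C: "act (A z) std_flag \<in> C \<longleftrightarrow> P (h (X z)) = 0" if "z \<in> O2" for z
  proof -
    from that have z: "z \<in> O1" "X z \<in> U" by (auto simp: O2_def)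
    then show ?thesis using U(12)[OF z(2)] flag_X[OF z(1)] X_low[OF z(1)] P(2) by simp
  qed
  have curve_P: "holomorphic_curve (\<lambda>z. P (h (X z))) O2"
  proof -
    have "holomorphic_curve X O2" using curve_X by (auto simp: holomorphic_curve_def O2_def)
    then have "holomorphic_curve (\<lambda>z. h (X z)) O2"
      by (rule holomorphic_curve_compose[OF _ U(4)]) (auto simp: O2_def)
    then show ?thesis
      by (rule holomorphic_curve_compose[OF _ holomorphic_map_on_linear[OF P(1), where U = UNIV]]) simp
  qed
  \<comment> \<open>On this segment the curve lies in \<open>C\<close> by hypothesis, so the
    transversal coordinates vanish there. The segment accumulates at the interior point
    \<open>z0\<close>, as the identity theorem requires.\<close>
  let ?line = "{z \<in> ball z0 r. \<exists>y::real. z = z0 + \<i> * of_real y}"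
  have limpt: "z0 islimpt ?line"
    unfolding islimpt_approachable
  proof (intro allI impI)
    fix \<epsilon> :: real assume \<epsilon>: "0 < \<epsilon>"
    define y where "y = min \<epsilon> r / 2"
    have y: "0 < y" "y < \<epsilon>" "y < r" using \<epsilon> r(1) by (auto simp: y_def)
    then show "\<exists>z\<in>?line. z \<noteq> z0 \<and> dist z z0 < \<epsilon>"
      by (intro bexI[of _ "z0 + \<i> * of_real y"]) (auto simp: dist_norm norm_mult)
  qed
  have "act (A z) std_flag \<in> C" if z: "z \<in> ball z0 r" for z
  proof -
    have "P (h (X z)) $ p = 0" for p
    proof (rule analytic_continuation[of "\<lambda>z. P (h (X z)) $ p" "ball z0 r" ?line z0])
      have "holomorphic_curve (\<lambda>z. P (h (X z))) (ball z0 r)"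
        using curve_P r(2) by (auto simp: holomorphic_curve_def)
      then show "(\<lambda>z. P (h (X z)) $ p) holomorphic_on ball z0 r"
        by (rule holomorphic_curve_component) simp
      show "P (h (X w)) $ p = 0" if "w \<in> ?line" for w
        using in_C[of w] line that r(2) by auto
    qed (use limpt r(1) z in auto)
    then have "P (h (X z)) = 0" by (simp add: vec_eq_iff)
    then show ?thesis using in_C z r(2) by blast
  qed
  then show ?thesis using that r(1) by blast
qed

section \<open>Compactness of the base cycle\<close>

lemma continuous_conj_transpose: "continuous_on S conj_transpose"
  unfolding conj_transpose_def
  by (intro continuous_on_vec_lambda continuous_on_cnj continuous_on_component continuous_on_id)

text \<open>The columns of a unitary matrix have length one, which bounds all entries by 1; the
  defining conditions are closed.\<close>

lemma compact_K0: "compact (K0 :: 'm::finite cmat set)"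
proof -
  have cont_det: "continuous_on UNIV (det :: 'm cmat \<Rightarrow> complex)"
    by (rule continuous_on_det) (intro continuous_on_component continuous_on_id)
  have K0_eq: "K0 = {A :: 'm cmat. det A = 1 \<and> conj_transpose A ** A = mat 1 \<and> (\<forall>v. jmap (A *v v) = A *v jmap v)}"
    by (auto simp: K0_def SU_def SLH_def SL_def)
  have "closed (K0 :: 'm cmat set)"
    unfolding K0_eq
    by (intro closed_Collect_conj closed_Collect_all closed_Collect_eq cont_det continuous_on_const
        continuous_on_matrix_mult continuous_conj_transpose continuous_on_jmap continuous_on_matrix_vector
        continuous_on_id)
  moreover have "bounded (K0 :: 'm cmat set)"
    unfolding bounded_iff
  proof (intro exI ballI)
    fix A :: "'m cmat" assume A: "A \<in> K0"
    have entry: "cmod (A $ i $ j) \<le> 1" for i j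
    proof -
      have "hprod (A *v axis j 1) (A *v axis j 1) = hprod (axis j 1) (axis j 1)"
        using A by (rule K0_hprod)
      also have "\<dots> = 1" by (simp add: hprod_def axis_def mult_delta_left)
      finally have "(\<Sum>i\<in>UNIV. (cmod ((A *v axis j 1) $ i))\<^sup>2) = 1"
        unfolding hprod_self by (simp only: of_real_eq_1_iff)
      moreover have "(cmod ((A *v axis j 1) $ i))\<^sup>2 \<le> (\<Sum>i\<in>UNIV. (cmod ((A *v axis j 1) $ i))\<^sup>2)"
        by (rule member_le_sum) auto
      moreover have "(A *v axis j 1) $ i = A $ i $ j"
        by (simp add: matrix_vector_mult_def axis_def mult_delta_right)
      ultimately have "(cmod (A $ i $ j))\<^sup>2 \<le> 1\<^sup>2" by simp
      then show ?thesis by (rule power2_le_imp_le) simp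
    qed
    have "norm A \<le> (\<Sum>i\<in>UNIV. norm (A $ i))" unfolding norm_vec_def by (rule L2_set_le_sum) simp
    also have "\<dots> \<le> (\<Sum>i\<in>(UNIV :: ('m + 'm) set). \<Sum>j\<in>(UNIV :: ('m + 'm) set). 1)"
    proof (rule sum_mono)
      fix i
      have "norm (A $ i) \<le> (\<Sum>j\<in>UNIV. norm (A $ i $ j))" unfolding norm_vec_def by (rule L2_set_le_sum) simp
      also have "\<dots> \<le> (\<Sum>j\<in>(UNIV :: ('m + 'm) set). 1)" by (rule sum_mono) (rule entry)
      finally show "norm (A $ i) \<le> (\<Sum>j\<in>(UNIV :: ('m + 'm) set). 1)" .
    qed
    finally show "norm A \<le> (\<Sum>i\<in>(UNIV :: ('m + 'm) set). \<Sum>j\<in>(UNIV :: ('m + 'm) set). 1)" .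
  qed
  ultimately show ?thesis by (simp add: compact_eq_bounded_closed)
qed

text \<open>The limit is taken among matrices, since flags carry only a quotient topology. Along a
  subsequence the elements of \<open>K0\<close> converge; what remains of \<open>A n\<close> after
  removing them and \<open>A0\<close> fixes the standard flag, hence is upper triangular, and this
  passes to the limit.\<close>

lemma K0_orbit_sequentially_closed:
  fixes A :: "nat \<Rightarrow> 'm::enum cmat"
  assumes V: "V \<in> flags" and A: "\<And>n. A n \<in> SL" "\<And>n. act (A n) std_flag \<in> orbit K0 V" and lim: "A \<longlonglongrightarrow> A'"
  shows "act A' std_flag \<in> orbit K0 V"
proof -
  obtain A0 where A0: "A0 \<in> SL" "V = act A0 std_flag" by (rule flags_transitive[OF V])
  obtain H where H: "H \<in> SL" "A0 ** H = mat 1" "H ** A0 = mat 1" by (rule SL_inverse[OF A0(1)])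
  have "\<exists>k\<in>K0. act (A n) std_flag = act k V" for n using A(2)[of n] by (auto simp: orbit_def)
  then obtain k where k: "\<And>n. k n \<in> K0" "\<And>n. act (A n) std_flag = act (k n) V" by metis
  obtain k' r where kr: "k' \<in> K0" "strict_mono r" "(k \<circ> r) \<longlonglongrightarrow> k'"
    using compact_K0 k(1) unfolding compact_def by metis
  have conj: "conj_transpose g ** g = mat 1" "g ** conj_transpose g = mat 1" if "g \<in> K0" for g :: "'m cmat"
  proof -
    show "conj_transpose g ** g = mat 1" using that by (simp add: K0_def SU_def)
    then show "g ** conj_transpose g = mat 1" by (simp add: matrix_left_right_inverse)
  qed
  define b where "b = (\<lambda>n. H ** conj_transpose (k n) ** A n)"
  define b' where "b' = H ** conj_transpose k' ** A'"
  have SL_A': "A' \<in> SL"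
  proof -
    have "continuous_on UNIV (det :: 'm cmat \<Rightarrow> complex)"
      by (rule continuous_on_det) (intro continuous_on_component continuous_on_id)
    then have "closed (SL :: 'm cmat set)"
      unfolding SL_def by (intro closed_Collect_eq continuous_on_const)
    then show ?thesis using lim A(1) by (meson closed_sequentially)
  qed
  have conj_SL: "conj_transpose g \<in> SL" if "g \<in> K0" for g :: "'m cmat"
  proof -
    have "det (conj_transpose g) * det g = 1" using conj[OF that] by (metis det_I det_mul)
    then show ?thesis using that by (simp add: K0_def SU_def SL_def)
  qed
  have b_SL: "b n \<in> SL" for n unfolding b_def by (intro SL_mult H A conj_SL k)
  have b'_SL: "b' \<in> SL" unfolding b'_def by (intro SL_mult H SL_A' conj_SL kr)
  have "act (b n) std_flag = std_flag" for n
  proof -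
    have "act (b n) std_flag = act (H ** (conj_transpose (k n) ** k n) ** A0) std_flag"
      unfolding b_def act_mult k(2) A0(2) ..
    also have "\<dots> = std_flag" using conj[OF k(1)] H(3) by simp
    finally show ?thesis .
  qed
  then have upper: "b n $ i $ j = 0" if "idx j < idx i" for n i j
    using act_std_fixed_iff[OF SL_det_nz[OF b_SL]] that by blast
  have "(\<lambda>n. b (r n)) \<longlonglongrightarrow> b'"
  proof -
    have "(\<lambda>n. conj_transpose (k (r n))) \<longlonglongrightarrow> conj_transpose k'"
      using continuous_on_tendsto_compose[OF continuous_conj_transpose[of UNIV] kr(3)] by (simp add: o_def)
    moreover have "(\<lambda>n. A (r n)) \<longlonglongrightarrow> A'" using LIMSEQ_subseq_LIMSEQ[OF lim kr(2)] by (simp add: o_def)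
    ultimately show ?thesis
      unfolding b_def b'_def matrix_matrix_mult_def
      by (intro tendsto_vec_lambda tendsto_sum tendsto_mult tendsto_const tendsto_vec_nth) simp_all
  qed
  then have lim_b: "(\<lambda>n. b (r n) $ i $ j) \<longlonglongrightarrow> b' $ i $ j" for i j by (intro tendsto_vec_nth)
  have "b' $ i $ j = 0" if "idx j < idx i" for i j
    using lim_b[of i j] unfolding upper[OF that] by (simp add: LIMSEQ_const_iff)
  then have b'_fix: "act b' std_flag = std_flag" using act_std_fixed_iff[OF SL_det_nz[OF b'_SL]] by blast
  have "act A' std_flag = act (k' ** (A0 ** H) ** conj_transpose k' ** A') std_flag"
    using H(2) conj(2)[OF kr(1)] by simp
  also have "\<dots> = act k' (act A0 (act b' std_flag))" unfolding b'_def by (simp add: act_mult)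
  also have "\<dots> = act k' V" unfolding b'_fix A0(2) ..
  finally show ?thesis using kr(1) by (auto simp: orbit_def)
qed

section \<open>Uniqueness of the base cycle\<close>

text \<open>The weights are distinct and are opposite on e_a and j(e_a). Opposite signs put the
  torus into \<open>SL\<close> and its imaginary part into \<open>K0\<close>; distinctness makes the
  limit of a flag a coordinate flag.\<close>

definition weight :: "'m::enum + 'm \<Rightarrow> real" where
  "weight i = (case i of Inl a \<Rightarrow> real (idx (Inl a)) | Inr a \<Rightarrow> - real (idx (Inl a)))"

definition torus :: "complex \<Rightarrow> 'm::enum cmat" where
  "torus z = (\<chi> i j. if i = j then exp (z * of_real (weight i)) else 0)"

lemma torus_vector: "(torus z *v x) $ i = exp (z * of_real (weight i)) * x $ i"
  by (simp add: torus_def matrix_vector_mult_def mult_delta_left)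

lemma torus_add: "torus (z + w) = torus z ** torus w"
proof -
  have "torus (z + w) *v x = torus z ** torus w *v x" for x :: "'a cvec"
    by (simp add: vec_eq_iff torus_vector distrib_right exp_add flip: matrix_vector_mul_assoc)
  then show ?thesis by (simp add: matrix_eq)
qed

lemma det_torus: "det (torus z :: 'm::enum cmat) = (\<Prod>i\<in>(UNIV :: ('m + 'm) set). exp (z * of_real (weight i)))"
  by (subst det_triangular[where r = idx]) (auto simp: torus_def inj_idx)

lemma det_torus_1: "det (torus z :: 'm::enum cmat) = 1"
proof -
  have "(\<Sum>i\<in>(UNIV :: ('m + 'm) set). z * of_real (weight i)) = 0"
    by (simp add: sum_UNIV_Plus weight_def sum_negf)
  then show ?thesis unfolding det_torus by (subst exp_sum[symmetric]) simp_all
qed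

lemma torus_imaginary_K0: "torus (\<i> * of_real y) \<in> (K0 :: 'm::enum cmat set)"
proof -
  have cnj_exp: "cnj (exp (\<i> * of_real y * of_real w)) = exp (\<i> * of_real y * of_real (- w))" for w
    by (simp add: exp_cnj)
  have "jmap (torus (\<i> * of_real y) *v v) = torus (\<i> * of_real y) *v jmap v" for v :: "'m cvec"
    unfolding vec_sum_eq_iff by (simp add: torus_vector weight_def exp_cnj)
  moreover have "conj_transpose (torus (\<i> * of_real y)) ** torus (\<i> * of_real y) = (mat 1 :: 'm cmat)"
  proof -
    have "(conj_transpose (torus (\<i> * of_real y)) ** torus (\<i> * of_real y) :: 'm cmat) $ i $ j =
        (if i = j then exp (\<i> * of_real y * of_real (- weight i)) * exp (\<i> * of_real y * of_real (weight i)) else 0)" for i j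
    proof -
      define E where "E = (\<lambda>k :: 'm + 'm. exp (\<i> * of_real y * of_real (weight k)))"
      have "(conj_transpose (torus (\<i> * of_real y)) ** torus (\<i> * of_real y) :: 'm cmat) $ i $ j =
        (\<Sum>k\<in>UNIV. cnj (if k = i then E k else 0) * (if k = j then E k else 0))"
        unfolding E_def by (simp add: matrix_matrix_mult_def conj_transpose_def torus_def)
      also have "\<dots> = (\<Sum>k\<in>UNIV. if k = i then (if i = j then cnj (E i) * E i else 0) else 0)"
        by (rule sum.cong) auto
      finally have "(conj_transpose (torus (\<i> * of_real y)) ** torus (\<i> * of_real y) :: 'm cmat) $ i $ j =
        (\<Sum>k\<in>UNIV. if k = i then (if i = j then cnj (exp (\<i> * of_real y * of_real (weight i))) * exp (\<i> * of_real y * of_real (weight i)) else 0) else 0)"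
        unfolding E_def .
      then show ?thesis by (simp only: sum.delta finite UNIV_I if_True cnj_exp)
    qed
    then show ?thesis by (simp add: vec_eq_iff mat_def flip: exp_add)
  qed
  ultimately show ?thesis by (simp add: K0_def SU_def SLH_def SL_def det_torus_1)
qed

text \<open>Lists the coordinates in the order of increasing weight.\<close>

definition weight_index :: "'m::enum itself \<Rightarrow> nat \<Rightarrow> nat" where
  "weight_index _ k = (if k \<le> CARD('m) then 2 * CARD('m) + 1 - k else k - CARD('m))"

definition weight_basis :: "nat \<Rightarrow> 'm::enum cvec" where
  "weight_basis k = e (weight_index TYPE('m) k)"

lemma weight_index_range:
  "k \<in> {1..2 * CARD('m)} \<Longrightarrow> weight_index TYPE('m::enum) k \<in> {1..2 * CARD('m)}"
  by (auto simp: weight_index_def)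

lemma weight_index_inj:
  "k \<in> {1..2 * CARD('m)} \<Longrightarrow> l \<in> {1..2 * CARD('m)} \<Longrightarrow>
    weight_index TYPE('m::enum) k = weight_index TYPE('m) l \<longleftrightarrow> k = l"
  by (auto simp: weight_index_def)

lemma weight_coord:
  assumes "k \<in> {1..2 * CARD('m)}"
  shows "weight (coord (weight_index TYPE('m) k) :: 'm::enum + 'm) =
    (if k \<le> CARD('m) then real k - real CARD('m) - 1 else real k - real CARD('m))"
proof -
  have inl: "weight (coord x :: 'm + 'm) = real x" and inr: "weight (coord (CARD('m) + x) :: 'm + 'm) = - real x"
    if x: "x \<in> {1..CARD('m)}" for x
  proof -
    obtain a where a: "coord x = (Inl a :: 'm + 'm)" "coord (CARD('m) + x) = (Inr a :: 'm + 'm)"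
      by (rule coord_Inl[OF x])
    have "x \<in> {1..2 * CARD('m)}" using x by auto
    then have "idx (Inl a :: 'm + 'm) = x" by (simp only: a(1)[symmetric] idx_coord)
    then show "weight (coord x :: 'm + 'm) = real x" "weight (coord (CARD('m) + x) :: 'm + 'm) = - real x"
      by (simp_all add: a weight_def)
  qed
  show ?thesis
  proof (cases "k \<le> CARD('m)")
    case True
    then have k: "CARD('m) + 1 - k \<in> {1..CARD('m)}" "weight_index TYPE('m) k = CARD('m) + (CARD('m) + 1 - k)"
      using assms by (auto simp: weight_index_def)
    show ?thesis unfolding k(2) inr[OF k(1)] using True by (simp add: of_nat_diff)
  next
    case False
    then have k: "k - CARD('m) \<in> {1..CARD('m)}" "weight_index TYPE('m) k = k - CARD('m)"
      using assms by (auto simp: weight_index_def)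
    show ?thesis unfolding k(2) inl[OF k(1)] using False by (simp add: of_nat_diff)
  qed
qed

lemma weight_coord_mono:
  assumes "k \<in> {1..2 * CARD('m)}" "l \<in> {1..2 * CARD('m)}" "k < l"
  shows "weight (coord (weight_index TYPE('m) k) :: 'm::enum + 'm) < weight (coord (weight_index TYPE('m) l) :: 'm + 'm)"
  unfolding weight_coord[OF assms(1)] weight_coord[OF assms(2)] using assms(3) by auto

lemma weight_basis_orthonormal:
  assumes "k \<in> {1..2 * CARD('m)}" "l \<in> {1..2 * CARD('m)}"
  shows "hprod (weight_basis k) (weight_basis l :: 'm::enum cvec) = (if k = l then 1 else 0)"
  unfolding weight_basis_def hprod_e[OF weight_index_range[OF assms(1)] weight_index_range[OF assms(2)]]
    weight_index_inj[OF assms] ..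

lemma span_frame:
  assumes "det (frame b) \<noteq> 0"
  shows "vec.span (b ` {1..2 * CARD('m)}) = (UNIV :: 'm::enum cvec set)"
proof -
  have F: "flag_of b \<in> (flags :: 'm flag set)" by (rule flag_of_in_flags[OF assms])
  have "flag_of b (2 * CARD('m)) = (UNIV :: 'm cvec set)"
    by (rule vec.subspace_dim_equal) (use flags_dim[OF F, of "2 * CARD('m)"] in \<open>simp_all add: subspace_flag_of card_cart_basis\<close>)
  then show ?thesis by (simp add: flag_of_def)
qed

text \<open>The torus is contained in \<open>K\<^sub>0\<close> for imaginary parameters, so a complex \<open>K\<^sub>0\<close>-orbit contains the
  complexified torus orbit of each of its flags, and its limit as the parameter tends to \<open>\<infinity>\<close>.\<close>

lemma complex_K0_orbit_coordinate_flag: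
  fixes V :: "'m::enum flag"
  assumes V: "V \<in> flags" and C: "complex_submanifold d (orbit K0 V)"
  obtains v where "v permutes {1..2 * CARD('m)}" "flag_of (\<lambda>k. weight_basis (v k)) \<in> orbit K0 V"
proof -
  define n where "n = 2 * CARD('m)"
  have "det (frame (weight_basis :: nat \<Rightarrow> 'm cvec)) \<noteq> 0"
    by (rule det_frame_orthonormal) (rule weight_basis_orthonormal)
  then have "vec.span (weight_basis ` {1..2 * CARD('m)}) = (UNIV :: 'm cvec set)" by (rule span_frame)
  from flag_adapted_basis[OF V this, folded n_def] obtain v f where v: "v permutes {1..n}" and f: "V = flag_of f"
    "\<And>k. k \<in> {1..n} \<Longrightarrow> f k - weight_basis (v k) \<in> vec.span (weight_basis ` {1..<v k})"
    by blast
  \<comment> \<open>The coordinate of largest weight occurring in the \<open>j\<close>-th basis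
    vector of the flag; \<open>f_comp\<close> makes this precise.\<close>
  define s where "s = (\<lambda>j :: 'm + 'm. coord (weight_index TYPE('m) (v (idx j))) :: 'm + 'm)"
  have v_range: "v k \<in> {1..n}" if "k \<in> {1..n}" for k using permutes_in_image[OF v] that by blast
  have idx_n: "idx (j :: 'm + 'm) \<in> {1..n}" for j unfolding n_def by (rule idx_range)
  have s_inj: "inj s"
  proof (rule injI)
    fix i j assume "s i = s j"
    then have "idx (s i) = idx (s j)" by simp
    moreover have r: "v (idx i) \<in> {1..2 * CARD('m)}" "v (idx j) \<in> {1..2 * CARD('m)}"
      using v_range[OF idx_n[of i]] v_range[OF idx_n[of j]] by (simp_all add: n_def)
    ultimately have "weight_index TYPE('m) (v (idx i)) = weight_index TYPE('m) (v (idx j))"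
      unfolding s_def idx_coord[OF weight_index_range[OF r(1)]] idx_coord[OF weight_index_range[OF r(2)]] by (simp only:)
    then have "v (idx i) = v (idx j)" unfolding weight_index_inj[OF r] .
    then have "idx i = idx j" by (rule injD[OF permutes_inj[OF v]])
    then show "i = j" by (simp only: idx_eq_iff)
  qed
  then have s_bij: "bij s" by (simp add: bij_def finite_UNIV_inj_surj)
  have wb_comp: "(weight_basis k :: 'm cvec) $ i = (if i = coord (weight_index TYPE('m) k) then 1 else 0)" for k i
    by (simp add: weight_basis_def e_def axis_def)
  have f_comp: "f (idx j) $ i = (if i = s j then 1 else 0)" if ge: "weight (s j) \<le> weight i" for i j
  proof -
    have "(f (idx j) - weight_basis (v (idx j))) $ i = 0"
      using f(2)[OF idx_n[of j]]
    proof (induction rule: vec.span_induct_alt)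
      case (step c x y)
      then obtain l where l: "l \<in> {1..<v (idx j)}" "x = weight_basis l" by auto
      have "l \<in> {1..2 * CARD('m)}" "v (idx j) \<in> {1..2 * CARD('m)}" "l < v (idx j)"
        using l v_range[OF idx_n[of j]] by (auto simp: n_def)
      then have "weight (coord (weight_index TYPE('m) l) :: 'm + 'm) < weight (s j)"
        unfolding s_def by (rule weight_coord_mono)
      then have "i \<noteq> coord (weight_index TYPE('m) l)" using ge by auto
      then show ?case using step by (simp add: l(2) wb_comp)
    qed simp
    then show ?thesis by (simp add: wb_comp s_def)
  qed
  have det_f: "det (frame f) \<noteq> 0" using flag_of_det[of f] V f(1) by simp
  obtain c where c: "c \<noteq> 0" "smat c (frame f) \<in> SL" by (rule scale_to_SL[OF det_f])
  \<comment> \<open>Rescaling the columns does not move the flag. The factors are chosen so that the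
    leading entry of each column is independent of \<open>z\<close>; the entries of lower weight
    then decay as the real part of \<open>z\<close> grows.\<close>
  define D where "D = (\<lambda>z. (\<chi> i j. if i = j then exp (- z * of_real (weight (s j))) else 0) :: 'm cmat)"
  define A where "A = (\<lambda>z. smat c (torus z ** frame f ** D z))"
  have A_entry: "A z $ i $ j = c * (exp (z * of_real (weight i - weight (s j))) * f (idx j) $ i)" for z i j
    unfolding A_def smat_def torus_def frame_def D_def
    by (simp add: matrix_matrix_mult_def mult_delta_left mult_delta_right left_diff_distrib right_diff_distrib
        exp_diff exp_minus divide_inverse mult_ac)
  have det_D: "det (D z) = 1" for z
  proof -
    have "det (D z) = (\<Prod>j\<in>UNIV. exp (- z * of_real (weight (s j))))"
      by (subst det_triangular[where r = idx]) (auto simp: D_def inj_idx)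
    also have "\<dots> = (\<Prod>i\<in>(UNIV :: ('m + 'm) set). exp (- z * of_real (weight i)))"
      using prod.reindex_bij_betw[OF s_bij, of "\<lambda>i. exp (- z * of_real (weight i))"] .
    also have "\<dots> = det (torus (- z) :: 'm cmat)" by (simp add: det_torus)
    finally show ?thesis by (simp add: det_torus_1)
  qed
  have A_SL: "A z \<in> SL" for z
    using c(2) by (simp add: A_def SL_def det_smat det_mul det_D det_torus_1)
  have A_hol: "(\<lambda>z. A z $ i $ j) holomorphic_on UNIV" for i j
    unfolding A_entry by (intro holomorphic_intros)
  have D_fix: "act (D z) std_flag = std_flag" for z
    by (subst act_std_fixed_iff) (simp add: det_D, auto simp: D_def)
  have A_act: "act (A z) std_flag = act (torus z) V" for z
  proof -
    have "act (A z) std_flag = act (torus z ** frame f ** D z) std_flag"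
      unfolding A_def by (rule act_smat[OF c(1)]) simp
    also have "\<dots> = act (torus z) V" unfolding act_mult D_fix f(1) flag_of_frame[of f] ..
    finally show ?thesis .
  qed
  have K0_inv: "act h W \<in> orbit K0 V" if "h \<in> K0" "W \<in> orbit K0 V" for h W
    using that by (auto simp: orbit_def K0_mult simp flip: act_mult)
  \<comment> \<open>The parameters for which the torus keeps the flag in the orbit. This set
    contains 0, is open by \<open>curve_in_submanifold\<close> and closed by compactness of
    \<open>K0\<close>, hence is the whole plane.\<close>
  define \<Omega> where "\<Omega> = {z. act (A z) std_flag \<in> orbit K0 V}"
  have "torus 0 = (mat 1 :: 'm cmat)" by (simp add: torus_def mat_def cong: if_cong)
  moreover have "mat 1 \<in> (K0 :: 'm cmat set)"
    by (simp add: K0_def SU_def SLH_def SL_def) (simp add: conj_transpose_def mat_def vec_eq_iff)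
  ultimately have 0: "0 \<in> \<Omega>"
    unfolding \<Omega>_def A_act by (auto simp: orbit_def intro!: image_eqI[of _ _ "mat 1"])
  have "open \<Omega>"
    unfolding open_contains_ball
  proof
    fix z0 assume z0: "z0 \<in> \<Omega>"
    have "act (A (z0 + \<i> * of_real y)) std_flag \<in> orbit K0 V" for y :: real
    proof -
      have "act (A (z0 + \<i> * of_real y)) std_flag = act (torus (\<i> * of_real y)) (act (A z0) std_flag)"
        unfolding A_act add.commute[of z0] torus_add act_mult ..
      then show ?thesis using K0_inv[OF torus_imaginary_K0] z0 by (simp add: \<Omega>_def)
    qed
    then obtain r where "r > 0" "\<And>z. z \<in> ball z0 r \<Longrightarrow> act (A z) std_flag \<in> orbit K0 V"
      using curve_in_submanifold[OF C A_SL A_hol] by metis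
    then show "\<exists>r>0. ball z0 r \<subseteq> \<Omega>" unfolding \<Omega>_def by auto
  qed
  moreover have "closed \<Omega>"
    unfolding closed_sequential_limits
  proof (intro allI impI)
    fix x l assume x: "(\<forall>n. x n \<in> \<Omega>) \<and> x \<longlonglongrightarrow> l"
    have "(\<lambda>n. A (x n)) \<longlonglongrightarrow> A l"
      using continuous_on_tendsto_compose[OF holomorphic_on_imp_continuous_matrix[OF A_hol], of x l] x by simp
    then show "l \<in> \<Omega>"
      using K0_orbit_sequentially_closed[OF V A_SL] x by (auto simp: \<Omega>_def)
  qed
  ultimately have all: "\<Omega> = UNIV" using 0 clopen[of \<Omega>] by blast
  \<comment> \<open>The limit of \<open>A n\<close> over the natural numbers \<open>n\<close>: every
    column keeps only its leading entry.\<close>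
  define A' where "A' = smat c (frame (\<lambda>k. weight_basis (v k)) :: 'm cmat)"
  have "(\<lambda>n. A (of_nat n)) \<longlonglongrightarrow> A'"
  proof (intro vec_tendstoI)
    fix i j
    have A'_entry: "A' $ i $ j = c * (if i = s j then 1 else 0)"
      by (simp add: A'_def smat_def frame_def wb_comp s_def)
    show "(\<lambda>n. A (of_nat n) $ i $ j) \<longlonglongrightarrow> A' $ i $ j"
    proof (cases "weight (s j) \<le> weight i")
      case True
      then show ?thesis unfolding A_entry A'_entry f_comp[OF True] by auto
    next
      case False
      have "(\<lambda>n. exp (of_real (weight i - weight (s j))) ^ n) \<longlonglongrightarrow> (0 :: complex)"
        using False by (intro LIMSEQ_power_zero) (simp add: norm_exp_eq_Re)
      then have "(\<lambda>n. exp (of_nat n * of_real (weight i - weight (s j)))) \<longlonglongrightarrow> (0 :: complex)"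
        unfolding exp_of_nat_mult .
      then have "(\<lambda>n. c * (exp (of_nat n * of_real (weight i - weight (s j))) * f (idx j) $ i)) \<longlonglongrightarrow> c * (0 * f (idx j) $ i)"
        by (intro tendsto_intros)
      moreover have "i \<noteq> s j" using False by auto
      ultimately show ?thesis unfolding A_entry A'_entry by simp
    qed
  qed
  then have "act A' std_flag \<in> orbit K0 V"
    using K0_orbit_sequentially_closed[OF V A_SL, of "\<lambda>n. of_nat n"] all by (auto simp: \<Omega>_def)
  moreover have "act A' std_flag = flag_of (\<lambda>k. weight_basis (v k))"
    unfolding A'_def flag_of_frame[of "\<lambda>k. weight_basis (v k)"] by (rule act_smat[OF c(1)]) simp
  ultimately show ?thesis using that v by (simp add: n_def)
qed

lemma jmap_e_cases:
  assumes "k \<in> {1..2 * CARD('m)}"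
  obtains l where "l \<in> {1..2 * CARD('m)}" "jmap (e k :: 'm::enum cvec) = e l \<or> jmap (e k :: 'm cvec) = - e l"
proof (cases "k \<le> CARD('m)")
  case True
  then show ?thesis using that[of "CARD('m) + k"] assms jmap_e[where ?'m = 'm, of k] by auto
next
  case False
  define l where "l = k - CARD('m)"
  have l: "l \<in> {1..CARD('m)}" "k = CARD('m) + l" using assms False by (auto simp: l_def)
  have "jmap (e k :: 'm cvec) = jmap (- jmap (e l))" unfolding l(2) by (simp add: jmap_e[OF l(1)])
  also have "\<dots> = e l" by (simp add: jmap_minus)
  finally show ?thesis using that[of l] l(1) by auto
qed

text \<open>If \<open>omega (b k) (b l)\<close> were nonzero for coordinate vectors, then
  \<open>b k\<close> would be j(b l) up to sign. For \<open>k + l \<le> n\<close> this is a nonzero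
  vector in an intersection that opposition declares trivial.\<close>

lemma opposite_coordinate_flag_isotropic:
  fixes v :: "nat \<Rightarrow> nat"
  assumes v: "v permutes {1..2 * CARD('m)}"
    and opp: "flag_of (\<lambda>k. weight_basis (v k)) \<in> (opposite_flags :: 'm::enum flag set)"
  shows "flag_of (\<lambda>k. weight_basis (v k)) \<in> (isotropic_flags :: 'm flag set)"
proof -
  define n where "n = 2 * CARD('m)"
  define b where "b = (\<lambda>k. weight_basis (v k) :: 'm cvec)"
  have F: "flag_of b \<in> flags" using opp by (simp add: opposite_flags_def b_def)
  have "omega (b k) (b l) = 0" if kl: "1 \<le> k" "1 \<le> l" "k + l \<le> n" for k l
  proof (rule ccontr)
    assume nz: "omega (b k) (b l) \<noteq> 0"
    have "k \<in> {1..n}" "l \<in> {1..n}" using kl by auto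
    then have vr: "v k \<in> {1..n}" "v l \<in> {1..n}" using permutes_in_image[OF v] unfolding n_def by blast+
    obtain p where p: "p \<in> {1..n}" "b k = e p"
      using weight_index_range[where ?'m = 'm] vr(1) by (auto simp: b_def weight_basis_def n_def)
    obtain q where q: "q \<in> {1..n}" "b l = e q"
      using weight_index_range[where ?'m = 'm] vr(2) by (auto simp: b_def weight_basis_def n_def)
    obtain t where t: "t \<in> {1..n}" "jmap (b l) = e t \<or> jmap (b l) = - e t"
      using jmap_e_cases[where ?'m = 'm, of q] q by (auto simp: n_def)
    have "p = t"
      using nz t hprod_e[where ?'m = 'm, of p t] p by (auto simp: omega_def n_def split: if_splits)
    then have bk: "b k = jmap (b l) \<or> b k = jmap (- b l)" using t p(2) by (auto simp: jmap_minus)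
    have mem: "b k \<in> flag_of b k" "b l \<in> flag_of b (n - k)"
      using kl by (auto simp: flag_of_def n_def intro!: vec.span_base)
    then have "- b l \<in> flag_of b (n - k)" using subspace_flag_of by (auto intro: vec.subspace_neg)
    then have "b k \<in> flag_of b k \<inter> jmap ` flag_of b (n - k)" using bk mem by auto
    moreover have "flag_of b k \<inter> jmap ` flag_of b (n - k) = {0}"
      using opp kl unfolding opposite_flags_def b_def n_def by auto
    ultimately have "b k = 0" by auto
    then show False using nz by simp
  qed
  then show ?thesis using isotropic_flag_of_iff[OF F] by (simp add: n_def b_def)
qed

lemma base_cycle_eq: "base_cycle = (isotropic_flags :: 'm::enum flag set)"
  unfolding base_cycle_def
proof (rule the_equality)
  show "(\<exists>V\<in>flags. (isotropic_flags :: 'm flag set) = orbit K0 V) \<and> (isotropic_flags :: 'm flag set) \<subseteq> open_orbit \<and>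
      (\<exists>d. complex_submanifold d (isotropic_flags :: 'm flag set))"
    unfolding open_orbit_eq
    using isotropic_eq_orbit base_flag_in_flags isotropic_subset_opposite complex_submanifold_isotropic by blast
next
  fix C :: "'m flag set"
  assume "(\<exists>V\<in>flags. C = orbit K0 V) \<and> C \<subseteq> open_orbit \<and> (\<exists>d. complex_submanifold d C)"
  then obtain V d where C: "V \<in> flags" "C = orbit K0 V" "C \<subseteq> opposite_flags" "complex_submanifold d C"
    unfolding open_orbit_eq by blast
  obtain v where v: "v permutes {1..2 * CARD('m)}" "flag_of (\<lambda>k. weight_basis (v k)) \<in> C"
    using complex_K0_orbit_coordinate_flag[OF C(1)] C(2,4) by blast
  then have "flag_of (\<lambda>k. weight_basis (v k)) \<in> orbit K0 (base_flag :: 'm flag)"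
    using opposite_coordinate_flag_isotropic[OF v(1)] C(3) unfolding isotropic_eq_orbit[symmetric] by blast
  then show "C = isotropic_flags"
    using v(2) K0_orbit_eq unfolding C(2) isotropic_eq_orbit by metis
qed

section \<open>Iwasawa--Schubert cells\<close>

lemma u_e:
  assumes "k \<in> {1..2 * CARD('m)}"
  shows "(u k :: 'm::enum cvec) = (if odd k then e ((k + 1) div 2) else - e (CARD('m) + k div 2))"
proof (cases "odd k")
  case False
  then have "k div 2 \<in> {1..CARD('m)}" using assms by (auto elim: evenE)
  then show ?thesis using False by (simp add: u_def jmap_e)
qed (simp add: u_def)

lemma u_index_eq_iff:
  fixes k l M :: nat
  assumes "1 \<le> k" "k \<le> 2 * M" "1 \<le> l" "l \<le> 2 * M"
  shows "(if odd k then (k + 1) div 2 else M + k div 2) = (if odd l then (l + 1) div 2 else M + l div 2) \<longleftrightarrow> k = l"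
proof (cases "odd k")
  case True
  then obtain a where a: "k = 2 * a + 1" by (rule oddE)
  show ?thesis
  proof (cases "odd l")
    case True
    then obtain b where b: "l = 2 * b + 1" by (rule oddE)
    show ?thesis using assms unfolding a b by auto
  next
    case False
    then obtain b where b: "l = 2 * b" by (auto elim: evenE)
    show ?thesis using assms unfolding a b by (auto, presburger)
  qed
next
  case False
  then obtain a where a: "k = 2 * a" by (auto elim: evenE)
  show ?thesis
  proof (cases "odd l")
    case True
    then obtain b where b: "l = 2 * b + 1" by (rule oddE)
    show ?thesis using assms unfolding a b by (auto, presburger)
  next
    case False
    then obtain b where b: "l = 2 * b" by (auto elim: evenE)
    show ?thesis using assms unfolding a b by auto
  qed
qed

lemma odd_bound: "odd l \<Longrightarrow> l \<le> 2 * M \<Longrightarrow> l + 1 \<le> 2 * M" for l M :: nat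
  by presburger

lemma even_bound: "even l \<Longrightarrow> 1 \<le> l \<Longrightarrow> 1 \<le> l - 1" for l :: nat
  by presburger

lemma u_orthonormal:
  assumes k: "k \<in> {1..2 * CARD('m)}" and l: "l \<in> {1..2 * CARD('m)}"
  shows "hprod (u k) (u l :: 'm::enum cvec) = (if k = l then 1 else 0)"
proof -
  define t where "t = (\<lambda>k. if odd k then (k + 1) div 2 else CARD('m) + k div 2)"
  have t_range: "t x \<in> {1..2 * CARD('m)}" if "x \<in> {1..2 * CARD('m)}" for x
    using that by (auto simp: t_def elim!: oddE evenE)
  have t_inj: "t k = t l \<longleftrightarrow> k = l"
    unfolding t_def by (rule u_index_eq_iff) (use k l in auto)
  have "u x = (if odd x then 1 else -1) *s (e (t x) :: 'm cvec)" if "x \<in> {1..2 * CARD('m)}" for x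
    unfolding u_e[OF that] t_def by (simp add: vec_eq_iff)
  then have "hprod (u k) (u l :: 'm cvec) =
      (if odd k then 1 else -1) * ((if odd l then 1 else -1) * hprod (e (t k)) (e (t l) :: 'm cvec))"
    using k l by (simp add: hprod_scale_left hprod_scale_right)
  then show ?thesis unfolding hprod_e[OF t_range[OF k] t_range[OF l]] t_inj by auto
qed

lemma jmap_u:
  assumes "k \<in> {1..2 * CARD('m)}"
  shows "jmap (u k :: 'm::enum cvec) = (if odd k then u (k + 1) else - u (k - 1))"
  using assms by (auto simp: u_def elim!: oddE evenE)

text \<open>j exchanges \<open>u (2 * i - 1)\<close> and \<open>u (2 * i)\<close> up to sign, so
  \<open>omega\<close> pairs only members of the same class.\<close>

lemma omega_u_nonzero:
  assumes k: "k \<in> {1..2 * CARD('m)}" and l: "l \<in> {1..2 * CARD('m)}"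
    and nz: "omega (u k) (u l :: 'm::enum cvec) \<noteq> 0"
  shows "(k + 1) div 2 = (l + 1) div 2"
proof (cases "odd l")
  case True
  then have l1: "l + 1 \<in> {1..2 * CARD('m)}" using l odd_bound[of l "CARD('m)"] by simp
  have "hprod (u k) (u (l + 1) :: 'm cvec) \<noteq> 0" using nz True by (simp add: omega_def jmap_u[OF l])
  then have "k = l + 1" unfolding u_orthonormal[OF k l1] by (auto split: if_splits)
  then show ?thesis using True by (auto elim!: oddE)
next
  case False
  then have l1: "l - 1 \<in> {1..2 * CARD('m)}" using l even_bound[of l] by auto
  have "hprod (u k) (u (l - 1) :: 'm cvec) \<noteq> 0" using nz False by (simp add: omega_def jmap_u[OF l])
  then have "k = l - 1" unfolding u_orthonormal[OF k l1] by (auto split: if_splits)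
  then show ?thesis using False l by (auto elim!: evenE)
qed

lemma permuted_range: "w permutes {1..n} \<Longrightarrow> k \<in> {1..n} \<Longrightarrow> w k \<in> {1..n :: nat}"
  using permutes_in_image[of w "{1..n}" k] by blast

lemma permuted_inj: "w permutes {1..n} \<Longrightarrow> w k = w l \<longleftrightarrow> k = (l :: nat)"
  using permutes_inj[of w "{1..n}"] by (auto dest: injD)

lemma det_frame_u_perm:
  assumes w: "w permutes {1..2 * CARD('m)}"
  shows "det (frame (\<lambda>k. u (w k) :: 'm::enum cvec)) \<noteq> 0"
proof (rule det_frame_orthonormal)
  fix k l assume "k \<in> {1..2 * CARD('m)}" "l \<in> {1..2 * CARD('m)}"
  then show "hprod (u (w k)) (u (w l) :: 'm cvec) = (if k = l then 1 else 0)"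
    using u_orthonormal[OF permuted_range[OF w] permuted_range[OF w]] permuted_inj[OF w] by simp
qed

lemma det_frame_u: "det (frame (u :: nat \<Rightarrow> 'm::enum cvec)) \<noteq> 0"
  using det_frame_u_perm[OF permutes_id] by simp

lemma perm_flag_in_flags: "w permutes {1..2 * CARD('m)} \<Longrightarrow> (perm_flag w :: 'm::enum flag) \<in> flags"
  unfolding perm_flag_def by (intro flag_of_in_flags det_frame_u_perm)

lemma span_e_eq:
  assumes "A \<subseteq> {1..2 * CARD('m)}"
  shows "vec.span (e ` A) = {x :: 'm::enum cvec. \<forall>i. idx i \<notin> A \<longrightarrow> x $ i = 0}"
proof
  have "vec.subspace {x :: 'm cvec. \<forall>i. idx i \<notin> A \<longrightarrow> x $ i = 0}" by (auto simp: vec.subspace_def)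
  then show "vec.span (e ` A) \<subseteq> {x :: 'm cvec. \<forall>i. idx i \<notin> A \<longrightarrow> x $ i = 0}"
    by (rule vec.span_minimal[rotated]) (use assms in \<open>auto simp: e_component subset_iff\<close>)
  show "{x :: 'm cvec. \<forall>i. idx i \<notin> A \<longrightarrow> x $ i = 0} \<subseteq> vec.span (e ` A)"
  proof
    fix x :: "'m cvec" assume x: "x \<in> {x. \<forall>i. idx i \<notin> A \<longrightarrow> x $ i = 0}"
    have "x = (\<Sum>l\<in>{1..2 * CARD('m)}. x $ coord l *s e l)" by (rule e_expansion)
    also have "\<dots> \<in> vec.span (e ` A)"
    proof (rule vec.span_sum)
      fix l assume l: "l \<in> {1..2 * CARD('m)}"
      show "x $ coord l *s (e l :: 'm cvec) \<in> vec.span (e ` A)"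
      proof (cases "l \<in> A")
        case True
        then show ?thesis by (intro vec.span_scale vec.span_base) auto
      next
        case False
        then have "x $ coord l = 0" using x l by simp
        then show ?thesis by (simp add: vec.span_zero)
      qed
    qed
    finally show "x \<in> vec.span (e ` A)" .
  qed
qed

lemma span_u_eq:
  assumes "A \<subseteq> {1..2 * CARD('m)}"
  shows "vec.span (u ` A) = (*v) (frame u) ` {x :: 'm::enum cvec. \<forall>i. idx i \<notin> A \<longrightarrow> x $ i = 0}"
proof -
  have "u ` A = (*v) (frame u) ` (e ` A :: 'm cvec set)"
    unfolding image_image using assms by (intro image_cong refl) (auto simp: frame_e)
  then show ?thesis unfolding span_e_eq[OF assms, symmetric] by (simp add: vec.span_image)
qed

lemma perm_flag_eq_span:
  assumes "k \<le> 2 * CARD('m)"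
  shows "(perm_flag w :: 'm::enum flag) k = vec.span (u ` w ` {1..k})"
  using assms by (simp add: perm_flag_def flag_of_def image_image min_def)

lemma dim_perm_flag_Int:
  assumes w: "w permutes {1..2 * CARD('m)}" and k: "k \<le> 2 * CARD('m)" and j: "j \<le> 2 * CARD('m)"
  shows "vec.dim ((perm_flag w :: 'm::enum flag) k \<inter> flag_of u j) = prefix_count w k j"
proof -
  have sub: "w ` {1..k} \<subseteq> {1..2 * CARD('m)}" "{1..j} \<subseteq> {1..2 * CARD('m)}"
    using permuted_range[OF w] k j by auto
  let ?A = "{i :: 'm + 'm. idx i \<in> w ` {1..k} \<and> idx i \<le> j}"
  have "(perm_flag w :: 'm flag) k \<inter> flag_of u j =
      (*v) (frame u) ` ({x. \<forall>i. idx i \<notin> w ` {1..k} \<longrightarrow> x $ i = 0} \<inter> {x. \<forall>i. idx i \<notin> {1..j} \<longrightarrow> x $ i = 0})"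
    unfolding perm_flag_eq_span[OF k] span_u_eq[OF sub(1)] image_Int[OF inj_matrix[OF det_frame_u]]
      flag_of_def min_absorb1[OF j] span_u_eq[OF sub(2)] ..
  also have "{x :: 'm cvec. \<forall>i. idx i \<notin> w ` {1..k} \<longrightarrow> x $ i = 0} \<inter> {x. \<forall>i. idx i \<notin> {1..j} \<longrightarrow> x $ i = 0} =
      {x. \<forall>i. i \<notin> ?A \<longrightarrow> x $ i = 0}"
    by auto
  finally have "vec.dim ((perm_flag w :: 'm flag) k \<inter> flag_of u j) = card ?A"
    by (simp only: dim_image_matrix[OF det_frame_u] dim_substandard_cart)
  also have "\<dots> = card {p \<in> {1..k}. w p \<le> j}"
  proof (rule bij_betw_same_card[symmetric])
    show "bij_betw (\<lambda>p. coord (w p) :: 'm + 'm) {p \<in> {1..k}. w p \<le> j} ?A"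
    proof (rule bij_betw_imageI)
      show "inj_on (\<lambda>p. coord (w p) :: 'm + 'm) {p \<in> {1..k}. w p \<le> j}"
      proof (rule inj_onI)
        fix p q assume "p \<in> {p \<in> {1..k}. w p \<le> j}" "q \<in> {p \<in> {1..k}. w p \<le> j}"
          "coord (w p) = (coord (w q) :: 'm + 'm)"
        then have "w p = w q" using sub by (metis (no_types, lifting) idx_coord image_subset_iff mem_Collect_eq)
        then show "p = q" by (simp add: permuted_inj[OF w])
      qed
      show "(\<lambda>p. coord (w p) :: 'm + 'm) ` {p \<in> {1..k}. w p \<le> j} = ?A"
      proof
        show "(\<lambda>p. coord (w p) :: 'm + 'm) ` {p \<in> {1..k}. w p \<le> j} \<subseteq> ?A"
        proof clarify
          fix p assume p: "p \<in> {1..k}" "w p \<le> j"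
          then have "w p \<in> {1..2 * CARD('m)}" using sub by blast
          then have "idx (coord (w p) :: 'm + 'm) = w p" by (rule idx_coord)
          then show "idx (coord (w p) :: 'm + 'm) \<in> w ` {1..k} \<and> idx (coord (w p) :: 'm + 'm) \<le> j" using p by auto
        qed
        show "?A \<subseteq> (\<lambda>p. coord (w p) :: 'm + 'm) ` {p \<in> {1..k}. w p \<le> j}"
        proof
          fix i assume i: "i \<in> ?A"
          then obtain p where p: "p \<in> {1..k}" "idx i = w p" by auto
          then have "i = coord (w p)" by (metis coord_idx)
          then show "i \<in> (\<lambda>p. coord (w p) :: 'm + 'm) ` {p \<in> {1..k}. w p \<le> j}" using i p by auto
        qed
      qed
    qed
  qed
  finally show ?thesis by (simp add: prefix_count_def)
qed

section \<open>Cells of the Iwasawa-Borel group and their rank numbers\<close>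

lemma borel_det_nz: "g \<in> iwasawa_borel \<Longrightarrow> det g \<noteq> 0"
  by (simp add: iwasawa_borel_def SL_def)

lemma borel_mult: "g \<in> iwasawa_borel \<Longrightarrow> h \<in> iwasawa_borel \<Longrightarrow> g ** h \<in> iwasawa_borel"
  by (simp add: iwasawa_borel_def SL_mult act_mult)

lemma borel_inverse:
  assumes "g \<in> iwasawa_borel"
  obtains h where "h \<in> iwasawa_borel" "h ** g = mat 1"
proof -
  obtain h where h: "h \<in> SL" "g ** h = mat 1" "h ** g = mat 1"
    using assms SL_inverse by (auto simp: iwasawa_borel_def)
  have "act h (flag_of u) = act (h ** g) (flag_of u)"
    using assms by (simp add: act_mult iwasawa_borel_def)
  then have "h \<in> iwasawa_borel" using h by (simp add: iwasawa_borel_def)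
  then show ?thesis using that h by blast
qed

text \<open>The group fixes every member of \<open>flag_of u\<close>, so the rank numbers are
  constant on a cell.\<close>

lemma dim_cell_Int:
  assumes w: "w permutes {1..2 * CARD('m)}" and V: "(V :: 'm::enum flag) \<in> orbit iwasawa_borel (perm_flag w)"
    and "k \<le> 2 * CARD('m)" "j \<le> 2 * CARD('m)"
  shows "vec.dim (V k \<inter> flag_of u j) = prefix_count w k j"
proof -
  obtain g where g: "g \<in> iwasawa_borel" "V = act g (perm_flag w)" using V by (auto simp: orbit_def)
  have "flag_of u j = (*v) g ` flag_of u j" using g(1) by (metis (mono_tags, lifting) act_def iwasawa_borel_def mem_Collect_eq)
  then have "V k \<inter> flag_of u j = (*v) g ` (perm_flag w k \<inter> flag_of u j)"
    unfolding g(2) act_def image_Int[OF inj_matrix[OF borel_det_nz[OF g(1)]]] by simp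
  then show ?thesis
    using dim_perm_flag_Int[OF w assms(3,4)] by (simp add: dim_image_matrix[OF borel_det_nz[OF g(1)]])
qed

text \<open>The linear map sending \<open>u (w k)\<close> to \<open>f k\<close> is unitriangular in
  the ordered basis \<open>u\<close>. It therefore preserves \<open>flag_of u\<close> and, after
  scaling, belongs to \<open>iwasawa_borel\<close>.\<close>

lemma cellI:
  fixes f :: "nat \<Rightarrow> 'm::enum cvec"
  assumes w: "w permutes {1..2 * CARD('m)}" and F: "flag_of f \<in> flags"
    and f: "\<And>k. k \<in> {1..2 * CARD('m)} \<Longrightarrow> f k - u (w k) \<in> vec.span (u ` {1..<w k})"
  shows "flag_of f \<in> orbit iwasawa_borel (perm_flag w)"
proof -
  let ?P = "frame (\<lambda>k. u (w k)) :: 'm cmat"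
  obtain R where R: "?P ** R = mat 1" "R ** ?P = mat 1" "det R = 1 / det ?P"
    by (rule inverse_matrix[OF det_frame_u_perm[OF w]])
  define g where "g = frame f ** R"
  have det_g: "det g \<noteq> 0"
    unfolding g_def using flag_of_det[OF F] R(3) det_frame_u_perm[OF w] by (simp add: det_mul)
  have g_u: "g *v u (w k) = f k" if k: "k \<in> {1..2 * CARD('m)}" for k
  proof -
    have "g *v u (w k) = frame f *v (R *v (?P *v e k))"
      unfolding g_def by (simp add: frame_e[OF k] matrix_vector_mul_assoc)
    also have "R *v (?P *v e k) = e k" by (simp add: matrix_vector_mul_assoc R(2))
    finally show ?thesis by (simp add: frame_e[OF k])
  qed
  have g_flag: "act g (perm_flag w) = flag_of f"
    unfolding perm_flag_def act_flag_of by (rule flag_of_cong) (rule g_u)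
  have "act g (flag_of u) = flag_of u"
  proof
    fix j
    have "(*v) g ` flag_of u j \<subseteq> flag_of u j"
    proof -
      have "g *v u a \<in> flag_of u j" if a: "a \<in> {1..min j (2 * CARD('m))}" for a
      proof -
        have "a \<in> {1..2 * CARD('m)}" using a by simp
        then have "a \<in> w ` {1..2 * CARD('m)}" by (simp only: permutes_image[OF w])
        then obtain k where k: "k \<in> {1..2 * CARD('m)}" "a = w k" by auto
        have "vec.span (u ` {1..<w k}) \<subseteq> (flag_of u j :: 'm cvec set)"
          unfolding flag_of_def using a k(2) by (intro vec.span_mono) auto
        then have "f k - u (w k) \<in> flag_of u j" using f[OF k(1)] by blast
        moreover have "u (w k) \<in> (flag_of u j :: 'm cvec set)"
          unfolding flag_of_def using a k(2) by (intro vec.span_base) auto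
        ultimately have "(f k - u (w k)) + u (w k) \<in> flag_of u j" by (rule vec.subspace_add[OF subspace_flag_of])
        then show ?thesis using g_u[OF k(1)] k(2) by simp
      qed
      then have "(*v) g ` u ` {1..min j (2 * CARD('m))} \<subseteq> flag_of u j" by auto
      then have "vec.span ((*v) g ` u ` {1..min j (2 * CARD('m))}) \<subseteq> flag_of u j"
        by (rule vec.span_minimal[OF _ subspace_flag_of])
      then show ?thesis unfolding vec.span_image by (simp add: flag_of_def)
    qed
    then show "act g (flag_of u) j = flag_of u j"
      unfolding act_def by (rule vec.subspace_dim_equal[rotated 2])
        (auto simp: vec.subspace_image subspace_flag_of dim_image_matrix[OF det_g])
  qed
  moreover obtain c where c: "c \<noteq> 0" "smat c g \<in> SL" by (rule scale_to_SL[OF det_g])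
  have "act (smat c g) W = act g W" if "\<And>k. vec.subspace (W k)" for W
    using that by (rule act_smat[OF c(1)])
  then have scaled: "act (smat c g) (flag_of b) = act g (flag_of b)" for b using subspace_flag_of by blast
  ultimately have "smat c g \<in> iwasawa_borel" using c by (simp add: iwasawa_borel_def)
  moreover have "act (smat c g) (perm_flag w) = flag_of f"
    using scaled g_flag by (simp add: perm_flag_def)
  ultimately show ?thesis unfolding orbit_def by (metis image_eqI)
qed

lemma flags_covered_by_cells:
  assumes "V \<in> (flags :: 'm::enum flag set)"
  obtains w where "w permutes {1..2 * CARD('m)}" "V \<in> orbit iwasawa_borel (perm_flag w)"
proof -
  obtain w f where wf: "w permutes {1..2 * CARD('m)}" "V = flag_of f"
    "\<And>k. k \<in> {1..2 * CARD('m)} \<Longrightarrow> f k - u (w k) \<in> vec.span (u ` {1..<w k})"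
    by (rule flag_adapted_basis[OF assms span_frame[OF det_frame_u]]) (rule that)
  then show ?thesis using that[OF wf(1)] cellI[OF wf(1) _ wf(3)] assms by blast
qed

text \<open>Some cell contains \<open>V\<close>, and its permutation has the given rank numbers;
  these determine it by \<open>prefix_count_inject\<close>.\<close>

lemma cell_of_dims:
  assumes w: "w permutes {1..2 * CARD('m)}" and V: "V \<in> (flags :: 'm::enum flag set)"
    and dims: "\<And>k j. k \<le> 2 * CARD('m) \<Longrightarrow> j \<le> 2 * CARD('m) \<Longrightarrow> vec.dim (V k \<inter> flag_of u j) = prefix_count w k j"
  shows "V \<in> orbit iwasawa_borel (perm_flag w)"
proof -
  obtain v where v: "v permutes {1..2 * CARD('m)}" "V \<in> orbit iwasawa_borel (perm_flag v)"
    by (rule flags_covered_by_cells[OF V])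
  have "prefix_count v k j = prefix_count w k j" if k: "k \<le> 2 * CARD('m)" for k j
  proof (cases "j \<le> 2 * CARD('m)")
    case True
    then show ?thesis using dim_cell_Int[OF v k True] dims[OF k True] by simp
  next
    case False
    have "prefix_count x k j = k" if "x permutes {1..2 * CARD('m)}" for x
    proof -
      have "x i \<le> j" if "i \<in> {1..k}" for i
        using permuted_range[OF \<open>x permutes _\<close>, of i] that k False by auto
      then have "{i \<in> {1..k}. x i \<le> j} = {1..k}" by auto
      then show ?thesis by (simp add: prefix_count_def)
    qed
    then show ?thesis using v(1) w by simp
  qed
  then have "\<forall>i\<in>{1..2 * CARD('m)}. v i = w i" by (rule prefix_count_inject)
  then have "v = w" using v(1) w by (metis ext permutes_not_in)
  then show ?thesis using v(2) by simp
qed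

section \<open>Schubert cells as complex submanifolds\<close>

text \<open>The free coordinates of the cell are the inverted pairs. One direction is
  \<open>cellI\<close>, as only smaller vectors of \<open>u\<close> are added to
  \<open>u (w k)\<close>. For the other, the vectors \<open>g *v u (w k)\<close> give combinations
  of the columns of \<open>unip X\<close> without components beyond \<open>w k\<close>, and the
  zeros of \<open>X\<close> are extracted column by column.\<close>

lemma cell_flag_param_iff:
  fixes w :: "nat \<Rightarrow> nat" and X :: "'m::enum coords"
  assumes w: "w permutes {1..2 * CARD('m)}" and X: "X \<in> strictly_lower"
  shows "act (frame (\<lambda>k. u (w k)) ** unip X) std_flag \<in> orbit iwasawa_borel (perm_flag w) \<longleftrightarrow>
    (\<forall>i j. idx j < idx i \<longrightarrow> w (idx j) < w (idx i) \<longrightarrow> X $ (i, j) = 0)"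
proof
  let ?P = "frame (\<lambda>k. u (w k)) :: 'm cmat"
  let ?V = "act (?P ** unip X) std_flag"
  have det: "det (?P ** unip X) \<noteq> 0" using det_frame_u_perm[OF w] by (simp add: det_mul)
  then have V_flags: "?V \<in> flags" by (intro act_in_flags std_flag_in_flags)
  have w_idx: "w (idx i) \<in> {1..2 * CARD('m)}" for i :: "'m + 'm" by (rule permuted_range[OF w idx_range])
  have inj: "inj ((*v) ?P)" by (rule inj_matrix[OF det_frame_u_perm[OF w]])
  {
    assume R: "\<forall>i j. idx j < idx i \<longrightarrow> w (idx j) < w (idx i) \<longrightarrow> X $ (i, j) = 0"
    define f where "f = (\<lambda>k. ?P *v (unip X *v e k))"
    have V: "?V = flag_of f" by (simp add: act_flag_of f_def matrix_vector_mul_assoc)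
    have "f k - u (w k) \<in> vec.span (u ` {1..<w k})" if k: "k \<in> {1..2 * CARD('m)}" for k
    proof -
      have "f k - u (w k) = ?P *v (unip X *v e k - e k)"
        by (simp add: f_def matrix_vector_mult_diff_distrib frame_e[OF k])
      also have "\<dots> = (\<Sum>l\<in>{1..2 * CARD('m)}. (unip X *v e k - e k) $ coord l *s u (w l))"
        by (rule frame_expansion)
      also have "\<dots> \<in> vec.span (u ` {1..<w k})"
      proof (rule vec.span_sum)
        fix l assume l: "l \<in> {1..2 * CARD('m)}"
        have comp: "(unip X *v e k - e k) $ coord l = (if k < l then X $ (coord l, coord k) else 0)"
        proof -
          have "coord l = (coord k :: 'm + 'm) \<longleftrightarrow> l = k" using k l by (metis idx_coord)
          then show ?thesis using k l by (auto simp: matrix_vector_e unip_def e_component)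
        qed
        show "(unip X *v e k - e k) $ coord l *s (u (w l) :: 'm cvec) \<in> vec.span (u ` {1..<w k})"
        proof (cases "k < l \<and> w l < w k")
          case True
          then show ?thesis using permuted_range[OF w l] by (intro vec.span_scale vec.span_base) auto
        next
          case False
          have "X $ (coord l, coord k) = 0" if "k < l"
          proof -
            have "w l \<noteq> w k" using that permuted_inj[OF w, of l k] by simp
            then have "w k < w l" using False that by simp
            then show ?thesis using R[rule_format, of "coord k" "coord l"] that k l by simp
          qed
          then show ?thesis unfolding comp by (auto simp: vec.span_zero)
        qed
      qed
      finally show ?thesis .
    qed
    then show "?V \<in> orbit iwasawa_borel (perm_flag w)"
      using cellI[OF w, of f] V_flags unfolding V by blast
  }
  assume "?V \<in> orbit iwasawa_borel (perm_flag w)"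
  then obtain g where g: "g \<in> iwasawa_borel" "?V = act g (perm_flag w)" by (auto simp: orbit_def)
  have V_k: "?V k = (*v) ?P ` (*v) (unip X) ` std_flag k" for k by (simp add: act_def image_image matrix_vector_mul_assoc)
  \<comment> \<open>Permuting the columns of \<open>frame u\<close> by \<open>w\<close> only
    relabels coordinates, so membership in a member of \<open>flag_of u\<close> is read off from the
    values \<open>w (idx i)\<close>.\<close>
  have mem_U: "\<forall>i. a < w (idx i) \<longrightarrow> y $ i = 0" if y: "?P *v y \<in> flag_of u a" "a \<le> 2 * CARD('m)" for a y
  proof -
    have "{1..a} \<subseteq> {1..2 * CARD('m)}" using y(2) by auto
    from span_u_eq[OF this] obtain x where x: "?P *v y = frame u *v x" "\<And>i :: 'm + 'm. idx i \<notin> {1..a} \<Longrightarrow> x $ i = 0"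
      using y by (auto simp: flag_of_def min_def)
    define y' :: "'m cvec" where "y' = (\<chi> i. x $ coord (w (idx i)))"
    have "?P *v y' = (\<Sum>k\<in>{1..2 * CARD('m)}. x $ coord (w k) *s u (w k))"
      unfolding frame_expansion by (rule sum.cong) (auto simp: y'_def)
    also have "\<dots> = (\<Sum>k\<in>{1..2 * CARD('m)}. x $ coord k *s u k)"
      by (rule sum.permute[OF w, of "\<lambda>k. x $ coord k *s u k", unfolded o_def, symmetric])
    also have "\<dots> = frame u *v x" by (rule frame_expansion[symmetric])
    also have "\<dots> = ?P *v y" by (rule x(1)[symmetric])
    finally have "y' = y" by (rule injD[OF inj])
    then show ?thesis using x(2) idx_coord[OF w_idx] by (auto simp: y'_def)
  qed
  \<comment> \<open>The vector \<open>g *v u (w k)\<close> lies in the \<open>k\<close>-th member of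
    the flag but not in the preceding one, so its coefficient at \<open>k\<close> is nonzero; it
    also lies in the member \<open>w k\<close> of \<open>flag_of u\<close>.\<close>
  have "\<exists>c. c \<in> std_flag k \<and> c $ coord k \<noteq> 0 \<and> (\<forall>i. w k < w (idx i) \<longrightarrow> (unip X *v c) $ i = 0)"
    if k: "k \<in> {1..2 * CARD('m)}" for k
  proof -
    let ?g = "g *v u (w k)"
    have "u (w k) \<in> (perm_flag w :: 'm flag) k"
      using k by (auto simp: perm_flag_def flag_of_def intro!: vec.span_base)
    then have "?g \<in> ?V k" unfolding g(2) by (auto simp: act_def)
    then obtain c where c: "c \<in> std_flag k" "?g = ?P *v (unip X *v c)" unfolding V_k by auto
    have "c $ coord k \<noteq> 0"
    proof
      assume c0: "c $ coord k = 0"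
      have "c \<in> std_flag (k - 1)"
        unfolding std_flag_iff
      proof (intro allI impI)
        fix i :: "'m + 'm" assume "k - 1 < idx i"
        then consider "idx i = k" | "k < idx i" by linarith
        then show "c $ i = 0" using c0 c(1) by cases (auto simp: std_flag_iff)
      qed
      then have "?g \<in> ?V (k - 1)" unfolding V_k c(2) by blast
      then obtain x where x: "?g = g *v x" "x \<in> perm_flag w (k - 1)" unfolding g(2) by (auto simp: act_def)
      have "u (w k) = x" by (rule injD[OF inj_matrix[OF borel_det_nz[OF g(1)]] x(1)])
      have "frame u *v e (w k) \<in> (*v) (frame u) ` {x :: 'm cvec. \<forall>i. idx i \<notin> w ` {1..k - 1} \<longrightarrow> x $ i = 0}"
      proof -
        have "w ` {1..k - 1} \<subseteq> {1..2 * CARD('m)}"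
          by (intro image_subsetI permuted_range[OF w]) (use k in auto)
        note span = span_u_eq[OF this]
        have "k - 1 \<le> 2 * CARD('m)" using k by auto
        then have "(u (w k) :: 'm cvec) \<in> vec.span (u ` w ` {1..k - 1})"
          using x(2) \<open>u (w k) = x\<close> by (simp only: perm_flag_eq_span)
        then show ?thesis unfolding span frame_e[OF permuted_range[OF w k]] .
      qed
      then have "e (w k) \<in> {x :: 'm cvec. \<forall>i. idx i \<notin> w ` {1..k - 1} \<longrightarrow> x $ i = 0}"
        unfolding inj_image_mem_iff[OF inj_matrix[OF det_frame_u]] .
      moreover have "w k \<notin> w ` {1..k - 1}" using k by (auto simp: permuted_inj[OF w])
      ultimately have "e (w k) $ (coord (w k) :: 'm + 'm) = 0" using idx_coord[OF permuted_range[OF w k]] by auto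
      then show False by (simp add: e_def)
    qed
    moreover have "?P *v (unip X *v c) \<in> flag_of u (w k)"
    proof -
      have "u (w k) \<in> (flag_of u (w k) :: 'm cvec set)"
        using permuted_range[OF w k] by (auto simp: flag_of_def intro!: vec.span_base)
      then have "?g \<in> act g (flag_of u) (w k)" by (auto simp: act_def)
      then show ?thesis using g(1) c(2) by (simp add: iwasawa_borel_def)
    qed
    ultimately show ?thesis using mem_U[of "unip X *v c" "w k"] c(1) permuted_range[OF w k] by auto
  qed
  then obtain c where c: "\<And>k. k \<in> {1..2 * CARD('m)} \<Longrightarrow> c k \<in> std_flag k \<and> c k $ coord k \<noteq> 0 \<and>
      (\<forall>i. w k < w (idx i) \<longrightarrow> (unip X *v c k) $ i = 0)" by metis
  have main: "X $ (i, j) = 0" if "idx j < idx i" "w (idx j) < w (idx i)" for i j :: "'m + 'm"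
    using that
  proof (induction "idx j" arbitrary: i j rule: less_induct)
    case less
    note IH = less.hyps
    define b where "b = c (idx j)"
    have b: "\<And>i :: 'm + 'm. idx j < idx i \<Longrightarrow> b $ i = 0" "b $ j \<noteq> 0"
      "\<And>i. w (idx j) < w (idx i) \<Longrightarrow> (unip X *v b) $ i = 0"
      using c[OF idx_range[of j]] by (auto simp: b_def std_flag_iff)
    \<comment> \<open>A second induction, from large values of \<open>w\<close> downwards. Earlier
      columns contribute through entries of \<open>X\<close> that the outer induction has shown to
      be zero, or through coefficients with larger \<open>w\<close>, already known to
      vanish.\<close>
    have low_zero: "b $ i' = 0" if "idx i' < idx j" "w (idx j) < w (idx i')" for i' :: "'m + 'm"
      using that
    proof (induction "2 * CARD('m) - w (idx i')" arbitrary: i' rule: less_induct)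
      case (less i')
      have "0 = (unip X *v b) $ i'" using b(3) less.prems by simp
      also have "\<dots> = b $ i' + (\<Sum>j'\<in>{j'. idx j' < idx i'}. X $ (i', j') * b $ j')" by (rule unip_vector)
      also have "(\<Sum>j'\<in>{j'. idx j' < idx i'}. X $ (i', j') * b $ j') = 0"
      proof (rule sum.neutral, intro ballI)
        fix j' :: "'m + 'm" assume j': "j' \<in> {j'. idx j' < idx i'}"
        show "X $ (i', j') * b $ j' = 0"
        proof (cases "w (idx j') < w (idx i')")
          case True
          then have "X $ (i', j') = 0"
            using j' less.prems by (intro IH) auto
          then show ?thesis by simp
        next
          case False
          moreover have "w (idx j') \<noteq> w (idx i')" using j' permuted_inj[OF w, of "idx j'" "idx i'"] by auto
          ultimately have gt: "w (idx i') < w (idx j')" by simp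
          have "2 * CARD('m) - w (idx j') < 2 * CARD('m) - w (idx i')"
            using gt w_idx[of j'] by auto
          then have "b $ j' = 0" using gt j' less.prems by (intro less.hyps) auto
          then show ?thesis by simp
        qed
      qed
      finally show ?case by simp
    qed
    have "0 = (unip X *v b) $ i" using b(3) less.prems by simp
    also have "\<dots> = b $ i + (\<Sum>j'\<in>{j'. idx j' < idx i}. X $ (i, j') * b $ j')" by (rule unip_vector)
    also have "b $ i = 0" using b(1) less.prems by simp
    \<comment> \<open>All terms but the one at \<open>j\<close> vanish: later coefficients since
      \<open>b\<close> lies in a standard member, earlier ones by \<open>low_zero\<close> or by the
      outer induction.\<close>
    also have "(\<Sum>j'\<in>{j'. idx j' < idx i}. X $ (i, j') * b $ j') = (\<Sum>j'\<in>{j}. X $ (i, j') * b $ j')"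
    proof (rule sum.mono_neutral_right)
      show "\<forall>j'\<in>{j'. idx j' < idx i} - {j}. X $ (i, j') * b $ j' = 0"
      proof
        fix j' :: "'m + 'm" assume j': "j' \<in> {j'. idx j' < idx i} - {j}"
        then have "idx j' \<noteq> idx j" by simp
        then consider "idx j < idx j'" | "idx j' < idx j" "w (idx j) < w (idx j')" | "idx j' < idx j" "w (idx j') < w (idx j)"
          using permuted_inj[OF w, of "idx j'" "idx j"] by linarith
        then show "X $ (i, j') * b $ j' = 0"
        proof cases
          case 1
          then show ?thesis using b(1) by simp
        next
          case 2
          then show ?thesis using low_zero by simp
        next
          case 3
          then have "X $ (i, j') = 0" using less.prems by (intro less.hyps) auto
          then show ?thesis by simp
        qed
      qed
    qed (use less.prems in auto)
    finally show ?case using b(2) by simp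
  qed
  then show "\<forall>i j. idx j < idx i \<longrightarrow> w (idx j) < w (idx i) \<longrightarrow> X $ (i, j) = 0" by blast
qed

lemma complex_submanifold_cell:
  assumes w: "w permutes {1..2 * CARD('m)}"
  shows "complex_submanifold (card (inversions (2 * CARD('m)) w)) (orbit iwasawa_borel (perm_flag w) :: 'm::enum flag set)"
proof -
  let ?P = "frame (\<lambda>k. u (w k)) :: 'm cmat"
  let ?S = "orbit iwasawa_borel (perm_flag w) :: 'm flag set"
  obtain c where c: "c \<noteq> 0" "smat c ?P \<in> SL" by (rule scale_to_SL[OF det_frame_u_perm[OF w]])
  have scaled: "act (smat c ?P) (act B std_flag) = act ?P (act B std_flag)" for B
    by (rule act_smat[OF c(1)]) (simp add: act_def vec.subspace_image)
  define G where "G = {p :: ('m + 'm) \<times> ('m + 'm). idx (snd p) < idx (fst p) \<and> w (idx (fst p)) < w (idx (snd p))}"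
  have set_eq: "{X \<in> strictly_lower. flag_param (smat c ?P) X \<in> ?S} = {X. \<forall>p. p \<notin> G \<longrightarrow> X $ p = 0}"
  proof -
    have "X \<in> strictly_lower \<and> flag_param (smat c ?P) X \<in> ?S \<longleftrightarrow> (\<forall>p. p \<notin> G \<longrightarrow> X $ p = 0)" for X
    proof (cases "X \<in> strictly_lower")
      case True
      have "flag_param (smat c ?P) X \<in> ?S \<longleftrightarrow> (\<forall>i j. idx j < idx i \<longrightarrow> w (idx j) < w (idx i) \<longrightarrow> X $ (i, j) = 0)"
        unfolding cell_flag_param_iff[OF w True, symmetric] flag_param_eq act_mult scaled ..
      also have "\<dots> \<longleftrightarrow> (\<forall>i j. (i, j) \<notin> G \<longrightarrow> X $ (i, j) = 0)"
      proof -
        have "(i, j) \<notin> G \<longleftrightarrow> idx i \<le> idx j \<or> (idx j < idx i \<and> w (idx j) < w (idx i))" for i j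
          using permuted_inj[OF w, of "idx i" "idx j"] unfolding G_def by (auto simp: not_less le_less)
        then show ?thesis using True by (auto simp: strictly_lower_iff)
      qed
      finally show ?thesis using True by auto
    next
      case False
      then obtain i j where "idx i \<le> idx j" "X $ (i, j) \<noteq> 0" by (auto simp: strictly_lower_iff)
      moreover from this(1) have "(i, j) \<notin> G" by (simp add: G_def)
      ultimately show ?thesis using False by blast
    qed
    then show ?thesis by blast
  qed
  have "bij_betw (\<lambda>(i, j). (idx j, idx i)) G (inversions (2 * CARD('m)) w)"
  proof (rule bij_betw_byWitness[where f' = "\<lambda>(p, q). (coord q, coord p)"])
    show "(\<lambda>(i, j). (idx j, idx i)) ` G \<subseteq> inversions (2 * CARD('m)) w"
      by (auto simp: G_def inversions_def)
    show "(\<lambda>(p, q). (coord q, coord p)) ` inversions (2 * CARD('m)) w \<subseteq> G"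
      by (auto simp: G_def inversions_def)
  qed (auto simp: inversions_def)
  then have card_G: "card G = card (inversions (2 * CARD('m)) w)" by (rule bij_betw_same_card)
  show ?thesis
  proof (rule complex_submanifold_orbit[of iwasawa_borel _ "smat c ?P"])
    show "iwasawa_borel \<subseteq> (SL :: 'm cmat set)" by (auto simp: iwasawa_borel_def)
    show "act h W \<in> ?S \<longleftrightarrow> W \<in> ?S" if h: "h \<in> iwasawa_borel" for h and W :: "'m flag"
    proof
      obtain h' where h': "h' \<in> iwasawa_borel" "h' ** h = mat 1" by (rule borel_inverse[OF h])
      assume "act h W \<in> ?S"
      then obtain g where g: "g \<in> iwasawa_borel" "act h W = act g (perm_flag w)" by (auto simp: orbit_def)
      have "W = act (h' ** h) W" unfolding h'(2) by simp
      also have "\<dots> = act (h' ** g) (perm_flag w)" by (simp only: act_mult g(2))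
      finally show "W \<in> ?S" using borel_mult[OF h'(1) g(1)] by (auto simp: orbit_def)
    next
      show "W \<in> ?S \<Longrightarrow> act h W \<in> ?S" using h by (auto simp: orbit_def borel_mult simp flip: act_mult)
    qed
    show "?S = orbit iwasawa_borel (act (smat c ?P) std_flag)"
      using scaled[of "mat 1"] by (simp add: perm_flag_def flag_of_frame[of "\<lambda>k. u (w k)"])
    show "straight_at (card (inversions (2 * CARD('m)) w)) {X \<in> strictly_lower. flag_param (smat c ?P) X \<in> ?S} 0"
      unfolding set_eq card_G[symmetric] using straight_at_subspace[OF coord_subspace[of G]]
      by (simp only: dim_substandard_cart)
  qed (rule c)
qed

section \<open>Semicontinuity and the dimension of Schubert varieties\<close>

lemma exists_complement:
  fixes W :: "(complex ^ 'k::finite) set"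
  assumes "vec.subspace W"
  obtains T where "vec.subspace T" "vec.dim W + vec.dim T = CARD('k)" "\<And>z. \<exists>x\<in>W. \<exists>t\<in>T. z = x + t"
proof -
  obtain B where B: "B \<subseteq> W" "vec.independent B" "W \<subseteq> vec.span B" "card B = vec.dim W"
    by (rule vec.basis_exists[of W]) auto
  obtain B' where B': "B \<subseteq> B'" "vec.independent B'" "UNIV \<subseteq> vec.span B'"
    by (rule vec.maximal_independent_subset_extend[OF subset_UNIV B(2)]) auto
  have fin: "finite B'" by (rule vec.finiteI_independent[OF B'(2)])
  have cardB': "card B' = CARD('k)"
    using vec.dim_eq_card[of B' UNIV] B' by (simp add: card_cart_basis vec.span_UNIV top.extremum_unique)
  show ?thesis
  proof
    show "vec.subspace (vec.span (B' - B))" by simp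
    have "vec.dim (vec.span (B' - B)) = card (B' - B)"
      unfolding vec.dim_span by (rule vec.dim_eq_card_independent) (rule vec.independent_mono[OF B'(2)], auto)
    then show "vec.dim W + vec.dim (vec.span (B' - B)) = CARD('k)"
      using B(4) cardB' B'(1) fin card_mono[OF fin B'(1)] by (simp add: card_Diff_subset finite_subset)
    fix z
    have "B' = B \<union> (B' - B)" using B'(1) by auto
    then have "z \<in> vec.span (B \<union> (B' - B))" using B'(3) by auto
    then obtain x t where "x \<in> vec.span B" "t \<in> vec.span (B' - B)" "z = x + t"
      unfolding vec.span_Un by auto
    moreover have "vec.span B \<subseteq> W" by (rule vec.span_minimal[OF B(1) assms])
    ultimately show "\<exists>x\<in>W. \<exists>t\<in>vec.span (B' - B). z = x + t" by blast
  qed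
qed

text \<open>A bound on the intersection from above is a bound on \<open>V k + U\<close> from below.
  Fix a complement \<open>T\<close> of this sum at \<open>g\<close> and write the standard basis in
  \<open>V k + U + T\<close>; the same coefficients still span as long as a determinant is nonzero,
  so the dimension of the sum cannot drop nearby.\<close>

lemma openin_dim_Int_le:
  fixes U :: "'m::enum cvec set"
  assumes U: "vec.subspace U" and k: "k \<le> 2 * CARD('m)"
  shows "openin flag_topology {V \<in> flags. vec.dim (V k \<inter> U) \<le> s}"
proof (rule openin_flag_topologyI)
  fix g :: "'m cmat" assume g: "g \<in> SL" "act g std_flag \<in> {V \<in> flags. vec.dim (V k \<inter> U) \<le> s}"
  define S where "S = (\<lambda>h. {x + y |x y. x \<in> act h std_flag k \<and> y \<in> U})"
  have sub: "vec.subspace (act h std_flag k)" for h :: "'m cmat" by (simp add: act_def vec.subspace_image)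
  have subS: "vec.subspace (S h)" for h unfolding S_def by (rule vec.subspace_sums[OF sub U])
  have dim_S: "vec.dim (S h) + vec.dim (act h std_flag k \<inter> U) = k + vec.dim U" if "h \<in> SL" for h
    using vec.dim_sums_Int[OF sub U, of h] k that
    by (simp add: S_def act_def dim_image_matrix[OF SL_det_nz] dim_std_flag)
  obtain T where T: "vec.subspace T" "vec.dim (S g) + vec.dim T = CARD('m + 'm)" "\<And>z. \<exists>x\<in>S g. \<exists>t\<in>T. z = x + t"
    by (rule exists_complement[OF subS[of g]]) (rule that)
  have "\<exists>x y t. x \<in> std_flag k \<and> y \<in> U \<and> t \<in> T \<and> axis i 1 = g *v x + y + t" for i
    using T(3)[of "axis i 1"] unfolding S_def act_def by blast
  then obtain x y t where xyt: "\<And>i. x i \<in> std_flag k \<and> y i \<in> U \<and> t i \<in> T \<and> axis i 1 = g *v x i + y i + t i"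
    by metis
  define Q where "Q = (\<lambda>h :: 'm cmat. \<chi> r i. (h *v x i + y i + t i) $ r)"
  have "Q g $ r $ i = axis i 1 $ r" for r i using xyt[of i] by (simp add: Q_def)
  then have "Q g = mat 1" by (simp add: vec_eq_iff mat_def axis_def)
  then have "det (Q g) \<noteq> 0" by simp
  moreover have "open {h. det (Q h) \<noteq> 0}"
    unfolding Q_def
    by (intro open_Collect_neq continuous_on_const continuous_on_det)
      (simp, intro continuous_intros continuous_on_matrix_vector)
  moreover have "act h std_flag \<in> {V \<in> flags. vec.dim (V k \<inter> U) \<le> s}" if h: "h \<in> SL" "det (Q h) \<noteq> 0" for h
  proof -
    have "{a + b |a b. a \<in> S h \<and> b \<in> T} = UNIV"
    proof (intro set_eqI iffI UNIV_I)
      fix z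
      obtain c where "z = (\<Sum>i\<in>UNIV. c i *s (h *v x i + y i + t i))"
        by (rule det_nz_expansion[OF h(2)[unfolded Q_def]]) (rule that)
      then have "z = (h *v (\<Sum>i\<in>UNIV. c i *s x i) + (\<Sum>i\<in>UNIV. c i *s y i)) + (\<Sum>i\<in>UNIV. c i *s t i)"
        by (simp add: vec.sum vec.scale vector_add_ldistrib sum.distrib)
      moreover have "(\<Sum>i\<in>UNIV. c i *s x i) \<in> std_flag k" "(\<Sum>i\<in>UNIV. c i *s y i) \<in> U" "(\<Sum>i\<in>UNIV. c i *s t i) \<in> T"
        using xyt U T(1) by (auto intro!: vec.subspace_sum vec.subspace_scale)
      ultimately show "z \<in> {a + b |a b. a \<in> S h \<and> b \<in> T}" unfolding S_def act_def by blast
    qed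
    then have "CARD('m + 'm) \<le> vec.dim (S h) + vec.dim T"
      using vec.dim_sums_Int[OF subS[of h] T(1)] by (simp add: card_cart_basis)
    then have "vec.dim (S g) \<le> vec.dim (S h)" using T(2) by simp
    then have "vec.dim (act h std_flag k \<inter> U) \<le> s"
      using dim_S[OF h(1)] dim_S[OF g(1)] g(2) by simp
    then show ?thesis using SL_act_in_flags[OF h(1)] by simp
  qed
  ultimately show "\<exists>T. open T \<and> g \<in> T \<and> (\<forall>h\<in>SL \<inter> T. act h std_flag \<in> {V \<in> flags. vec.dim (V k \<inter> U) \<le> s})"
    by (intro exI[of _ "{h. det (Q h) \<noteq> 0}"]) auto
qed auto

lemma cell_subset_flags:
  assumes "w permutes {1..2 * CARD('m)}"
  shows "(orbit iwasawa_borel (perm_flag w) :: 'm::enum flag set) \<subseteq> flags"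
  using perm_flag_in_flags[OF assms] by (auto simp: orbit_def intro!: act_in_flags borel_det_nz)

lemma cell_subset_schubert:
  assumes "w permutes {1..2 * CARD('m)}"
  shows "(orbit iwasawa_borel (perm_flag w) :: 'm::enum flag set) \<subseteq> iwasawa_schubert w"
  unfolding iwasawa_schubert_def using cell_subset_flags[OF assms] by (intro closure_of_subset) simp

text \<open>On the cell equality holds, and the flags violating the bound form an open set, which
  would have to meet the cell if it met the closure.\<close>

lemma schubert_dim_ge:
  assumes w: "w permutes {1..2 * CARD('m)}" and V: "(V :: 'm::enum flag) \<in> iwasawa_schubert w"
    and kj: "k \<le> 2 * CARD('m)" "j \<le> 2 * CARD('m)"
  shows "prefix_count w k j \<le> vec.dim (V k \<inter> flag_of u j)"
proof (rule ccontr)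
  assume "\<not> ?thesis"
  then have lt: "vec.dim (V k \<inter> flag_of u j) \<le> prefix_count w k j - 1" "prefix_count w k j \<noteq> 0" by auto
  have VF: "V \<in> flags" using V closure_of_subset_topspace[of flag_topology] by (auto simp: iwasawa_schubert_def)
  let ?O = "{W \<in> (flags :: 'm flag set). vec.dim (W k \<inter> flag_of u j) \<le> prefix_count w k j - 1}"
  have "openin flag_topology ?O" by (rule openin_dim_Int_le[OF subspace_flag_of kj(1)])
  moreover have "V \<in> ?O" using VF lt by simp
  moreover have "\<forall>T. V \<in> T \<and> openin flag_topology T \<longrightarrow> (\<exists>W. W \<in> orbit iwasawa_borel (perm_flag w) \<and> W \<in> T)"
    using V unfolding iwasawa_schubert_def in_closure_of by blast
  ultimately obtain W where "W \<in> orbit iwasawa_borel (perm_flag w)" "W \<in> ?O"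
    by meson
  then have "prefix_count w k j \<le> prefix_count w k j - 1" using dim_cell_Int[OF w _ kj, of W] by simp
  with lt(2) show False by linarith
qed

lemma complex_dim_schubert:
  assumes w: "w permutes {1..2 * CARD('m)}"
  shows "complex_dim (iwasawa_schubert w :: 'm::enum flag set) = card (inversions (2 * CARD('m)) w)"
proof (rule complex_dim_eq[OF complex_submanifold_cell[OF w]])
  let ?S = "orbit iwasawa_borel (perm_flag w) :: 'm flag set"
  let ?n = "2 * CARD('m)"
  let ?O = "(\<Inter>(k, j)\<in>{..?n} \<times> {..?n}. {V \<in> (flags :: 'm flag set). vec.dim (V k \<inter> flag_of u j) \<le> prefix_count w k j})"
  have "mat 1 \<in> (iwasawa_borel :: 'm cmat set)" by (simp add: iwasawa_borel_def SL_def)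
  then show "?S \<noteq> {}" by (auto simp: orbit_def)
  have "(0, 0) \<in> {..?n} \<times> {..?n}" by simp
  then show "openin flag_topology ?O"
    by (intro openin_Inter) (auto intro: openin_dim_Int_le[OF subspace_flag_of])
  show "iwasawa_schubert w \<inter> ?O = ?S"
  proof
    show "?S \<subseteq> iwasawa_schubert w \<inter> ?O"
      using cell_subset_schubert[OF w] cell_subset_flags[OF w] dim_cell_Int[OF w] by fastforce
    show "iwasawa_schubert w \<inter> ?O \<subseteq> ?S"
    proof
      fix V assume V: "V \<in> iwasawa_schubert w \<inter> ?O"
      then have "V \<in> flags" by force
      moreover have "vec.dim (V k \<inter> flag_of u j) = prefix_count w k j" if "k \<le> ?n" "j \<le> ?n" for k j
        using schubert_dim_ge[OF w _ that, of V] V that by (intro antisym) auto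
      ultimately show "V \<in> ?S" by (intro cell_of_dims[OF w])
    qed
  qed
  show "?S \<inter> U \<noteq> {}" if "openin flag_topology U" "iwasawa_schubert w \<inter> U \<noteq> {}" for U
    using that openin_Int_closure_of_eq_empty[of flag_topology U ?S] by (auto simp: iwasawa_schubert_def Int_commute)
qed

lemma complex_dim_closed_orbit:
  assumes "complex_submanifold d S" "S \<noteq> {}"
  shows "complex_dim S = d"
  by (rule complex_dim_eq[OF assms openin_flags]) (use assms in \<open>auto simp: complex_submanifold_def\<close>)

section \<open>Dimensions of the flag manifold and of the base cycle\<close>

definition lower_coords :: "(('m::enum + 'm) \<times> ('m + 'm)) set" where
  "lower_coords = {p. idx (snd p) < idx (fst p)}"

lemma complex_dim_flags: "complex_dim (flags :: 'm::enum flag set) = card (lower_coords :: (('m + 'm) \<times> ('m + 'm)) set)"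
proof (rule complex_dim_closed_orbit)
  show "(flags :: 'm flag set) \<noteq> {}" using std_flag_in_flags by blast
  have iff: "X \<in> strictly_lower \<longleftrightarrow> (\<forall>p. p \<notin> lower_coords \<longrightarrow> X $ p = 0)" for X :: "'m coords"
    by (auto simp: strictly_lower_iff lower_coords_def not_less)
  have "flag_param (mat 1) X \<in> flags" for X :: "'m coords"
    by (simp add: flag_param_eq SL_act_in_flags unip_SL)
  then have set_eq: "{X \<in> strictly_lower. flag_param (mat 1) X \<in> (flags :: 'm flag set)} =
      {X. \<forall>p. p \<notin> lower_coords \<longrightarrow> X $ p = 0}"
    using iff by auto
  show "complex_submanifold (card (lower_coords :: (('m + 'm) \<times> ('m + 'm)) set)) (flags :: 'm flag set)"
  proof (rule complex_submanifold_orbit[of SL _ "mat 1"])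
    show "act h W \<in> flags \<longleftrightarrow> W \<in> flags" if h: "h \<in> SL" for h and W :: "'m flag"
    proof
      obtain h' where h': "h' \<in> SL" "h' ** h = mat 1" using SL_inverse[OF h] by metis
      assume "act h W \<in> flags"
      then have "act h' (act h W) \<in> flags" by (rule act_in_flags[OF SL_det_nz[OF h'(1)]])
      then show "W \<in> flags" unfolding act_mult[symmetric] h'(2) by simp
    qed (rule act_in_flags[OF SL_det_nz[OF h]])
    show "straight_at (card (lower_coords :: (('m + 'm) \<times> ('m + 'm)) set))
        {X \<in> strictly_lower. flag_param (mat 1) X \<in> (flags :: 'm flag set)} 0"
      unfolding set_eq using straight_at_subspace[OF coord_subspace[of lower_coords]]
      by (simp only: dim_substandard_cart)
  qed (simp_all add: flags_eq_orbit SL_def)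
qed

lemma complex_dim_base_cycle:
  "complex_dim (base_cycle :: 'm::enum flag set) = card (isotropic_coords :: (('m + 'm) \<times> ('m + 'm)) set)"
  unfolding base_cycle_eq
  using complex_dim_closed_orbit[OF complex_submanifold_isotropic] base_flag_isotropic by blast

text \<open>The lower positions that are not free correspond to the inversions of the word 1, 3,
  ..., 2m-1, 2m, ..., 4, 2. Its inversions are the pairs \<open>p < q\<close> with
  \<open>p + q\<close> above \<open>2 * m + 1\<close>, and their number is known from
  \<open>card_inversions_paired_perm\<close>.\<close>

lemma codim_base_cycle:
  "CARD('m) * (CARD('m) - 1) + card (isotropic_coords :: (('m::enum + 'm) \<times> ('m + 'm)) set) =
    card (lower_coords :: (('m + 'm) \<times> ('m + 'm)) set)"
proof -
  define M where "M = CARD('m)"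
  define w where "w = paired_perm M id"
  define Eq :: "(('m + 'm) \<times> ('m + 'm)) set" where
    "Eq = {p. idx (snd p) < idx (fst p) \<and> 2 * M + 1 < idx (fst p) + idx (snd p)}"
  have inv: "inversions (2 * M) w = {(p, q). p < q \<and> q \<le> 2 * M \<and> 2 * M + 1 < p + q}"
  proof -
    have "(1 \<le> p \<and> p < q \<and> q \<le> 2 * M \<and> w q < w p) \<longleftrightarrow> (p < q \<and> q \<le> 2 * M \<and> 2 * M + 1 < p + q)" for p q
      unfolding w_def paired_perm_def by auto
    then show ?thesis by (auto simp: inversions_def)
  qed
  have "bij_betw (\<lambda>p. (idx (snd p), idx (fst p))) Eq (inversions (2 * M) w)"
  proof (rule bij_betw_byWitness[where f' = "\<lambda>(p, q). (coord q, coord p)"])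
    show "(\<lambda>p. (idx (snd p), idx (fst p))) ` Eq \<subseteq> inversions (2 * M) w"
      unfolding inv by (auto simp: Eq_def M_def add.commute)
    show "(\<lambda>(p, q). (coord q, coord p)) ` inversions (2 * M) w \<subseteq> Eq"
      unfolding inv by (auto simp: Eq_def M_def)
    show "\<forall>a'\<in>inversions (2 * M) w. (idx (snd (case a' of (p, q) \<Rightarrow> (coord q :: 'm + 'm, coord p :: 'm + 'm))),
        idx (fst (case a' of (p, q) \<Rightarrow> (coord q :: 'm + 'm, coord p :: 'm + 'm)))) = a'"
      unfolding inv by (auto simp: M_def)
  qed auto
  then have "card Eq = card (inversions (2 * M) w)" by (rule bij_betw_same_card)
  also have "\<dots> = M * (M - 1)"
    unfolding w_def by (rule card_inversions_paired_perm[OF permutes_id]) (simp add: M_def Suc_le_eq)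
  finally have card_Eq: "card Eq = M * (M - 1)" .
  have "(lower_coords :: (('m + 'm) \<times> ('m + 'm)) set) = Eq \<union> isotropic_coords" "Eq \<inter> isotropic_coords = {}"
    by (auto simp: lower_coords_def Eq_def isotropic_coords_def M_def)
  moreover from this(2) have "card (Eq \<union> isotropic_coords) = card Eq + card (isotropic_coords :: (('m + 'm) \<times> ('m + 'm)) set)"
    by (intro card_Un_disjoint) simp_all
  ultimately have "card (lower_coords :: (('m + 'm) \<times> ('m + 'm)) set) = card Eq + card (isotropic_coords :: (('m + 'm) \<times> ('m + 'm)) set)"
    by (simp only:)
  then show ?thesis using card_Eq by (simp add: M_def)
qed

section \<open>Intersection with the base cycle\<close>

text \<open>Inside the j-stable space \<open>?U\<close> of dimension \<open>2 * j\<close>, the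
  subspaces coming from \<open>V k\<close> and from the j-image of \<open>V (n - k)\<close> are
  independent, so their dimensions add up to at most \<open>2 * j\<close>.\<close>

lemma opposite_prefix_count:
  assumes v: "v permutes {1..2 * CARD('m)}" and V: "(V :: 'm::enum flag) \<in> orbit iwasawa_borel (perm_flag v)"
    and opp: "V \<in> opposite_flags" and k: "k \<le> 2 * CARD('m)" and j: "j \<le> CARD('m)"
  shows "prefix_count v k (2 * j) + prefix_count v (2 * CARD('m) - k) (2 * j) \<le> 2 * j"
proof -
  let ?U = "flag_of u (2 * j) :: 'm cvec set"
  have VF: "V \<in> flags" using opp by (simp add: opposite_flags_def)
  have j_U: "jmap x \<in> ?U" if "x \<in> ?U" for x
  proof -
    have gen: "jmap (u a) \<in> ?U" if a: "a \<in> {1..min (2 * j) (2 * CARD('m))}" for a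
    proof -
      have a': "a \<in> {1..2 * CARD('m)}" using a by auto
      show ?thesis
      proof (cases "odd a")
        case True
        then have "a + 1 \<in> {1..min (2 * j) (2 * CARD('m))}" using a odd_bound[of a j] odd_bound[of a "CARD('m)"] by simp
        then show ?thesis using True by (auto simp: jmap_u[OF a'] flag_of_def intro!: vec.span_base)
      next
        case False
        then have "a - 1 \<in> {1..min (2 * j) (2 * CARD('m))}" using a even_bound[of a] by auto
        then show ?thesis using False
          by (auto simp: jmap_u[OF a'] flag_of_def intro!: vec.span_base vec.span_neg)
      qed
    qed
    have "x \<in> vec.span (u ` {1..min (2 * j) (2 * CARD('m))})" using that by (simp add: flag_of_def)
    then show ?thesis
    proof (induction rule: vec.span_induct_alt)
      case base
      then show ?case by (simp add: vec.subspace_0 subspace_flag_of)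
    next
      case (step c x y)
      then show ?case unfolding jmap_add jmap_scale
        by (intro vec.subspace_add[OF subspace_flag_of] vec.subspace_scale[OF subspace_flag_of]) (auto intro: gen)
    qed
  qed
  let ?A = "V k \<inter> ?U" and ?B = "V (2 * CARD('m) - k) \<inter> ?U"
  have subA: "vec.subspace ?A" and subB: "vec.subspace ?B"
    by (rule vec.subspace_inter[OF flags_subspace[OF VF] subspace_flag_of])+
  have "V k \<inter> jmap ` V (2 * CARD('m) - k) = {0}" using opp k by (simp add: opposite_flags_def)
  then have "?A \<inter> jmap ` ?B \<subseteq> {0}" by blast
  then have 0: "vec.dim (?A \<inter> jmap ` ?B) = 0" by (simp only: vec.dim_eq_0)
  have "vec.dim ?A + vec.dim ?B = vec.dim ?A + vec.dim (jmap ` ?B)" by (simp add: dim_jmap_image[OF subB])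
  also have "\<dots> = vec.dim {x + y |x y. x \<in> ?A \<and> y \<in> jmap ` ?B}"
    using vec.dim_sums_Int[OF subA subspace_jmap_image[OF subB]] 0 by simp
  also have "\<dots> \<le> vec.dim ?U"
    by (rule vec.dim_subset) (auto intro!: vec.subspace_add[OF subspace_flag_of] j_U)
  also have "\<dots> = min (2 * j) (2 * CARD('m))" by (rule flags_dim[OF flag_of_in_flags[OF det_frame_u]])
  also have "\<dots> = 2 * j" using j by simp
  finally show ?thesis using dim_cell_Int[OF v V] k j by simp
qed

text \<open>\<open>omega\<close> pairs only partners, and partners sit at mirror positions, whose
  sum is \<open>n + 1\<close>; isotropy concerns positions with sum at most
  \<open>n\<close>.\<close>

lemma paired_perm_flag_isotropic:
  assumes s: "s permutes {1..CARD('m)}"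
  shows "perm_flag (paired_perm CARD('m) s) \<in> (isotropic_flags :: 'm::enum flag set)"
proof -
  let ?w = "paired_perm CARD('m) s"
  have w: "?w permutes {1..2 * CARD('m)}" by (rule paired_perm_permutes[OF s])
  have "omega (u (?w k)) (u (?w l) :: 'm cvec) = 0" if kl: "1 \<le> k" "1 \<le> l" "k + l \<le> 2 * CARD('m)" for k l
  proof (rule ccontr)
    assume nz: "omega (u (?w k)) (u (?w l) :: 'm cvec) \<noteq> 0"
    have kl': "k \<in> {1..2 * CARD('m)}" "l \<in> {1..2 * CARD('m)}" using kl by auto
    have "k \<noteq> l" using nz omega_commute[of "u (?w k) :: 'm cvec" "u (?w k)"] by auto
    have sr: "s i \<in> {1..CARD('m)}" if "i \<in> {1..CARD('m)}" for i using permuted_range[OF s that] .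
    have cls: "(?w i + 1) div 2 = s (if i \<le> CARD('m) then i else 2 * CARD('m) + 1 - i)" if i: "i \<in> {1..2 * CARD('m)}" for i
    proof (cases "i \<le> CARD('m)")
      case True
      then show ?thesis using i sr[of i] by (auto simp: paired_perm_def)
    next
      case False
      then have "2 * CARD('m) + 1 - i \<in> {1..CARD('m)}" using i by auto
      from sr[OF this] show ?thesis using i False by (auto simp: paired_perm_def)
    qed
    have "(if k \<le> CARD('m) then k else 2 * CARD('m) + 1 - k) = (if l \<le> CARD('m) then l else 2 * CARD('m) + 1 - l)"
      using omega_u_nonzero[OF permuted_range[OF w kl'(1)] permuted_range[OF w kl'(2)] nz]
      unfolding cls[OF kl'(1)] cls[OF kl'(2)] permuted_inj[OF s] .
    then show False using kl \<open>k \<noteq> l\<close> by (auto split: if_splits)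
  qed
  then show ?thesis
    unfolding perm_flag_def using perm_flag_in_flags[OF w]
    by (subst isotropic_flag_of_iff) (auto simp: perm_flag_def)
qed

lemma prefix_count_large:
  assumes "w permutes {1..n}" "k \<le> n" "n \<le> j"
  shows "prefix_count w k j = k"
proof -
  have "w i \<le> j" if "i \<in> {1..k}" for i
    using permuted_range[OF assms(1), of i] that assms(2,3) by auto
  then have "{i \<in> {1..k}. w i \<le> j} = {1..k}" by auto
  then show ?thesis by (simp add: prefix_count_def)
qed

lemma schubert_prefix_count:
  assumes w: "w permutes {1..2 * CARD('m)}" and v: "v permutes {1..2 * CARD('m)}"
    and V: "(V :: 'm::enum flag) \<in> orbit iwasawa_borel (perm_flag v)" "V \<in> iwasawa_schubert w"
    and k: "k \<le> 2 * CARD('m)"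
  shows "prefix_count w k j \<le> prefix_count v k j"
proof (cases "j \<le> 2 * CARD('m)")
  case True
  then show ?thesis using schubert_dim_ge[OF w V(2) k True] dim_cell_Int[OF v V(1) k True] by simp
next
  case False
  then show ?thesis using prefix_count_large[OF w k, of j] prefix_count_large[OF v k, of j] by simp
qed

lemma perm_flag_in_cell: "perm_flag w \<in> orbit iwasawa_borel (perm_flag w)"
proof -
  have "mat 1 \<in> (iwasawa_borel :: 'a::enum cmat set)" by (simp add: iwasawa_borel_def SL_def)
  then show ?thesis unfolding orbit_def by (metis act_one image_eqI)
qed

text \<open>Each variety contains the coordinate flag of the other, so the rank inequalities hold in
  both directions.\<close>

lemma iwasawa_schubert_inj:
  assumes w: "w permutes {1..2 * CARD('m)}" and v: "v permutes {1..2 * CARD('m)}"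
    and eq: "(iwasawa_schubert w :: 'm::enum flag set) = iwasawa_schubert v"
  shows "w = v"
proof -
  have "(perm_flag v :: 'm flag) \<in> iwasawa_schubert w" "(perm_flag w :: 'm flag) \<in> iwasawa_schubert v"
    using cell_subset_schubert[OF v] cell_subset_schubert[OF w] perm_flag_in_cell eq by blast+
  then have "prefix_count w k j = prefix_count v k j" if "k \<le> 2 * CARD('m)" for k j
    using schubert_prefix_count[OF w v perm_flag_in_cell _ that] schubert_prefix_count[OF v w perm_flag_in_cell _ that]
    by (intro antisym) blast+
  then have "\<forall>i\<in>{1..2 * CARD('m)}. w i = v i" by (rule prefix_count_inject)
  then show ?thesis using w v by (metis ext permutes_not_in)
qed

lemma complementary_schubert_iff:
  assumes w: "w permutes {1..2 * CARD('m)}"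
  shows "complex_dim (iwasawa_schubert w :: 'm::enum flag set) + complex_dim (base_cycle :: 'm flag set)
       = complex_dim (flags :: 'm flag set) \<and> (iwasawa_schubert w :: 'm flag set) \<inter> base_cycle \<noteq> {} \<longleftrightarrow>
    (\<exists>s. s permutes {1..CARD('m)} \<and> w = paired_perm CARD('m) s)"
proof -
  have M: "1 \<le> CARD('m)" by (simp add: Suc_le_eq)
  have dim: "complex_dim (iwasawa_schubert w :: 'm flag set) + complex_dim (base_cycle :: 'm flag set)
       = complex_dim (flags :: 'm flag set) \<longleftrightarrow> card (inversions (2 * CARD('m)) w) = CARD('m) * (CARD('m) - 1)"
    using codim_base_cycle[where ?'m = 'm]
    unfolding complex_dim_schubert[OF w] complex_dim_base_cycle complex_dim_flags by linarith
  show ?thesis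
    unfolding dim unfolding base_cycle_eq
  proof
    assume L: "card (inversions (2 * CARD('m)) w) = CARD('m) * (CARD('m) - 1) \<and>
      (iwasawa_schubert w :: 'm flag set) \<inter> isotropic_flags \<noteq> {}"
    then obtain V :: "'m flag" where V: "V \<in> iwasawa_schubert w" "V \<in> isotropic_flags" by blast
    have VF: "V \<in> flags" using V(2) by (simp add: isotropic_flags_def)
    obtain v where v: "v permutes {1..2 * CARD('m)}" "V \<in> orbit iwasawa_borel (perm_flag v)"
      by (rule flags_covered_by_cells[OF VF])
    have "V \<in> opposite_flags" using V(2) isotropic_subset_opposite by blast
    then have lb: "CARD('m) * (CARD('m) - 1) \<le> card (inversions (2 * CARD('m)) v)"
      "card (inversions (2 * CARD('m)) v) = CARD('m) * (CARD('m) - 1) \<longrightarrow>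
        (\<exists>s. s permutes {1..CARD('m)} \<and> v = paired_perm CARD('m) s)"
      using inversions_lower_bound[OF v(1) M] opposite_prefix_count[OF v] by blast+
    have mono: "card (inversions (2 * CARD('m)) v) \<le> card (inversions (2 * CARD('m)) w) \<and>
      (card (inversions (2 * CARD('m)) v) = card (inversions (2 * CARD('m)) w) \<longrightarrow> (\<forall>i\<in>{1..2 * CARD('m)}. v i = w i))"
    proof (rule card_inversions_mono)
      show "prefix_count w k j \<le> prefix_count v k j" if "k \<le> 2 * CARD('m)" for k j
        by (rule schubert_prefix_count[OF w v V(1) that])
      show "prefix_count w (2 * CARD('m)) j = prefix_count v (2 * CARD('m)) j" for j
      proof (cases "j \<le> 2 * CARD('m)")
        case True
        then show ?thesis using prefix_count_total[OF w] prefix_count_total[OF v(1)] by simp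
      next
        case False
        then show ?thesis using prefix_count_large[OF w] prefix_count_large[OF v(1)] by simp
      qed
    qed
    \<comment> \<open>The number m(m-1) bounds the inversions of \<open>v\<close> from below, and
      those of \<open>w\<close> bound them from above; so \<open>v\<close> attains both bounds, and
      the two equality cases give \<open>v = w\<close> and the paired form.\<close>
    have eq: "card (inversions (2 * CARD('m)) v) = CARD('m) * (CARD('m) - 1)" using lb(1) mono L by linarith
    then have "\<forall>i\<in>{1..2 * CARD('m)}. v i = w i" using mono L by simp
    then have "v = w" using v(1) w by (metis ext permutes_not_in)
    then show "\<exists>s. s permutes {1..CARD('m)} \<and> w = paired_perm CARD('m) s" using lb(2) eq by blast
  next
    assume "\<exists>s. s permutes {1..CARD('m)} \<and> w = paired_perm CARD('m) s"
    then obtain s where s: "s permutes {1..CARD('m)}" "w = paired_perm CARD('m) s" by blast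
    have "perm_flag w \<in> (iwasawa_schubert w :: 'm flag set)"
      using cell_subset_schubert[OF w] perm_flag_in_cell by blast
    then have "(iwasawa_schubert w :: 'm flag set) \<inter> isotropic_flags \<noteq> {}"
      using paired_perm_flag_isotropic[OF s(1)] s(2) by blast
    moreover have "card (inversions (2 * CARD('m)) w) = CARD('m) * (CARD('m) - 1)"
      unfolding s(2) by (rule card_inversions_paired_perm[OF s(1) M])
    ultimately show "card (inversions (2 * CARD('m)) w) = CARD('m) * (CARD('m) - 1) \<and>
      (iwasawa_schubert w :: 'm flag set) \<inter> isotropic_flags \<noteq> {}" by blast
  qed
qed

lemma paired_perm_inj:
  assumes "s permutes {1..m}" "t permutes {1..m}" "paired_perm m s = paired_perm m t"
  shows "s = t"
proof
  fix i
  show "s i = t i"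
  proof (cases "i \<in> {1..m}")
    case True
    then have "2 * s i - 1 = 2 * t i - 1" using fun_cong[OF assms(3), of i] by (simp add: paired_perm_def)
    then show ?thesis using permuted_range[OF assms(1) True] permuted_range[OF assms(2) True] by auto
  next
    case False
    then show ?thesis using assms(1,2) by (simp add: permutes_not_in)
  qed
qed

text \<open>The inverse formula is stated over the reals, so that \<open>(w i + 1) / 2\<close> is
  exact division and the existence of \<open>s\<close> also records that the first \<open>m\<close>
  entries of \<open>w\<close> are odd.\<close>

theorem corollary24:
  fixes m :: nat
  assumes m: "m = CARD('m::enum)"
  shows "(\<forall>s. s permutes {1..m} \<longrightarrow> paired_perm m s permutes {1..2 * m})
       \<and> bij_betw (\<lambda>s. iwasawa_schubert (paired_perm m s))
           {s. s permutes {1..m}} (complementary_schubert_set :: 'm flag set set)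
       \<and> (\<forall>w. w permutes {1..2 * m} \<and>
              iwasawa_schubert w \<in> (complementary_schubert_set :: 'm flag set set) \<longrightarrow>
            (\<exists>!s. s permutes {1..m} \<and> (\<forall>i\<in>{1..m}. real (s i) = (real (w i) + 1) / 2)) \<and>
            (\<forall>s. s permutes {1..m} \<and> (\<forall>i\<in>{1..m}. real (s i) = (real (w i) + 1) / 2) \<longrightarrow>
               w = paired_perm m s))
       \<and> card (complementary_schubert_set :: 'm flag set set) = fact m"
proof -
  let ?C = "complementary_schubert_set :: 'm flag set set"
  have C_eq: "?C = {iwasawa_schubert (paired_perm m s) |s. s permutes {1..m}}"
  proof -
    have "?C = {iwasawa_schubert w |w. w permutes {1..2 * m} \<and> (\<exists>s. s permutes {1..m} \<and> w = paired_perm m s)}"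
      unfolding complementary_schubert_set_def using complementary_schubert_iff[where ?'m = 'm] unfolding m by blast
    then show ?thesis using paired_perm_permutes by blast
  qed
  have inj: "w = v" if "w permutes {1..2 * m}" "v permutes {1..2 * m}"
    "(iwasawa_schubert w :: 'm flag set) = iwasawa_schubert v" for w v
    using iwasawa_schubert_inj[where ?'m = 'm] that unfolding m by blast
  have bij: "bij_betw (\<lambda>s. iwasawa_schubert (paired_perm m s)) {s. s permutes {1..m}} ?C"
  proof (rule bij_betw_imageI)
    show "inj_on (\<lambda>s. iwasawa_schubert (paired_perm m s) :: 'm flag set) {s. s permutes {1..m}}"
    proof (rule inj_onI)
      fix s t assume st: "s \<in> {s. s permutes {1..m}}" "t \<in> {s. s permutes {1..m}}"
        "(iwasawa_schubert (paired_perm m s) :: 'm flag set) = iwasawa_schubert (paired_perm m t)"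
      then have "paired_perm m s = paired_perm m t" by (intro inj paired_perm_permutes) simp_all
      then show "s = t" using paired_perm_inj st by blast
    qed
    show "(\<lambda>s. iwasawa_schubert (paired_perm m s)) ` {s. s permutes {1..m}} = ?C"
      unfolding C_eq by auto
  qed
  have conv: "(\<exists>!s. s permutes {1..m} \<and> (\<forall>i\<in>{1..m}. real (s i) = (real (w i) + 1) / 2)) \<and>
      (\<forall>s. s permutes {1..m} \<and> (\<forall>i\<in>{1..m}. real (s i) = (real (w i) + 1) / 2) \<longrightarrow> w = paired_perm m s)"
    if w: "w permutes {1..2 * m}" "iwasawa_schubert w \<in> ?C" for w
  proof -
    obtain s where s: "s permutes {1..m}" "(iwasawa_schubert w :: 'm flag set) = iwasawa_schubert (paired_perm m s)"
      using w(2) unfolding C_eq by blast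
    have w_eq: "w = paired_perm m s" using inj[OF w(1) paired_perm_permutes[OF s(1)] s(2)] .
    have s_half: "real (s i) = (real (w i) + 1) / 2" if i: "i \<in> {1..m}" for i
      using permuted_range[OF s(1) i] i by (auto simp: w_eq paired_perm_def of_nat_diff)
    have uniq: "t = s" if t: "t permutes {1..m}" "\<forall>i\<in>{1..m}. real (t i) = (real (w i) + 1) / 2" for t
    proof
      fix i
      show "t i = s i"
      proof (cases "i \<in> {1..m}")
        case True
        then have "real (t i) = (real (w i) + 1) / 2" using t(2) by blast
        then have "real (t i) = real (s i)" unfolding s_half[OF True] .
        then show ?thesis by simp
      next
        case False
        then show ?thesis using t(1) s(1) by (simp add: permutes_not_in)
      qed
    qed
    show ?thesis using s(1) s_half uniq w_eq by blast
  qed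
  have "card ?C = card {s. s permutes {1..m}}" using bij by (simp add: bij_betw_same_card)
  also have "\<dots> = fact m" by (simp add: card_permutations)
  finally show ?thesis using bij conv paired_perm_permutes by blast
qed

end
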